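(* Let $R$ be a Noetherian ring and $I$ an ideal in $R$. The set $\mathcal{L}(I)=\{P\in\mathrm{Spec}(R): I_P\text{ is of linear type}\}$ is an open set in $\mathrm{Spec}(R)$. More precisely, $\mathcal{L}(I)=\mathrm{Spec}(R)\setminus V(C(I))$.
   Context: All rings are commutative with unit. $V(\mathfrak{a})$ is the set of primes containing $\mathfrak{a}$; $I_P$ is the localization, an ideal of $R_P$. For a Noetherian ring $R$ and an ideal $I=(f_1,\ldots,f_m)\subseteq R$, let $\mathcal{R}(I)=R[f_1t,\ldots,f_mt]\subseteq R[t]$ be the Rees algebra, $T=R[y_1,\ldots,y_m]$ a polynomial ring, $\varphi:T\to\mathcal{R}(I)$ the $R$-algebra homomorphism with $\varphi(y_j)=f_jt$, and $J=\ker\varphi$. Let $L\subseteq J$ be the ideal of $T$ generated by all linear relations $\sum_{i=1}^m a_iy_i$ with $a_i\in R$ and $\sum_i a_if_i=0$. Then $T/L\cong S(I)$ is the symmetric algebra of $I$, and the kernel of the canonical epimorphism $\alpha:S(I)\to\mathcal{R}(I)$ is $J/L$. The conductor of $I$ is the ideal $C(I)=L:_RJ=\{r\in R: rJ\subseteq L\}=\mathrm{Ann}_R(\ker\alpha)$ of $R$; it does not depend on the chosen generators. The ideal $I$ is of linear type if $J=L$, equivalently $C(I)=R$. *)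

theory Defs
  imports
    "HOL-Algebra.Indexed_Polynomials"
    "HOL-Algebra.UnivPoly"
    "HOL-Algebra.Generated_Rings"
    "HOL-Analysis.Abstract_Topology"
begin

definition Spec :: "('a, 'm) ring_scheme \<Rightarrow> 'a set set" where
  "Spec R = {P. primeideal P R}"

definition zeros :: "('a, 'm) ring_scheme \<Rightarrow> 'a set \<Rightarrow> 'a set set" where
  "zeros R A = {P \<in> Spec R. A \<subseteq> P}"

definition zariski_topology :: "('a, 'm) ring_scheme \<Rightarrow> 'a set topology" where
  "zariski_topology R = topology (\<lambda>U. \<exists>A. ideal A R \<and> U = Spec R - zeros R A)"

lemma (in cring) istopology_zariski:
  "istopology (\<lambda>U. \<exists>A. ideal A R \<and> U = Spec R - zeros R A)"
  unfolding istopology_def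
proof (intro conjI allI impI)
  fix U V
  assume "\<exists>A. ideal A R \<and> U = Spec R - zeros R A" "\<exists>B. ideal B R \<and> V = Spec R - zeros R B"
  then obtain A B where A: "ideal A R" "U = Spec R - zeros R A"
    and B: "ideal B R" "V = Spec R - zeros R B"
    by blast
  have "A \<subseteq> P \<or> B \<subseteq> P" if P: "P \<in> Spec R" and AB: "A \<inter> B \<subseteq> P" for P
  proof (rule ccontr)
    assume "\<not> ?thesis"
    then obtain a b where ab: "a \<in> A" "a \<notin> P" "b \<in> B" "b \<notin> P"
      by blast
    have c: "a \<in> carrier R" "b \<in> carrier R"
      using ideal.Icarr[OF A(1) ab(1)] ideal.Icarr[OF B(1) ab(3)] .
    have "a \<otimes> b \<in> P"
      using ideal.I_r_closed[OF A(1) ab(1) c(2)] ideal.I_l_closed[OF B(1) ab(3) c(1)] AB by auto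
    moreover have "primeideal P R"
      using P by (simp add: Spec_def)
    ultimately show False
      using primeideal.I_prime[of P R a b] c ab by simp
  qed
  then have "U \<inter> V = Spec R - zeros R (A \<inter> B)"
    unfolding A(2) B(2) zeros_def by blast
  then show "\<exists>C. ideal C R \<and> U \<inter> V = Spec R - zeros R C"
    using i_intersect[OF A(1) B(1)] by blast
next
  fix K
  assume "\<forall>U\<in>K. \<exists>A. ideal A R \<and> U = Spec R - zeros R A"
  then have "\<exists>f. \<forall>U\<in>K. ideal (f U) R \<and> U = Spec R - zeros R (f U)"
    by (rule bchoice)
  then obtain f where f: "\<And>U. U \<in> K \<Longrightarrow> ideal (f U) R"
    "\<And>U. U \<in> K \<Longrightarrow> U = Spec R - zeros R (f U)"
    by blast
  have sub: "(\<Union>U\<in>K. f U) \<subseteq> carrier R"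
    using ideal.Icarr[OF f(1)] by auto
  have "Idl (\<Union>U\<in>K. f U) \<subseteq> P \<longleftrightarrow> (\<Union>U\<in>K. f U) \<subseteq> P" if "P \<in> Spec R" for P
    using Idl_subset_ideal[OF primeideal.axioms(1) sub, of P] that by (simp add: Spec_def)
  then have "zeros R (Idl (\<Union>U\<in>K. f U)) = {P \<in> Spec R. \<forall>U\<in>K. P \<in> zeros R (f U)}"
    unfolding zeros_def by auto
  moreover have "\<Union>K = (\<Union>U\<in>K. Spec R - zeros R (f U))"
    using f(2) by auto
  ultimately have "\<Union>K = Spec R - zeros R (Idl (\<Union>U\<in>K. f U))"
    by auto
  then show "\<exists>C. ideal C R \<and> \<Union>K = Spec R - zeros R C"
    using genideal_ideal[OF sub] by blast
qed

lemma (in cring) openin_zariski: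
  "openin (zariski_topology R) U \<longleftrightarrow> (\<exists>A. ideal A R \<and> U = Spec R - zeros R A)"
  unfolding zariski_topology_def by (simp add: istopology_zariski)

definition frac_rel :: "('a, 'm) ring_scheme \<Rightarrow> 'a set \<Rightarrow> (('a \<times> 'a) \<times> ('a \<times> 'a)) set" where
  "frac_rel R S =
    {((a, s), (b, t)) | a s b t. a \<in> carrier R \<and> s \<in> S \<and> b \<in> carrier R \<and> t \<in> S \<and>
       (\<exists>u\<in>S. u \<otimes>\<^bsub>R\<^esub> (t \<otimes>\<^bsub>R\<^esub> a \<ominus>\<^bsub>R\<^esub> s \<otimes>\<^bsub>R\<^esub> b) = \<zero>\<^bsub>R\<^esub>)}"

definition frac :: "('a, 'm) ring_scheme \<Rightarrow> 'a set \<Rightarrow> 'a \<Rightarrow> 'a \<Rightarrow> ('a \<times> 'a) set" where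
  "frac R S a s = frac_rel R S `` {(a, s)}"

text \<open>
  The unions below range over representatives of the two classes; as the operations respect
  \<^const>\<open>frac_rel\<close>, all the sets that are united coincide (see \<^theory>\<open>HOL.Equiv_Relations\<close>).
\<close>

definition localization :: "('a, 'm) ring_scheme \<Rightarrow> 'a set \<Rightarrow> ('a \<times> 'a) set ring" where
  "localization R S = \<lparr>
     carrier = (carrier R \<times> S) // frac_rel R S,
     monoid.mult = (\<lambda>A B. \<Union>(a, s)\<in>A. \<Union>(b, t)\<in>B. frac R S (a \<otimes>\<^bsub>R\<^esub> b) (s \<otimes>\<^bsub>R\<^esub> t)),
     one = frac R S \<one>\<^bsub>R\<^esub> \<one>\<^bsub>R\<^esub>,
     zero = frac R S \<zero>\<^bsub>R\<^esub> \<one>\<^bsub>R\<^esub>,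
     add = (\<lambda>A B. \<Union>(a, s)\<in>A. \<Union>(b, t)\<in>B.
              frac R S (t \<otimes>\<^bsub>R\<^esub> a \<oplus>\<^bsub>R\<^esub> s \<otimes>\<^bsub>R\<^esub> b) (s \<otimes>\<^bsub>R\<^esub> t))\<rparr>"

definition local_ring_at :: "('a, 'm) ring_scheme \<Rightarrow> 'a set \<Rightarrow> ('a \<times> 'a) set ring" where
  "local_ring_at R P = localization R (carrier R - P)"

definition local_ideal_at :: "('a, 'm) ring_scheme \<Rightarrow> 'a set \<Rightarrow> 'a set \<Rightarrow> ('a \<times> 'a) set set" where
  "local_ideal_at R P I = {frac R (carrier R - P) a s | a s. a \<in> I \<and> s \<in> carrier R - P}"

text \<open>
  A polynomial maps each monomial, a multiset of variables, to its coefficient; the variables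
  of \<open>mpoly_ring R n\<close> are indexed by \<open>0, \<dots>, n - 1\<close>.
\<close>

definition mpoly_ring :: "('a, 'm) ring_scheme \<Rightarrow> nat \<Rightarrow> (nat multiset \<Rightarrow> 'a) ring" where
  "mpoly_ring R n = \<lparr>
     carrier = ring.indexed_pset R {..<n} (carrier R),
     monoid.mult = (\<lambda>F G \<mu>. \<Oplus>\<^bsub>R\<^esub>\<nu>\<in>{\<nu>. \<nu> \<subseteq># \<mu>}. F \<nu> \<otimes>\<^bsub>R\<^esub> G (\<mu> - \<nu>)),
     one = ring.indexed_const R \<one>\<^bsub>R\<^esub>,
     zero = ring.indexed_const R \<zero>\<^bsub>R\<^esub>,
     add = ring.indexed_padd R\<rparr>"

text \<open>
  A finite sequence of generators is a list \<open>fs\<close>; the variable \<open>j < length fs\<close>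
  corresponds to the generator \<open>fs ! j\<close>.
\<close>

definition generators :: "('a, 'm) ring_scheme \<Rightarrow> 'a list \<Rightarrow> 'a set \<Rightarrow> bool" where
  "generators R fs I \<longleftrightarrow> set fs \<subseteq> carrier R \<and> I = Idl\<^bsub>R\<^esub> (set fs)"

definition rees_algebra :: "('a, 'm) ring_scheme \<Rightarrow> 'a list \<Rightarrow> ('a, nat \<Rightarrow> 'a) up_ring" where
  "rees_algebra R fs = (UP R)\<lparr>carrier :=
     generate_ring (UP R)
       ((\<lambda>a. monom (UP R) a 0) ` carrier R \<union> (\<lambda>f. monom (UP R) f 1) ` set fs)\<rparr>"

text \<open>
  The \<open>R\<close>-algebra homomorphism with \<open>y\<^sub>j \<mapsto> f\<^sub>j t\<close>, i.e.
  \<open>\<Sum>\<^sub>\<mu> c\<^sub>\<mu> y\<^sup>\<mu> \<mapsto> \<Sum>\<^sub>\<mu> c\<^sub>\<mu> \<Prod>\<^sub>j (f\<^sub>j t)^\<mu>\<^sub>j\<close>.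
\<close>

definition rees_map ::
    "('a, 'm) ring_scheme \<Rightarrow> 'a list \<Rightarrow> (nat multiset \<Rightarrow> 'a) \<Rightarrow> (nat \<Rightarrow> 'a)" where
  "rees_map R fs F =
     (\<Oplus>\<^bsub>UP R\<^esub>\<mu>\<in>{\<mu>. F \<mu> \<noteq> \<zero>\<^bsub>R\<^esub>}.
        monom (UP R) (F \<mu>) 0 \<otimes>\<^bsub>UP R\<^esub>
        (\<Otimes>\<^bsub>UP R\<^esub>j\<in>set_mset \<mu>. monom (UP R) (fs ! j) 1 [^]\<^bsub>UP R\<^esub> count \<mu> j))"

definition rees_ideal :: "('a, 'm) ring_scheme \<Rightarrow> 'a list \<Rightarrow> (nat multiset \<Rightarrow> 'a) set" where
  "rees_ideal R fs = a_kernel (mpoly_ring R (length fs)) (rees_algebra R fs) (rees_map R fs)"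

definition linear_relations :: "('a, 'm) ring_scheme \<Rightarrow> 'a list \<Rightarrow> (nat multiset \<Rightarrow> 'a) set" where
  "linear_relations R fs =
     {\<Oplus>\<^bsub>mpoly_ring R (length fs)\<^esub>i\<in>{..<length fs}.
        ring.indexed_const R (a i) \<otimes>\<^bsub>mpoly_ring R (length fs)\<^esub> ring.indexed_var R i
      | a. a \<in> {..<length fs} \<rightarrow> carrier R \<and>
           (\<Oplus>\<^bsub>R\<^esub>i\<in>{..<length fs}. a i \<otimes>\<^bsub>R\<^esub> fs ! i) = \<zero>\<^bsub>R\<^esub>}"

definition linear_ideal :: "('a, 'm) ring_scheme \<Rightarrow> 'a list \<Rightarrow> (nat multiset \<Rightarrow> 'a) set" where
  "linear_ideal R fs = Idl\<^bsub>mpoly_ring R (length fs)\<^esub> (linear_relations R fs)"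

definition conductor :: "('a, 'm) ring_scheme \<Rightarrow> 'a list \<Rightarrow> 'a set" where
  "conductor R fs =
     {r \<in> carrier R. \<forall>F\<in>rees_ideal R fs.
        ring.indexed_const R r \<otimes>\<^bsub>mpoly_ring R (length fs)\<^esub> F \<in> linear_ideal R fs}"

text \<open>
  The condition on \<open>fs\<close> holds for one finite sequence of generators iff it holds for all of them;
  the existential form excludes ideals that are not finitely generated.
\<close>

definition linear_type :: "('a, 'm) ring_scheme \<Rightarrow> 'a set \<Rightarrow> bool" where
  "linear_type R I \<longleftrightarrow> (\<exists>fs. generators R fs I \<and> rees_ideal R fs = linear_ideal R fs)"

definition linear_type_locus :: "('a, 'm) ring_scheme \<Rightarrow> 'a set \<Rightarrow> 'a set set" where
  "linear_type_locus R I =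
     {P \<in> Spec R. linear_type (local_ring_at R P) (local_ideal_at R P I)}"

end

theory Submission
  imports Defs
begin

text \<open>
  Fix generators of \<open>I\<close> and write \<open>J\<close> and \<open>L\<close> for the ideals of the polynomial ring \<open>T\<close> from the
  definition of the conductor. Formation of \<open>J\<close> and \<open>L\<close> commutes with localization at a
  multiplicative set \<open>M\<close>, so if the localizations of \<open>J\<close> and \<open>L\<close> agree, every element of \<open>J\<close> is
  multiplied into \<open>L\<close> by some element of \<open>M\<close>. As \<open>T\<close> is Noetherian, \<open>J\<close> is finitely generated and a
  single element of \<open>M\<close> suffices, i.e. \<open>M\<close> meets the conductor; the converse is clear. Being of
  linear type does not depend on the generators: two systems of generators are related by linear
  substitutions in both directions whose composite is the identity modulo linear relations.
\<close>

text \<open>Being of linear type is an existential statement about generators over the local ring,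
  and these need not come from \<open>R\<close>; independence of the generators reduces it to the
  images of a fixed list over \<open>R\<close>. An identity over the localization only says that the
  difference of two elements over \<open>R\<close> is killed by some element of \<open>M\<close>.
  Passing back to \<open>R\<close> may therefore cost two multipliers, one clearing denominators and
  one killing torsion, and finitely many such conditions must be met by a common multiplier. For
  coefficients this works because polynomials have finite support. The ideal L needs separate care:
  over the localization it is generated by relations with coefficients there, and these have to be
  traced back to relations over \<open>R\<close>. Since the carrier of the polynomial ring is
  generated inductively, most facts about it are proved by induction on constants, sums and
  multiplication by a variable, and homomorphisms are compared on constants and variables.\<close>

section \<open>Closure criteria for ideals\<close>

lemma (in cring) ideal_memI:
  assumes "I \<subseteq> carrier R" "\<zero> \<in> I" "\<And>a b. a \<in> I \<Longrightarrow> b \<in> I \<Longrightarrow> a \<oplus> b \<in> I"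
    and mult: "\<And>a x. a \<in> I \<Longrightarrow> x \<in> carrier R \<Longrightarrow> x \<otimes> a \<in> I"
  shows "ideal I R"
proof (rule idealI[OF ring_axioms])
  \<comment> \<open>Closure under negation follows from absorption, as \<open>\<ominus> a\<close> is
    the multiple of \<open>a\<close> by \<open>\<ominus> \<one>\<close>.\<close>
  have "\<ominus> a \<in> I" if "a \<in> I" for a
    using mult[OF that, of "\<ominus> \<one>"] assms(1) that by (simp add: l_minus subset_iff)
  then show "subgroup I (add_monoid R)"
    using assms(1-3) by (intro add.subgroupI) (auto simp: a_inv_def)
  show "x \<otimes> a \<in> I" "a \<otimes> x \<in> I" if "a \<in> I" "x \<in> carrier R" for a x
    using mult[OF that] assms(1) that by (auto simp: m_comm)
qed

lemma (in cring) idealD: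
  assumes "ideal I R"
  shows "I \<subseteq> carrier R" "\<zero> \<in> I" "\<And>a b. a \<in> I \<Longrightarrow> b \<in> I \<Longrightarrow> a \<oplus> b \<in> I"
    "\<And>a b. a \<in> I \<Longrightarrow> b \<in> I \<Longrightarrow> a \<ominus> b \<in> I"
    "\<And>a x. a \<in> I \<Longrightarrow> x \<in> carrier R \<Longrightarrow> x \<otimes> a \<in> I"
proof -
  interpret I: ideal I R by (rule assms)
  show "I \<subseteq> carrier R" "\<zero> \<in> I" by auto
  show "\<And>a b. a \<in> I \<Longrightarrow> b \<in> I \<Longrightarrow> a \<oplus> b \<in> I" by simp
  show "\<And>a b. a \<in> I \<Longrightarrow> b \<in> I \<Longrightarrow> a \<ominus> b \<in> I"
    by (simp add: a_minus_def)
  show "\<And>a x. a \<in> I \<Longrightarrow> x \<in> carrier R \<Longrightarrow> x \<otimes> a \<in> I" by (rule I.I_l_closed)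
qed

section \<open>Noetherian rings\<close>

text \<open>
  Hilbert's basis theorem for \<open>A[x]\<close>, where \<open>x\<close> need not be transcendental over \<open>A\<close>: an ideal is
  determined by the ideals of its leading coefficients, taken over all representations of its
  elements as polynomials in \<open>x\<close>.
\<close>

primrec (in ring) power_span :: "'a set \<Rightarrow> 'a \<Rightarrow> nat \<Rightarrow> 'a set" where
  "power_span A x 0 = {\<zero>}"
| "power_span A x (Suc k) = {a \<otimes> x [^] k \<oplus> m | a m. a \<in> A \<and> m \<in> power_span A x k}"

definition (in ring) leading_coeffs :: "'a set \<Rightarrow> 'a \<Rightarrow> 'a set \<Rightarrow> nat \<Rightarrow> 'a set" where
  "leading_coeffs A x J k = {a \<in> A. \<exists>m\<in>power_span A x k. a \<otimes> x [^] k \<oplus> m \<in> J}"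

context cring
begin

context
  fixes A x
  assumes A: "subring A R" and x: "x \<in> carrier R"
begin

lemma power_span_closed: "m \<in> power_span A x k \<Longrightarrow> m \<in> carrier R"
  using subringE(1)[OF A] x by (induction k arbitrary: m) auto

lemma power_span_zero: "\<zero> \<in> power_span A x k"
proof (induction k)
  case (Suc k)
  have "\<zero> = \<zero> \<otimes> x [^] k \<oplus> \<zero>"
    using x by simp
  with Suc show ?case
    using subringE(2)[OF A] by (force simp del: l_null)
qed simp

lemma power_span_add:
  "m \<in> power_span A x k \<Longrightarrow> m' \<in> power_span A x k \<Longrightarrow> m \<oplus> m' \<in> power_span A x k"
proof (induction k arbitrary: m m')
  case (Suc k)
  then obtain a n a' n' where *: "m = a \<otimes> x [^] k \<oplus> n" "m' = a' \<otimes> x [^] k \<oplus> n'"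
    "a \<in> A" "a' \<in> A" "n \<in> power_span A x k" "n' \<in> power_span A x k"
    by auto
  have c: "a \<in> carrier R" "a' \<in> carrier R" "n \<in> carrier R" "n' \<in> carrier R" "x [^] k \<in> carrier R"
    using * subringE(1)[OF A] power_span_closed x by auto
  have "m \<oplus> m' = (a \<oplus> a') \<otimes> x [^] k \<oplus> (n \<oplus> n')"
    unfolding * using c by algebra
  moreover have "a \<oplus> a' \<in> A" "n \<oplus> n' \<in> power_span A x k"
    using * subringE(7)[OF A] Suc.IH by auto
  ultimately show ?case by auto
qed simp

lemma power_span_mult:
  "b \<in> A \<Longrightarrow> m \<in> power_span A x k \<Longrightarrow> b \<otimes> m \<in> power_span A x k"
proof (induction k arbitrary: m)
  case 0
  then show ?case using subringE(1)[OF A] by auto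
next
  case (Suc k)
  then obtain a n where *: "m = a \<otimes> x [^] k \<oplus> n" "a \<in> A" "n \<in> power_span A x k"
    by auto
  have c: "a \<in> carrier R" "b \<in> carrier R" "n \<in> carrier R" "x [^] k \<in> carrier R"
    using * Suc.prems subringE(1)[OF A] power_span_closed x by auto
  have "b \<otimes> m = (b \<otimes> a) \<otimes> x [^] k \<oplus> b \<otimes> n"
    unfolding * using c by algebra
  moreover have "b \<otimes> a \<in> A" "b \<otimes> n \<in> power_span A x k"
    using * Suc.prems subringE(6)[OF A] Suc.IH by auto
  ultimately show ?case by auto
qed

lemma power_span_diff:
  assumes "m \<in> power_span A x k" "m' \<in> power_span A x k"
  shows "m \<ominus> m' \<in> power_span A x k"
proof -
  have "\<ominus> \<one> \<in> A"
    using subringE(3,5)[OF A] by blast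
  moreover have "m \<ominus> m' = m \<oplus> (\<ominus> \<one>) \<otimes> m'"
    using assms power_span_closed by (simp add: l_minus a_minus_def)
  ultimately show ?thesis
    using power_span_add power_span_mult assms by simp
qed

lemma power_span_shift: "m \<in> power_span A x k \<Longrightarrow> x \<otimes> m \<in> power_span A x (Suc k)"
proof (induction k arbitrary: m)
  case 0
  then show ?case using power_span_zero[of 1] x by simp
next
  case (Suc k)
  then obtain a n where *: "m = a \<otimes> x [^] k \<oplus> n" "a \<in> A" "n \<in> power_span A x k"
    by auto
  have c: "a \<in> carrier R" "n \<in> carrier R" "x [^] k \<in> carrier R"
    using * subringE(1)[OF A] power_span_closed x by auto
  have "x \<otimes> m = a \<otimes> x [^] Suc k \<oplus> x \<otimes> n"
    unfolding * nat_pow_Suc using c x by algebra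
  then show ?case
    using Suc.IH[OF *(3)] *(2) by auto
qed

text \<open>All representations share the formal degree \<open>k\<close>, and the leading
  coefficient is allowed to vanish. Cancellation in a sum therefore needs no case
  distinction.\<close>

lemma leading_coeffs_ideal:
  assumes J: "ideal J R"
  shows "ideal (leading_coeffs A x J k) (R\<lparr>carrier := A\<rparr>)"
proof (rule cring.ideal_memI)
  note J' = idealD[OF J]
  note Ac = subsetD[OF subringE(1)[OF A]]
  show "cring (R\<lparr>carrier := A\<rparr>)"
    using A subringE(1,2)[OF A] subcring_iff subcringI' by blast
  show "leading_coeffs A x J k \<subseteq> carrier (R\<lparr>carrier := A\<rparr>)"
    by (auto simp: leading_coeffs_def)
  show "\<zero>\<^bsub>R\<lparr>carrier := A\<rparr>\<^esub> \<in> leading_coeffs A x J k"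
    using power_span_zero[of k] J'(2) subringE(2)[OF A] x
    by (force simp: leading_coeffs_def intro!: bexI[of _ \<zero>])
  fix a assume "a \<in> leading_coeffs A x J k"
  then obtain m where a: "a \<in> A" "m \<in> power_span A x k" "a \<otimes> x [^] k \<oplus> m \<in> J"
    by (auto simp: leading_coeffs_def)
  have c: "a \<in> carrier R" "m \<in> carrier R" "x [^] k \<in> carrier R"
    using a Ac power_span_closed x by auto
  show "a \<oplus>\<^bsub>R\<lparr>carrier := A\<rparr>\<^esub> b \<in> leading_coeffs A x J k"
    if "b \<in> leading_coeffs A x J k" for b
  proof -
    obtain n where b: "b \<in> A" "n \<in> power_span A x k" "b \<otimes> x [^] k \<oplus> n \<in> J"
      using \<open>b \<in> leading_coeffs A x J k\<close> by (auto simp: leading_coeffs_def)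
    have d: "b \<in> carrier R" "n \<in> carrier R"
      using b Ac power_span_closed by auto
    have "(a \<oplus> b) \<otimes> x [^] k \<oplus> (m \<oplus> n) = (a \<otimes> x [^] k \<oplus> m) \<oplus> (b \<otimes> x [^] k \<oplus> n)"
      using c d by algebra
    then show ?thesis
      using power_span_add[OF a(2) b(2)] subringE(7)[OF A a(1) b(1)] J'(3)[OF a(3) b(3)]
      by (auto simp: leading_coeffs_def intro: bexI[of _ "m \<oplus> n"])
  qed
  show "b \<otimes>\<^bsub>R\<lparr>carrier := A\<rparr>\<^esub> a \<in> leading_coeffs A x J k"
    if "b \<in> carrier (R\<lparr>carrier := A\<rparr>)" for b
  proof -
    have b: "b \<in> A" "b \<in> carrier R"
      using that Ac by auto
    have "(b \<otimes> a) \<otimes> x [^] k \<oplus> b \<otimes> m = b \<otimes> (a \<otimes> x [^] k \<oplus> m)"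
      using c b by algebra
    then show ?thesis
      using power_span_mult[OF b(1) a(2)] subringE(6)[OF A b(1) a(1)] J'(5)[OF a(3) b(2)]
      by (auto simp: leading_coeffs_def intro: bexI[of _ "b \<otimes> m"])
  qed
qed

text \<open>Multiplication by \<open>x\<close> raises the formal degree by one, keeps the leading
  coefficient and does not leave \<open>J\<close>.\<close>

lemma leading_coeffs_mono:
  assumes J: "ideal J R" and "k \<le> l"
  shows "leading_coeffs A x J k \<subseteq> leading_coeffs A x J l"
proof (rule lift_Suc_mono_le[OF _ \<open>k \<le> l\<close>])
  fix k
  show "leading_coeffs A x J k \<subseteq> leading_coeffs A x J (Suc k)"
  proof
    fix a assume "a \<in> leading_coeffs A x J k"
    then obtain m where a: "a \<in> A" "m \<in> power_span A x k" "a \<otimes> x [^] k \<oplus> m \<in> J"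
      by (auto simp: leading_coeffs_def)
    have c: "a \<in> carrier R" "m \<in> carrier R" "x [^] k \<in> carrier R"
      using a subringE(1)[OF A] power_span_closed x by auto
    have "a \<otimes> x [^] Suc k \<oplus> x \<otimes> m = x \<otimes> (a \<otimes> x [^] k \<oplus> m)"
      unfolding nat_pow_Suc using c x by algebra
    then show "a \<in> leading_coeffs A x J (Suc k)"
      using power_span_shift[OF a(2)] a(1) idealD(5)[OF J a(3) x]
      unfolding leading_coeffs_def by (metis (mono_tags, lifting) mem_Collect_eq)
  qed
qed

text \<open>Induction on the formal degree: from an element of \<open>J\<close> subtract an element
  of \<open>K\<close> with the same leading coefficient. The difference has lower formal degree and,
  because \<open>K\<close> is contained in \<open>J\<close>, still lies in \<open>J\<close>.\<close>

lemma ideal_eq_if_leading_coeffs_subset: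
  assumes J: "ideal J R" and K: "ideal K R" "K \<subseteq> J"
    and sub: "\<And>k. leading_coeffs A x J k \<subseteq> leading_coeffs A x K k"
    and gen: "\<And>y. y \<in> carrier R \<Longrightarrow> \<exists>k. y \<in> power_span A x k"
  shows "J = K"
proof -
  have "y \<in> K" if "y \<in> power_span A x k" "y \<in> J" for y k
    using that
  proof (induction k arbitrary: y)
    case 0
    then show ?case using idealD(2)[OF K(1)] by simp
  next
    case (Suc k)
    then obtain a m where y: "y = a \<otimes> x [^] k \<oplus> m" "a \<in> A" "m \<in> power_span A x k"
      by auto
    then have "a \<in> leading_coeffs A x K k"
      using Suc.prems(2) sub by (auto simp: leading_coeffs_def)
    then obtain n where n: "n \<in> power_span A x k" "a \<otimes> x [^] k \<oplus> n \<in> K"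
      by (auto simp: leading_coeffs_def)
    have c: "a \<in> carrier R" "m \<in> carrier R" "n \<in> carrier R" "x [^] k \<in> carrier R"
      using y n subringE(1)[OF A] power_span_closed x by auto
    have eq: "m \<ominus> n = y \<ominus> (a \<otimes> x [^] k \<oplus> n)"
      unfolding y(1) using c by algebra
    have "m \<ominus> n \<in> K"
      using Suc.IH[OF power_span_diff[OF y(3) n(1)]] idealD(4)[OF J Suc.prems(2)] n(2) K(2)
      by (auto simp: eq)
    moreover have "y = (m \<ominus> n) \<oplus> (a \<otimes> x [^] k \<oplus> n)"
      unfolding y(1) using c by algebra
    ultimately show ?case
      using idealD(3)[OF K(1)] n(2) by simp
  qed
  with gen idealD(1)[OF J] K(2) show ?thesis
    by blast
qed

end

text \<open>In the application \<open>A\<close> is the polynomial ring in one variable fewer.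
  Finitely many elements of \<open>J\<close> that realize generators of the first few ideals of
  leading coefficients already account for all leading coefficients of \<open>J\<close>, and hence
  generate it.\<close>

theorem noetherian_adjoin:
  assumes A: "subring A R" "noetherian_ring (R\<lparr>carrier := A\<rparr>)" and x: "x \<in> carrier R"
    and gen: "\<And>y. y \<in> carrier R \<Longrightarrow> \<exists>k. y \<in> power_span A x k"
  shows "noetherian_ring R"
proof (rule noetherian_ringI)
  interpret A: noetherian_ring "R\<lparr>carrier := A\<rparr>" by (rule A(2))
  fix J assume J: "ideal J R"
  let ?L = "leading_coeffs A x J"
  note mono = leading_coeffs_mono[OF A(1) x]
  have "subset.chain {I. ideal I (R\<lparr>carrier := A\<rparr>)} (range ?L)"
    using leading_coeffs_ideal[OF A(1) x J] mono[OF J] nat_le_linear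
    unfolding pred_on.chain_def by blast
  \<comment> \<open>In a Noetherian ring a nonempty chain of ideals contains its union, so some
    \<open>?L N\<close> is the largest of them.\<close>
  then have "\<Union>(range ?L) \<in> range ?L"
    by (intro A.ideal_chain_is_trivial) auto
  then obtain N where N: "\<And>k. ?L k \<subseteq> ?L N"
    by auto
  have "\<forall>k. \<exists>B. B \<subseteq> A \<and> finite B \<and> ?L k = Idl\<^bsub>R\<lparr>carrier := A\<rparr>\<^esub> B"
    using A.finetely_gen[OF leading_coeffs_ideal[OF A(1) x J]] by auto
  then obtain B where B: "\<And>k. B k \<subseteq> A" "\<And>k. finite (B k)" "\<And>k. ?L k = Idl\<^bsub>R\<lparr>carrier := A\<rparr>\<^esub> (B k)"
    by metis
  have BL: "B k \<subseteq> ?L k" for k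
    using A.genideal_self[of "B k"] B by auto
  then have "\<forall>k. \<forall>b\<in>B k. \<exists>m\<in>power_span A x k. b \<otimes> x [^] k \<oplus> m \<in> J"
    by (force simp: leading_coeffs_def)
  then obtain m where m: "\<And>k b. b \<in> B k \<Longrightarrow> m k b \<in> power_span A x k"
    "\<And>k b. b \<in> B k \<Longrightarrow> b \<otimes> x [^] k \<oplus> m k b \<in> J"
    by metis
  \<comment> \<open>Each generator of an ideal of leading coefficients is completed by lower terms
    \<open>m k b\<close> to an element of \<open>J\<close>. Keeping only the levels up to
    \<open>N\<close> makes \<open>G\<close> finite.\<close>
  define G where "G = (\<Union>k\<le>N. (\<lambda>b. b \<otimes> x [^] k \<oplus> m k b) ` B k)"
  have G: "G \<subseteq> J" "G \<subseteq> carrier R" "finite G"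
    using m(2) idealD(1)[OF J] B(2) unfolding G_def by auto
  let ?K = "Idl G"
  have K: "ideal ?K R" "?K \<subseteq> J"
    using genideal_ideal[OF G(2)] genideal_minimal[OF J G(1)] .
  have 1: "?L k \<subseteq> leading_coeffs A x ?K k" if "k \<le> N" for k
  proof -
    have "b \<otimes> x [^] k \<oplus> m k b \<in> ?K" if "b \<in> B k" for b
      using genideal_self[OF G(2)] that \<open>k \<le> N\<close> by (auto simp: G_def)
    then have "B k \<subseteq> leading_coeffs A x ?K k"
      using B(1) m(1) by (force simp: leading_coeffs_def)
    then show ?thesis
      unfolding B(3) by (intro A.genideal_minimal leading_coeffs_ideal[OF A(1) x K(1)])
  qed
  \<comment> \<open>Above \<open>N\<close> the ideals for \<open>J\<close> are contained in the one
    at \<open>N\<close>, whereas those for \<open>?K\<close> do not shrink.\<close>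
  have "?L k \<subseteq> leading_coeffs A x ?K k" for k
    using 1[of k] 1[of N] N[of k] mono[OF K(1), of N k] by (cases "k \<le> N") auto
  then have "J = ?K"
    using ideal_eq_if_leading_coeffs_subset[OF A(1) x J K _ gen] by blast
  with G show "\<exists>G\<subseteq>carrier R. finite G \<and> J = Idl G"
    by blast
qed

end

section \<open>Multivariate polynomials\<close>

text \<open>The product of \<open>mpoly_ring\<close> is a \<open>finsum\<close> over all
  submultisets of a monomial, and a \<open>finsum\<close> over an infinite set would be zero by
  convention.\<close>

lemma finite_submultisets: "finite {\<nu>. \<nu> \<subseteq># \<mu>}"
proof (induction \<mu>)
  case (add x \<mu>)
  have "\<nu> \<in> {\<nu>. \<nu> \<subseteq># \<mu>} \<union> add_mset x ` {\<nu>. \<nu> \<subseteq># \<mu>}" if "\<nu> \<subseteq># add_mset x \<mu>" for \<nu>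
  proof (cases "x \<in># \<nu>")
    case True
    then obtain \<nu>' where "\<nu> = add_mset x \<nu>'"
      by (meson multi_member_split)
    with that show ?thesis by auto
  next
    case False
    have "count \<nu> y \<le> count \<mu> y" for y
      using mset_subset_eq_count[OF that, of y] False by (cases "y = x") (auto simp: not_in_iff)
    then show ?thesis
      by (simp add: subseteq_mset_def)
  qed
  then have "{\<nu>. \<nu> \<subseteq># add_mset x \<mu>} \<subseteq> {\<nu>. \<nu> \<subseteq># \<mu>} \<union> add_mset x ` {\<nu>. \<nu> \<subseteq># \<mu>}"
    by blast
  then show ?case
    by (rule finite_subset) (simp add: add.IH)
qed simp

abbreviation (in ring) "mpoly n \<equiv> mpoly_ring R n"

section \<open>The ring axioms for polynomials\<close>

context cring
begin

lemma mpoly_carrier: "carrier (mpoly n) = (carrier R) [\<X>\<^bsub>{..<n}\<^esub>]"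
  by (simp add: mpoly_ring_def)

lemma mpoly_mult:
  "F \<otimes>\<^bsub>mpoly n\<^esub> G = (\<lambda>\<mu>. \<Oplus>\<nu>\<in>{\<nu>. \<nu> \<subseteq># \<mu>}. F \<nu> \<otimes> G (\<mu> - \<nu>))"
  by (simp add: mpoly_ring_def)

lemma mpoly_add: "F \<oplus>\<^bsub>mpoly n\<^esub> G = (\<lambda>\<mu>. F \<mu> \<oplus> G \<mu>)"
  by (simp add: mpoly_ring_def indexed_padd_def)

lemma mpoly_one: "\<one>\<^bsub>mpoly n\<^esub> = indexed_const \<one>"
  by (simp add: mpoly_ring_def)

lemma mpoly_zero: "\<zero>\<^bsub>mpoly n\<^esub> = (\<lambda>\<mu>. \<zero>)"
  by (simp add: mpoly_ring_def indexed_zero_def)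

lemma mpoly_coeff: "F \<in> carrier (mpoly n) \<Longrightarrow> F \<mu> \<in> carrier R"
  unfolding mpoly_carrier using indexed_pset_in_carrier carrier_coeffE by blast

lemma mpoly_finite_support:
  assumes "F \<in> carrier (mpoly n)"
  shows "finite {\<mu>. F \<mu> \<noteq> \<zero>}"
  using assms unfolding mpoly_carrier
proof induction
  case (indexed_const k)
  then show ?case
    by (auto simp: indexed_const_def intro: finite_subset[of _ "{{#}}"])
next
  case (indexed_padd P Q)
  then have "{\<mu>. (P \<Oplus> Q) \<mu> \<noteq> \<zero>} \<subseteq> {\<mu>. P \<mu> \<noteq> \<zero>} \<union> {\<mu>. Q \<mu> \<noteq> \<zero>}"
    by (auto simp: indexed_padd_def)
  with indexed_padd.IH show ?case by (meson finite_UnI finite_subset)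
next
  case (indexed_pmult P i)
  have "{\<mu>. (P \<Otimes> i) \<mu> \<noteq> \<zero>} \<subseteq> add_mset i ` {\<mu>. P \<mu> \<noteq> \<zero>}"
  proof
    fix \<mu> assume "\<mu> \<in> {\<mu>. (P \<Otimes> i) \<mu> \<noteq> \<zero>}"
    then have "i \<in># \<mu>" "P (\<mu> - {#i#}) \<noteq> \<zero>"
      by (auto simp: indexed_pmult_def split: if_splits)
    then show "\<mu> \<in> add_mset i ` {\<mu>. P \<mu> \<noteq> \<zero>}"
      by (auto intro!: image_eqI[of _ _ "\<mu> - {#i#}"])
  qed
  with indexed_pmult.IH show ?case by (meson finite_imageI finite_subset)
qed

text \<open>This keeps evaluation away from indices at or beyond \<open>n\<close>, where the
  assigned values are unconstrained.\<close>

lemma mpoly_support_vars: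
  assumes "F \<in> carrier (mpoly n)" "F \<mu> \<noteq> \<zero>"
  shows "set_mset \<mu> \<subseteq> {..<n}"
  using assms unfolding mpoly_carrier
proof (induction arbitrary: \<mu>)
  case (indexed_const k)
  then show ?case by (auto simp: indexed_const_def split: if_splits)
next
  case (indexed_padd P Q)
  then have "P \<mu> \<noteq> \<zero> \<or> Q \<mu> \<noteq> \<zero>"
    by (auto simp: indexed_padd_def)
  with indexed_padd show ?case by blast
next
  case (indexed_pmult P i)
  then have "i \<in># \<mu>" "P (\<mu> - {#i#}) \<noteq> \<zero>"
    by (auto simp: indexed_pmult_def split: if_splits)
  with indexed_pmult(3)[OF this(2)] indexed_pmult(2) show ?case
    by (metis insert_DiffM insert_subset set_mset_add_mset_insert)
qed

lemma mpoly_const_mult: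
  assumes "k \<in> carrier R" "carrier_coeff F"
  shows "indexed_const k \<otimes>\<^bsub>mpoly n\<^esub> F = (\<lambda>\<mu>. k \<otimes> F \<mu>)"
proof
  fix \<mu>
  have "(indexed_const k \<otimes>\<^bsub>mpoly n\<^esub> F) \<mu> =
      (\<Oplus>\<nu>\<in>{\<nu>. \<nu> \<subseteq># \<mu>}. if {#} = \<nu> then k \<otimes> F (\<mu> - \<nu>) else \<zero>)"
    unfolding mpoly_mult using assms
    by (intro finsum_cong') (auto simp: indexed_const_def carrier_coeff_def)
  also have "\<dots> = k \<otimes> F (\<mu> - {#})"
    using assms finite_submultisets
    by (intro finsum_singleton) (auto simp: carrier_coeff_def)
  finally show "(indexed_const k \<otimes>\<^bsub>mpoly n\<^esub> F) \<mu> = k \<otimes> F \<mu>" by simp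
qed

text \<open>A submultiset of \<open>add_mset i \<mu>'\<close> contributes to the left-hand side only
  if it contains \<open>i\<close>; removing that \<open>i\<close> gives a bijection with the
  submultisets of \<open>\<mu>'\<close>. Together with \<open>mpoly_const_mult\<close> this permits
  induction on the left factor of a product.\<close>

lemma mpoly_shift_mult:
  assumes "carrier_coeff F" "carrier_coeff G"
  shows "(F \<Otimes> i) \<otimes>\<^bsub>mpoly n\<^esub> G = (F \<otimes>\<^bsub>mpoly n\<^esub> G) \<Otimes> i"
proof
  fix \<mu>
  note c = assms[unfolded carrier_coeff_def]
  show "((F \<Otimes> i) \<otimes>\<^bsub>mpoly n\<^esub> G) \<mu> = ((F \<otimes>\<^bsub>mpoly n\<^esub> G) \<Otimes> i) \<mu>"
  proof (cases "i \<in># \<mu>")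
    case False
    have "((F \<Otimes> i) \<otimes>\<^bsub>mpoly n\<^esub> G) \<mu> = (\<Oplus>\<nu>\<in>{\<nu>. \<nu> \<subseteq># \<mu>}. \<zero>)"
      unfolding mpoly_mult using c False
      by (intro finsum_cong') (auto simp: indexed_pmult_def dest: mset_subset_eqD)
    with False show ?thesis
      by (simp add: indexed_pmult_def)
  next
    case True
    then obtain \<mu>' where \<mu>: "\<mu> = add_mset i \<mu>'"
      by (meson multi_member_split)
    let ?f = "\<lambda>\<nu>. (F \<Otimes> i) \<nu> \<otimes> G (\<mu> - \<nu>)"
    have sub: "add_mset i ` {\<nu>. \<nu> \<subseteq># \<mu>'} \<subseteq> {\<nu>. \<nu> \<subseteq># \<mu>}"
      by (auto simp: \<mu>)
    have zero: "(F \<Otimes> i) \<nu> = \<zero>" if "\<nu> \<subseteq># \<mu>" "\<nu> \<notin> add_mset i ` {\<nu>. \<nu> \<subseteq># \<mu>'}" for \<nu>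
    proof -
      have "i \<notin># \<nu>"
      proof
        assume "i \<in># \<nu>"
        then obtain \<nu>' where "\<nu> = add_mset i \<nu>'"
          by (meson multi_member_split)
        with that show False by (auto simp: \<mu>)
      qed
      then show ?thesis by (simp add: indexed_pmult_def)
    qed
    have "((F \<Otimes> i) \<otimes>\<^bsub>mpoly n\<^esub> G) \<mu> = (\<Oplus>\<nu>\<in>add_mset i ` {\<nu>. \<nu> \<subseteq># \<mu>'}. ?f \<nu>)"
      unfolding mpoly_mult using c zero sub finite_submultisets
      by (intro add.finprod_mono_neutral_cong_right) (auto simp: indexed_pmult_def)
    also have "\<dots> = (\<Oplus>\<nu>\<in>{\<nu>. \<nu> \<subseteq># \<mu>'}. ?f (add_mset i \<nu>))"
      using c by (intro finsum_reindex) (auto simp: indexed_pmult_def inj_on_def)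
    also have "\<dots> = (\<Oplus>\<nu>\<in>{\<nu>. \<nu> \<subseteq># \<mu>'}. F \<nu> \<otimes> G (\<mu>' - \<nu>))"
      using c by (intro finsum_cong') (auto simp: indexed_pmult_def \<mu>)
    finally show ?thesis
      by (simp add: indexed_pmult_def \<mu> mpoly_mult)
  qed
qed

lemma mpoly_mult_coeff:
  "carrier_coeff F \<Longrightarrow> carrier_coeff G \<Longrightarrow> carrier_coeff (F \<otimes>\<^bsub>mpoly n\<^esub> G)"
  unfolding carrier_coeff_def mpoly_mult by (auto intro!: finsum_closed)

lemma mpoly_l_distr:
  assumes "carrier_coeff F" "carrier_coeff G" "carrier_coeff H"
  shows "(F \<oplus>\<^bsub>mpoly n\<^esub> G) \<otimes>\<^bsub>mpoly n\<^esub> H = F \<otimes>\<^bsub>mpoly n\<^esub> H \<oplus>\<^bsub>mpoly n\<^esub> G \<otimes>\<^bsub>mpoly n\<^esub> H"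
proof
  fix \<mu>
  note c = assms[unfolded carrier_coeff_def]
  have "((F \<oplus>\<^bsub>mpoly n\<^esub> G) \<otimes>\<^bsub>mpoly n\<^esub> H) \<mu> =
      (\<Oplus>\<nu>\<in>{\<nu>. \<nu> \<subseteq># \<mu>}. F \<nu> \<otimes> H (\<mu> - \<nu>) \<oplus> G \<nu> \<otimes> H (\<mu> - \<nu>))"
    unfolding mpoly_mult mpoly_add using c by (intro finsum_cong') (auto simp: l_distr)
  also have "\<dots> = (F \<otimes>\<^bsub>mpoly n\<^esub> H \<oplus>\<^bsub>mpoly n\<^esub> G \<otimes>\<^bsub>mpoly n\<^esub> H) \<mu>"
    unfolding mpoly_mult mpoly_add using c by (intro finsum_addf) auto
  finally show "((F \<oplus>\<^bsub>mpoly n\<^esub> G) \<otimes>\<^bsub>mpoly n\<^esub> H) \<mu> = \<dots>" .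
qed

text \<open>Taking complements, \<open>\<nu>\<close> to \<open>\<mu> - \<nu>\<close>, is an
  involution on the submultisets of \<open>\<mu>\<close> and interchanges the two factors.\<close>

lemma mpoly_m_comm:
  assumes "carrier_coeff F" "carrier_coeff G"
  shows "F \<otimes>\<^bsub>mpoly n\<^esub> G = G \<otimes>\<^bsub>mpoly n\<^esub> F"
proof
  fix \<mu> :: "nat multiset"
  note c = assms[unfolded carrier_coeff_def]
  have inv: "\<mu> - (\<mu> - \<nu>) = \<nu>" if "\<nu> \<subseteq># \<mu>" for \<nu>
    using that by (auto simp: multiset_eq_iff subseteq_mset_def)
  have im: "(\<lambda>\<nu>. \<mu> - \<nu>) ` {\<nu>. \<nu> \<subseteq># \<mu>} = {\<nu>. \<nu> \<subseteq># \<mu>}"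
  proof
    show "{\<nu>. \<nu> \<subseteq># \<mu>} \<subseteq> (\<lambda>\<nu>. \<mu> - \<nu>) ` {\<nu>. \<nu> \<subseteq># \<mu>}"
      using inv by (metis (mono_tags, lifting) diff_subset_eq_self image_eqI mem_Collect_eq subsetI)
  qed auto
  have inj: "inj_on (\<lambda>\<nu>. \<mu> - \<nu>) {\<nu>. \<nu> \<subseteq># \<mu>}"
    by (rule inj_on_inverseI[where g = "\<lambda>\<nu>. \<mu> - \<nu>"]) (simp add: inv)
  have "(F \<otimes>\<^bsub>mpoly n\<^esub> G) \<mu> = (\<Oplus>\<nu>\<in>(\<lambda>\<nu>. \<mu> - \<nu>) ` {\<nu>. \<nu> \<subseteq># \<mu>}. F \<nu> \<otimes> G (\<mu> - \<nu>))"
    by (simp add: mpoly_mult im)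
  also have "\<dots> = (\<Oplus>\<nu>\<in>{\<nu>. \<nu> \<subseteq># \<mu>}. F (\<mu> - \<nu>) \<otimes> G (\<mu> - (\<mu> - \<nu>)))"
    using c inj by (intro finsum_reindex) auto
  also have "\<dots> = (G \<otimes>\<^bsub>mpoly n\<^esub> F) \<mu>"
    unfolding mpoly_mult using c by (intro finsum_cong') (auto simp: m_comm inv)
  finally show "(F \<otimes>\<^bsub>mpoly n\<^esub> G) \<mu> = (G \<otimes>\<^bsub>mpoly n\<^esub> F) \<mu>" .
qed

lemma mpoly_coeffs: "F \<in> carrier (mpoly n) \<Longrightarrow> carrier_coeff F"
  using mpoly_coeff by (auto simp: carrier_coeff_def)

lemma indexed_const_coeff: "k \<in> carrier R \<Longrightarrow> carrier_coeff (indexed_const k)"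
  by (simp add: carrier_coeff_def indexed_const_def)

lemma mpoly_const_closed: "k \<in> carrier R \<Longrightarrow> indexed_const k \<in> carrier (mpoly n)"
  unfolding mpoly_carrier by (rule indexed_pset.indexed_const)

lemma mpoly_shift_closed:
  "F \<in> carrier (mpoly n) \<Longrightarrow> i < n \<Longrightarrow> F \<Otimes> i \<in> carrier (mpoly n)"
  unfolding mpoly_carrier by (auto intro: indexed_pset.indexed_pmult)

lemma mpoly_a_closed:
  "F \<in> carrier (mpoly n) \<Longrightarrow> G \<in> carrier (mpoly n) \<Longrightarrow> F \<oplus>\<^bsub>mpoly n\<^esub> G \<in> carrier (mpoly n)"
  unfolding mpoly_carrier by (simp add: mpoly_ring_def indexed_pset.indexed_padd)

text \<open>Closure of the carrier under products is not yet available, so multiplication by a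
  variable appears as the shift \<open>F \<Otimes> i\<close>; \<open>mpoly_induct\<close> later
  replaces it by a genuine product.\<close>

lemma mpoly_shift_induct [consumes 1, case_names const add shift]:
  assumes "F \<in> carrier (mpoly n)"
    and "\<And>k. k \<in> carrier R \<Longrightarrow> Q (indexed_const k)"
    and "\<And>F G. F \<in> carrier (mpoly n) \<Longrightarrow> G \<in> carrier (mpoly n) \<Longrightarrow> Q F \<Longrightarrow> Q G \<Longrightarrow> Q (F \<oplus>\<^bsub>mpoly n\<^esub> G)"
    and "\<And>F i. F \<in> carrier (mpoly n) \<Longrightarrow> i < n \<Longrightarrow> Q F \<Longrightarrow> Q (F \<Otimes> i)"
  shows "Q F"
  using assms(1) unfolding mpoly_carrier
proof induction
  case (indexed_padd F G)
  then show ?case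
    using assms(3)[of F G] by (simp add: mpoly_ring_def)
next
  case (indexed_const k)
  then show ?case by (rule assms(2))
next
  case (indexed_pmult F i)
  then show ?case using assms(4)[of F i] by (simp add: mpoly_carrier)
qed

lemma mpoly_const_mult_const:
  assumes "k \<in> carrier R" "l \<in> carrier R"
  shows "indexed_const k \<otimes>\<^bsub>mpoly n\<^esub> indexed_const l = indexed_const (k \<otimes> l)"
  using assms by (auto simp: mpoly_const_mult indexed_const_coeff) (auto simp: indexed_const_def)

text \<open>The product is given by coefficients but the carrier by generation, so closure needs an
  induction on the left factor and, when that is a constant, another one on the right
  factor.\<close>

lemma mpoly_m_closed:
  assumes F: "F \<in> carrier (mpoly n)" and G: "G \<in> carrier (mpoly n)"
  shows "F \<otimes>\<^bsub>mpoly n\<^esub> G \<in> carrier (mpoly n)"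
  using F
proof (induction rule: mpoly_shift_induct)
  case (const k)
  show ?case
    using G
  proof (induction rule: mpoly_shift_induct)
    case (const l)
    then have "indexed_const k \<otimes>\<^bsub>mpoly n\<^esub> indexed_const l = indexed_const (k \<otimes> l)"
      using \<open>k \<in> carrier R\<close> by (simp add: mpoly_const_mult_const)
    with const \<open>k \<in> carrier R\<close> show ?case
      by (simp add: mpoly_const_closed)
  next
    case (add G H)
    have "indexed_const k \<otimes>\<^bsub>mpoly n\<^esub> (G \<oplus>\<^bsub>mpoly n\<^esub> H) =
        indexed_const k \<otimes>\<^bsub>mpoly n\<^esub> G \<oplus>\<^bsub>mpoly n\<^esub> indexed_const k \<otimes>\<^bsub>mpoly n\<^esub> H"
      using add(1,2) \<open>k \<in> carrier R\<close> mpoly_coeff[OF add(1)] mpoly_coeff[OF add(2)]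
        mpoly_coeffs[OF mpoly_a_closed[OF add(1,2)]]
      by (simp add: mpoly_const_mult mpoly_coeffs) (simp add: mpoly_add r_distr)
    with add show ?case by (simp add: mpoly_a_closed)
  next
    case (shift G i)
    have "indexed_const k \<otimes>\<^bsub>mpoly n\<^esub> (G \<Otimes> i) = (indexed_const k \<otimes>\<^bsub>mpoly n\<^esub> G) \<Otimes> i"
      using shift(1,2) \<open>k \<in> carrier R\<close>
      by (auto simp: mpoly_const_mult mpoly_coeffs indexed_pmult_in_carrier) (auto simp: indexed_pmult_def)
    with shift show ?case by (simp add: mpoly_shift_closed)
  qed
next
  case (add F H)
  then show ?case using G by (simp add: mpoly_l_distr mpoly_coeffs mpoly_a_closed)
next
  case (shift F i)
  then show ?case using G by (simp add: mpoly_shift_mult mpoly_coeffs mpoly_shift_closed)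
qed

text \<open>Induction on the first factor avoids double sums over nested submultisets: the base case
  merely pulls a scalar out of one convolution.\<close>

lemma mpoly_m_assoc:
  assumes F: "F \<in> carrier (mpoly n)" and G: "G \<in> carrier (mpoly n)" and H: "H \<in> carrier (mpoly n)"
  shows "(F \<otimes>\<^bsub>mpoly n\<^esub> G) \<otimes>\<^bsub>mpoly n\<^esub> H = F \<otimes>\<^bsub>mpoly n\<^esub> (G \<otimes>\<^bsub>mpoly n\<^esub> H)"
  using F
proof (induction rule: mpoly_shift_induct)
  case (const k)
  note GH = mpoly_coeffs[OF G] mpoly_coeffs[OF H] mpoly_coeffs[OF mpoly_m_closed[OF G H]]
  have c: "carrier_coeff (\<lambda>\<mu>. k \<otimes> G \<mu>)"
    using const GH(1) by (simp add: carrier_coeff_def)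
  show ?case
  proof
    fix \<mu>
    have "((indexed_const k \<otimes>\<^bsub>mpoly n\<^esub> G) \<otimes>\<^bsub>mpoly n\<^esub> H) \<mu>
        = (\<Oplus>\<nu>\<in>{\<nu>. \<nu> \<subseteq># \<mu>}. k \<otimes> (G \<nu> \<otimes> H (\<mu> - \<nu>)))"
      unfolding mpoly_const_mult[OF const GH(1)] unfolding mpoly_mult using const GH(1,2)
      by (intro finsum_cong') (auto simp: carrier_coeff_def m_assoc)
    also have "\<dots> = k \<otimes> (G \<otimes>\<^bsub>mpoly n\<^esub> H) \<mu>"
      unfolding mpoly_mult using const GH(1,2) finite_submultisets
      by (intro finsum_rdistr[symmetric]) (auto simp: carrier_coeff_def)
    finally show "((indexed_const k \<otimes>\<^bsub>mpoly n\<^esub> G) \<otimes>\<^bsub>mpoly n\<^esub> H) \<mu> =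
        (indexed_const k \<otimes>\<^bsub>mpoly n\<^esub> (G \<otimes>\<^bsub>mpoly n\<^esub> H)) \<mu>"
      by (simp add: mpoly_const_mult[OF const GH(3)])
  qed
next
  case (add F F')
  then show ?case
    using G H by (simp add: mpoly_l_distr mpoly_coeffs mpoly_mult_coeff)
next
  case (shift F i)
  then show ?case
    using G H by (simp add: mpoly_shift_mult mpoly_coeffs mpoly_mult_coeff)
qed

lemma mpoly_cring: "cring (mpoly n)"
proof (rule cringI)
  show "abelian_group (mpoly n)"
  proof (rule abelian_groupI)
    show "\<zero>\<^bsub>mpoly n\<^esub> \<in> carrier (mpoly n)"
      using mpoly_const_closed[OF zero_closed] by (simp add: mpoly_ring_def)
    fix F assume F: "F \<in> carrier (mpoly n)"
    note c = mpoly_coeff[OF F]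
    show "\<zero>\<^bsub>mpoly n\<^esub> \<oplus>\<^bsub>mpoly n\<^esub> F = F"
      by (simp add: mpoly_add mpoly_zero c)
    show "\<exists>G\<in>carrier (mpoly n). G \<oplus>\<^bsub>mpoly n\<^esub> F = \<zero>\<^bsub>mpoly n\<^esub>"
    proof
      show "indexed_const (\<ominus> \<one>) \<otimes>\<^bsub>mpoly n\<^esub> F \<in> carrier (mpoly n)"
        using F by (simp add: mpoly_m_closed mpoly_const_closed)
      show "indexed_const (\<ominus> \<one>) \<otimes>\<^bsub>mpoly n\<^esub> F \<oplus>\<^bsub>mpoly n\<^esub> F = \<zero>\<^bsub>mpoly n\<^esub>"
        using F by (simp add: mpoly_const_mult mpoly_coeffs mpoly_add mpoly_zero c l_minus l_neg)
    qed
    fix G assume G: "G \<in> carrier (mpoly n)"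
    show "F \<oplus>\<^bsub>mpoly n\<^esub> G \<in> carrier (mpoly n)"
      using F G by (rule mpoly_a_closed)
    show "F \<oplus>\<^bsub>mpoly n\<^esub> G = G \<oplus>\<^bsub>mpoly n\<^esub> F"
      using c mpoly_coeff[OF G] by (simp add: mpoly_add a_comm)
    show "F \<oplus>\<^bsub>mpoly n\<^esub> G \<oplus>\<^bsub>mpoly n\<^esub> H = F \<oplus>\<^bsub>mpoly n\<^esub> (G \<oplus>\<^bsub>mpoly n\<^esub> H)"
      if "H \<in> carrier (mpoly n)" for H
      using c mpoly_coeff[OF G] mpoly_coeff[OF that] by (simp add: mpoly_add a_assoc)
  qed
  show "comm_monoid (mpoly n)"
    by (rule comm_monoidI)
      (auto simp: mpoly_m_closed mpoly_m_assoc mpoly_one mpoly_const_closed mpoly_const_mult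
        mpoly_coeffs mpoly_coeff intro: mpoly_m_comm)
qed (simp add: mpoly_l_distr mpoly_coeffs)

lemma mpoly_var_closed: "i < n \<Longrightarrow> indexed_var i \<in> carrier (mpoly n)"
  by (simp add: indexed_var_def mpoly_const_closed mpoly_shift_closed)

lemma mpoly_var_mult:
  assumes "F \<in> carrier (mpoly n)"
  shows "indexed_var i \<otimes>\<^bsub>mpoly n\<^esub> F = F \<Otimes> i"
  using assms
  by (simp add: indexed_var_def mpoly_shift_mult indexed_const_coeff mpoly_coeffs mpoly_const_mult
      mpoly_coeff)

lemma mpoly_induct [consumes 1, case_names const add var]:
  assumes F: "F \<in> carrier (mpoly n)"
    and "\<And>k. k \<in> carrier R \<Longrightarrow> Q (indexed_const k)"
    and "\<And>F G. F \<in> carrier (mpoly n) \<Longrightarrow> G \<in> carrier (mpoly n) \<Longrightarrow> Q F \<Longrightarrow> Q G \<Longrightarrow> Q (F \<oplus>\<^bsub>mpoly n\<^esub> G)"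
    and var: "\<And>F i. F \<in> carrier (mpoly n) \<Longrightarrow> i < n \<Longrightarrow> Q F \<Longrightarrow> Q (indexed_var i \<otimes>\<^bsub>mpoly n\<^esub> F)"
  shows "Q F"
  using F
proof (induction rule: mpoly_shift_induct)
  case (shift F i)
  then show ?case using var[of F i] by (simp add: mpoly_var_mult)
next
  case (const k)
  then show ?case by (rule assms(2))
next
  case (add F G)
  then show ?case by (rule assms(3))
qed

lemma mpoly_const_hom: "ring_hom_cring R (mpoly n) indexed_const"
proof (rule ring_hom_cringI[OF cring_axioms mpoly_cring ring_hom_memI])
  show "indexed_const (a \<otimes> b) = indexed_const a \<otimes>\<^bsub>mpoly n\<^esub> indexed_const b"
    if "a \<in> carrier R" "b \<in> carrier R" for a b
    using that by (simp add: mpoly_const_mult_const)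
  show "indexed_const (a \<oplus> b) = indexed_const a \<oplus>\<^bsub>mpoly n\<^esub> indexed_const b" for a b
    by (auto simp: mpoly_add indexed_const_def)
qed (auto simp: mpoly_const_closed mpoly_one)

end

section \<open>Polynomial rings over Noetherian rings\<close>

lemma (in ring_hom_cring) vimage_ideal:
  assumes "ideal J S"
  shows "ideal {r \<in> carrier R. h r \<in> J} R"
  using S.idealD[OF assms] by (intro R.ideal_memI) auto

text \<open>Generators of the preimage of \<open>J\<close> are mapped to generators of
  \<open>J\<close>, because by surjectivity every element of \<open>J\<close> comes from the
  preimage.\<close>

lemma (in ring_hom_cring) noetherian_surj_image:
  assumes "noetherian_ring R" and surj: "h ` carrier R = carrier S"
  shows "noetherian_ring S"
proof (rule S.noetherian_ringI)
  interpret R': noetherian_ring R by (rule assms(1))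
  note pre = vimage_ideal
  fix J assume J: "ideal J S"
  obtain B where B: "B \<subseteq> carrier R" "finite B" "{r \<in> carrier R. h r \<in> J} = Idl B"
    using R'.finetely_gen[OF pre[OF J]] by blast
  have "B \<subseteq> {r \<in> carrier R. h r \<in> J}"
    unfolding B(3) by (rule R.genideal_self[OF B(1)])
  then have hB: "h ` B \<subseteq> carrier S" "h ` B \<subseteq> J"
    using B(1) by (auto intro: hom_closed)
  have "B \<subseteq> {r \<in> carrier R. h r \<in> Idl\<^bsub>S\<^esub> (h ` B)}"
    using B(1) S.genideal_self[OF hB(1)] by blast
  then have "{r \<in> carrier R. h r \<in> J} \<subseteq> {r \<in> carrier R. h r \<in> Idl\<^bsub>S\<^esub> (h ` B)}"
    unfolding B(3) by (intro R.genideal_minimal pre S.genideal_ideal hB(1))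
  then have *: "h r \<in> Idl\<^bsub>S\<^esub> (h ` B)" if "r \<in> carrier R" "h r \<in> J" for r
    using that by auto
  have "J \<subseteq> Idl\<^bsub>S\<^esub> (h ` B)"
  proof
    fix y assume "y \<in> J"
    then obtain r where "r \<in> carrier R" "y = h r"
      using S.idealD(1)[OF J] surj by (metis imageE subsetD)
    with * \<open>y \<in> J\<close> show "y \<in> Idl\<^bsub>S\<^esub> (h ` B)"
      by simp
  qed
  then have "J = Idl\<^bsub>S\<^esub> (h ` B)"
    using S.genideal_minimal[OF J hB(2)] by (rule subset_antisym)
  then show "\<exists>A\<subseteq>carrier S. finite A \<and> J = Idl\<^bsub>S\<^esub> A"
    using hB(1) B(2) by (intro exI[of _ "h ` B"]) simp
qed

lemma (in cring) mpoly_mono: "carrier (mpoly n) \<subseteq> carrier (mpoly (Suc n))"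
proof
  fix F assume "F \<in> carrier (mpoly n)"
  then show "F \<in> carrier (mpoly (Suc n))"
  proof (induction rule: mpoly_shift_induct)
    case (add F G)
    have "F \<oplus>\<^bsub>mpoly n\<^esub> G = F \<oplus>\<^bsub>mpoly (Suc n)\<^esub> G"
      by (simp only: mpoly_add)
    then show ?case using mpoly_a_closed[OF add(3,4)] by simp
  next
    case (const k)
    then show ?case by (rule mpoly_const_closed)
  next
    case (shift F i)
    then show ?case using mpoly_shift_closed[OF shift(3)] by simp
  qed
qed

text \<open>The two records share sum, product, zero and one. Negation, however, is defined through
  the carrier, so the two negations are identified by uniqueness of additive inverses.\<close>

lemma (in cring) mpoly_subring: "subring (carrier (mpoly n)) (mpoly (Suc n))"
proof -
  interpret T: cring "mpoly n" by (rule mpoly_cring)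
  interpret T': cring "mpoly (Suc n)" by (rule mpoly_cring)
  have eq: "(\<otimes>\<^bsub>mpoly (Suc n)\<^esub>) = (\<otimes>\<^bsub>mpoly n\<^esub>)" "(\<oplus>\<^bsub>mpoly (Suc n)\<^esub>) = (\<oplus>\<^bsub>mpoly n\<^esub>)"
    "\<one>\<^bsub>mpoly (Suc n)\<^esub> = \<one>\<^bsub>mpoly n\<^esub>" "\<zero>\<^bsub>mpoly (Suc n)\<^esub> = \<zero>\<^bsub>mpoly n\<^esub>"
    by (auto simp: mpoly_ring_def)
  show ?thesis
  proof (rule T'.subringI)
    fix F assume F: "F \<in> carrier (mpoly n)"
    have "\<ominus>\<^bsub>mpoly (Suc n)\<^esub> F = \<ominus>\<^bsub>mpoly n\<^esub> F"
      using subsetD[OF mpoly_mono F] subsetD[OF mpoly_mono T.a_inv_closed[OF F]] T.l_neg[OF F]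
      by (intro T'.minus_equality) (simp_all only: eq)
    then show "\<ominus>\<^bsub>mpoly (Suc n)\<^esub> F \<in> carrier (mpoly n)"
      using T.a_inv_closed[OF F] by (simp only:)
  qed (simp_all only: eq mpoly_mono T.one_closed T.m_closed T.a_closed)
qed

text \<open>The spans increase with \<open>k\<close>, so their union is closed under sums.
  Multiplication by an earlier variable acts on the coefficients, and multiplication by the last one
  moves to the next span.\<close>

lemma (in cring) mpoly_power_span:
  assumes "F \<in> carrier (mpoly (Suc n))"
  shows "\<exists>k. F \<in> ring.power_span (mpoly (Suc n)) (carrier (mpoly n)) (indexed_var n) k"
proof -
  interpret T: cring "mpoly n" by (rule mpoly_cring)
  interpret T': cring "mpoly (Suc n)" by (rule mpoly_cring)
  let ?x = "indexed_var n"
  note A = mpoly_subring[of n]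
  have x: "?x \<in> carrier (mpoly (Suc n))"
    by (simp add: mpoly_var_closed)
  let ?M = "T'.power_span (carrier (mpoly n)) ?x"
  have Suc: "?M k \<subseteq> ?M (Suc k)" for k
  proof
    fix m assume m: "m \<in> ?M k"
    have "m = \<zero>\<^bsub>mpoly (Suc n)\<^esub> \<otimes>\<^bsub>mpoly (Suc n)\<^esub> ?x [^]\<^bsub>mpoly (Suc n)\<^esub> k \<oplus>\<^bsub>mpoly (Suc n)\<^esub> m"
      using T'.power_span_closed[OF A x m] x by simp
    with m show "m \<in> ?M (Suc k)"
      using subringE(2)[OF A] by auto
  qed
  have mono: "?M k \<subseteq> ?M l" if "k \<le> l" for k l
    by (rule lift_Suc_mono_le[of ?M, OF Suc that])
  show ?thesis
    using assms
  proof (induction rule: mpoly_induct)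
    case (const k)
    let ?c = "indexed_const k :: nat multiset \<Rightarrow> 'a"
    have "?c \<in> carrier (mpoly n)" "?c \<in> carrier (mpoly (Suc n))"
      using const by (auto simp: mpoly_const_closed)
    then have "?c \<in> ?M 1"
      by (auto intro!: exI[of _ ?c])
    then show ?case by blast
  next
    case (add F G)
    then obtain k l where "F \<in> ?M k" "G \<in> ?M l" by auto
    then have "F \<in> ?M (max k l)" "G \<in> ?M (max k l)"
      using mono[of k "max k l"] mono[of l "max k l"] by auto
    then show ?case
      using T'.power_span_add[OF A x] by blast
  next
    case (var F i)
    then obtain k where k: "F \<in> ?M k" by auto
    show ?case
    proof (cases "i = n")
      case True
      then show ?thesis using T'.power_span_shift[OF A x k] by blast
    next
      case False
      then have "indexed_var i \<in> carrier (mpoly n)"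
        using var by (simp add: mpoly_var_closed)
      then show ?thesis using T'.power_span_mult[OF A x _ k] by blast
    qed
  qed
qed

theorem (in cring) mpoly_noetherian:
  assumes "noetherian_ring R"
  shows "noetherian_ring (mpoly n)"
proof (induction n)
  case 0
  interpret c: ring_hom_cring R "mpoly 0" indexed_const by (rule mpoly_const_hom)
  \<comment> \<open>Without variables only constants remain, but these are functions on multisets,
    so \<open>mpoly 0\<close> is an image of \<open>R\<close> rather than \<open>R\<close>
    itself.\<close>
  have "F \<in> indexed_const ` carrier R" if "F \<in> carrier (mpoly 0)" for F
    using that
  proof (induction rule: mpoly_induct)
    case (add F G)
    then show ?case using c.hom_add[symmetric] by (auto simp del: c.hom_add)
  qed auto
  then show ?case
    by (intro c.noetherian_surj_image[OF assms]) auto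
next
  case (Suc n)
  interpret T': cring "mpoly (Suc n)" by (rule mpoly_cring)
  \<comment> \<open>The number of variables enters only the carrier, so restricting it yields
    literally the smaller ring, as \<open>noetherian_adjoin\<close> requires.\<close>
  have "mpoly (Suc n)\<lparr>carrier := carrier (mpoly n)\<rparr> = mpoly n"
    by (simp add: mpoly_ring_def)
  with Suc show ?case
    by (intro T'.noetherian_adjoin[OF mpoly_subring _ mpoly_var_closed mpoly_power_span]) auto
qed

section \<open>Evaluation homomorphisms\<close>

context ring_hom_cring
begin

definition monomial_value :: "(nat \<Rightarrow> 'c) \<Rightarrow> nat multiset \<Rightarrow> 'c" where
  "monomial_value s \<mu> = (\<Otimes>\<^bsub>S\<^esub>j\<in>set_mset \<mu>. s j [^]\<^bsub>S\<^esub> count \<mu> j)"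

text \<open>The shape follows \<open>rees_map\<close>, which is thereby an instance; linear
  substitutions between polynomial rings are another one.\<close>

definition mpoly_eval :: "(nat \<Rightarrow> 'c) \<Rightarrow> (nat multiset \<Rightarrow> 'a) \<Rightarrow> 'c" where
  "mpoly_eval s F = (\<Oplus>\<^bsub>S\<^esub>\<mu>\<in>{\<mu>. F \<mu> \<noteq> \<zero>}. h (F \<mu>) \<otimes>\<^bsub>S\<^esub> monomial_value s \<mu>)"

context
  fixes s :: "nat \<Rightarrow> 'c" and n :: nat
  assumes s: "s \<in> {..<n} \<rightarrow> carrier S"
begin

lemma monomial_value_closed:
  "set_mset \<mu> \<subseteq> {..<n} \<Longrightarrow> monomial_value s \<mu> \<in> carrier S"
  unfolding monomial_value_def using s by (intro S.finprod_closed) auto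

text \<open>The product runs over the support of \<open>\<mu>\<close>, which may or may not contain
  \<open>i\<close>. The index \<open>i\<close> is split off in any case; if it is absent from
  \<open>\<mu>\<close>, the split-off factor has exponent zero.\<close>

lemma monomial_value_add_mset:
  assumes "set_mset \<mu> \<subseteq> {..<n}" "i < n"
  shows "monomial_value s (add_mset i \<mu>) = s i \<otimes>\<^bsub>S\<^esub> monomial_value s \<mu>"
proof -
  let ?A = "set_mset \<mu> - {i}"
  have c: "(\<lambda>j. s j [^]\<^bsub>S\<^esub> count \<mu> j) \<in> ?A \<rightarrow> carrier S" "s i \<in> carrier S"
    using s assms by auto
  then have f: "(\<Otimes>\<^bsub>S\<^esub>j\<in>?A. s j [^]\<^bsub>S\<^esub> count \<mu> j) \<in> carrier S"
    by (intro S.finprod_closed)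
  have "monomial_value s (add_mset i \<mu>) =
      (\<Otimes>\<^bsub>S\<^esub>j\<in>insert i ?A. s j [^]\<^bsub>S\<^esub> count (add_mset i \<mu>) j)"
    by (simp add: monomial_value_def)
  also have "\<dots> = s i [^]\<^bsub>S\<^esub> Suc (count \<mu> i) \<otimes>\<^bsub>S\<^esub> (\<Otimes>\<^bsub>S\<^esub>j\<in>?A. s j [^]\<^bsub>S\<^esub> count (add_mset i \<mu>) j)"
    using s assms by (subst S.finprod_insert) (auto simp del: S.nat_pow_Suc)
  also have "(\<Otimes>\<^bsub>S\<^esub>j\<in>?A. s j [^]\<^bsub>S\<^esub> count (add_mset i \<mu>) j) = (\<Otimes>\<^bsub>S\<^esub>j\<in>?A. s j [^]\<^bsub>S\<^esub> count \<mu> j)"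
    using c by (intro S.finprod_cong') auto
  also have "s i [^]\<^bsub>S\<^esub> Suc (count \<mu> i) \<otimes>\<^bsub>S\<^esub> \<dots> = s i \<otimes>\<^bsub>S\<^esub> (s i [^]\<^bsub>S\<^esub> count \<mu> i \<otimes>\<^bsub>S\<^esub> \<dots>)"
    using c(2) f by (simp add: S.m_ac)
  also have "s i [^]\<^bsub>S\<^esub> count \<mu> i \<otimes>\<^bsub>S\<^esub> (\<Otimes>\<^bsub>S\<^esub>j\<in>?A. s j [^]\<^bsub>S\<^esub> count \<mu> j) = monomial_value s \<mu>"
  proof (cases "i \<in># \<mu>")
    case True
    then have "monomial_value s \<mu> = (\<Otimes>\<^bsub>S\<^esub>j\<in>insert i ?A. s j [^]\<^bsub>S\<^esub> count \<mu> j)"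
      by (simp add: monomial_value_def insert_absorb)
    also have "\<dots> = s i [^]\<^bsub>S\<^esub> count \<mu> i \<otimes>\<^bsub>S\<^esub> (\<Otimes>\<^bsub>S\<^esub>j\<in>?A. s j [^]\<^bsub>S\<^esub> count \<mu> j)"
      using c by (subst S.finprod_insert) auto
    finally show ?thesis ..
  next
    case False
    then have "?A = set_mset \<mu>" "count \<mu> i = 0"
      by (auto simp: not_in_iff)
    then show ?thesis
      using f by (simp add: monomial_value_def)
  qed
  finally show ?thesis .
qed

text \<open>Sums over different supports can be compared on a common finite set, provided its
  monomials involve only variables with values in \<open>S\<close>.\<close>

lemma mpoly_eval_superset:
  assumes F: "F \<in> carrier (mpoly_ring R n)" and A: "finite A" "{\<mu>. F \<mu> \<noteq> \<zero>} \<subseteq> A"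
    and vars: "\<And>\<mu>. \<mu> \<in> A \<Longrightarrow> set_mset \<mu> \<subseteq> {..<n}"
  shows "mpoly_eval s F = (\<Oplus>\<^bsub>S\<^esub>\<mu>\<in>A. h (F \<mu>) \<otimes>\<^bsub>S\<^esub> monomial_value s \<mu>)"
  unfolding mpoly_eval_def using A R.mpoly_coeff[OF F] monomial_value_closed[OF vars]
  by (intro S.add.finprod_mono_neutral_cong_left) auto

lemma mpoly_eval_closed:
  assumes F: "F \<in> carrier (mpoly_ring R n)"
  shows "mpoly_eval s F \<in> carrier S"
  unfolding mpoly_eval_def
  using R.mpoly_coeff[OF F] monomial_value_closed[OF R.mpoly_support_vars[OF F]]
  by (intro S.finsum_closed) auto

lemma mpoly_eval_const:
  assumes "k \<in> carrier R"
  shows "mpoly_eval s (R.indexed_const k) = h k"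
proof -
  have "mpoly_eval s (R.indexed_const k) =
      (\<Oplus>\<^bsub>S\<^esub>\<mu>\<in>{{#}}. h (R.indexed_const k \<mu>) \<otimes>\<^bsub>S\<^esub> monomial_value s \<mu>)"
    using assms by (intro mpoly_eval_superset R.mpoly_const_closed) (auto simp: R.indexed_const_def)
  also have "\<dots> = h k"
    using assms by (simp add: R.indexed_const_def monomial_value_def)
  finally show ?thesis .
qed

lemma mpoly_eval_add:
  assumes F: "F \<in> carrier (mpoly_ring R n)" and G: "G \<in> carrier (mpoly_ring R n)"
  shows "mpoly_eval s (F \<oplus>\<^bsub>mpoly_ring R n\<^esub> G) = mpoly_eval s F \<oplus>\<^bsub>S\<^esub> mpoly_eval s G"
proof -
  let ?A = "{\<mu>. F \<mu> \<noteq> \<zero>} \<union> {\<mu>. G \<mu> \<noteq> \<zero>}"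
  note FG = R.mpoly_a_closed[OF F G]
  have A: "finite ?A"
    using R.mpoly_finite_support[OF F] R.mpoly_finite_support[OF G] by simp
  have v: "set_mset \<mu> \<subseteq> {..<n}" if "\<mu> \<in> ?A" for \<mu>
    using that R.mpoly_support_vars[OF F] R.mpoly_support_vars[OF G] by blast
  note c = R.mpoly_coeff[OF F] R.mpoly_coeff[OF G] monomial_value_closed[OF v]
  have "{\<mu>. (F \<oplus>\<^bsub>mpoly_ring R n\<^esub> G) \<mu> \<noteq> \<zero>} \<subseteq> ?A"
    by (auto simp: R.mpoly_add)
  then have "mpoly_eval s (F \<oplus>\<^bsub>mpoly_ring R n\<^esub> G) =
      (\<Oplus>\<^bsub>S\<^esub>\<mu>\<in>?A. h (F \<mu> \<oplus> G \<mu>) \<otimes>\<^bsub>S\<^esub> monomial_value s \<mu>)"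
    using mpoly_eval_superset[OF FG A _ v] by (simp add: R.mpoly_add)
  also have "\<dots> = (\<Oplus>\<^bsub>S\<^esub>\<mu>\<in>?A. h (F \<mu>) \<otimes>\<^bsub>S\<^esub> monomial_value s \<mu> \<oplus>\<^bsub>S\<^esub> h (G \<mu>) \<otimes>\<^bsub>S\<^esub> monomial_value s \<mu>)"
    using c by (intro S.finsum_cong') (auto simp: S.l_distr)
  also have "\<dots> = mpoly_eval s F \<oplus>\<^bsub>S\<^esub> mpoly_eval s G"
  proof -
    have "mpoly_eval s F = (\<Oplus>\<^bsub>S\<^esub>\<mu>\<in>?A. h (F \<mu>) \<otimes>\<^bsub>S\<^esub> monomial_value s \<mu>)"
      "mpoly_eval s G = (\<Oplus>\<^bsub>S\<^esub>\<mu>\<in>?A. h (G \<mu>) \<otimes>\<^bsub>S\<^esub> monomial_value s \<mu>)"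
      by (rule mpoly_eval_superset[OF _ A _ v]; use F G in auto)+
    then show ?thesis
      using c by (simp only:) (intro S.finsum_addf; auto)
  qed
  finally show ?thesis .
qed

lemma mpoly_eval_shift:
  assumes F: "F \<in> carrier (mpoly_ring R n)" and i: "i < n"
  shows "mpoly_eval s (R.indexed_var i \<otimes>\<^bsub>mpoly_ring R n\<^esub> F) = s i \<otimes>\<^bsub>S\<^esub> mpoly_eval s F"
proof -
  let ?G = "R.indexed_pmult F i" and ?A = "{\<mu>. F \<mu> \<noteq> \<zero>}"
  note v = R.mpoly_support_vars[OF F]
  note c = R.mpoly_coeff[OF F] monomial_value_closed[OF v]
  have si: "s i \<in> carrier S"
    using s i by auto
  have supp: "{\<mu>. ?G \<mu> \<noteq> \<zero>} = add_mset i ` ?A"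
  proof
    show "{\<mu>. ?G \<mu> \<noteq> \<zero>} \<subseteq> add_mset i ` ?A"
    proof
      fix \<mu> assume "\<mu> \<in> {\<mu>. ?G \<mu> \<noteq> \<zero>}"
      then have "i \<in># \<mu>" "F (\<mu> - {#i#}) \<noteq> \<zero>"
        by (auto simp: R.indexed_pmult_def split: if_splits)
      then show "\<mu> \<in> add_mset i ` ?A"
        by (auto intro!: image_eqI[of _ _ "\<mu> - {#i#}"])
    qed
  qed (auto simp: R.indexed_pmult_def)
  have "mpoly_eval s (R.indexed_var i \<otimes>\<^bsub>mpoly_ring R n\<^esub> F) =
      (\<Oplus>\<^bsub>S\<^esub>\<mu>\<in>add_mset i ` ?A. h (?G \<mu>) \<otimes>\<^bsub>S\<^esub> monomial_value s \<mu>)"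
    by (simp only: R.mpoly_var_mult[OF F] mpoly_eval_def supp)
  also have "\<dots> = (\<Oplus>\<^bsub>S\<^esub>\<mu>\<in>?A. h (?G (add_mset i \<mu>)) \<otimes>\<^bsub>S\<^esub> monomial_value s (add_mset i \<mu>))"
    using c si v i
    by (intro S.finsum_reindex) (auto simp: R.indexed_pmult_def inj_on_def monomial_value_add_mset)
  also have "\<dots> = (\<Oplus>\<^bsub>S\<^esub>\<mu>\<in>?A. s i \<otimes>\<^bsub>S\<^esub> (h (F \<mu>) \<otimes>\<^bsub>S\<^esub> monomial_value s \<mu>))"
    using c si v i
    by (intro S.finsum_cong') (auto simp: R.indexed_pmult_def monomial_value_add_mset S.m_ac)
  also have "\<dots> = s i \<otimes>\<^bsub>S\<^esub> mpoly_eval s F"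
    unfolding mpoly_eval_def using c si R.mpoly_finite_support[OF F]
    by (intro S.finsum_rdistr[symmetric]) auto
  finally show ?thesis .
qed

lemma mpoly_eval_var:
  assumes "i < n"
  shows "mpoly_eval s (R.indexed_var i) = s i"
proof -
  interpret T: cring "mpoly_ring R n" by (rule R.mpoly_cring)
  have "s i \<in> carrier S"
    using s assms by auto
  then show ?thesis
    using mpoly_eval_shift[OF T.one_closed assms] mpoly_eval_const[OF R.one_closed]
      T.r_one[OF R.mpoly_var_closed[OF assms]]
    by (simp add: R.mpoly_one)
qed

text \<open>The convolution is never expanded: induction on the left factor reduces to a constant,
  and then induction on the right factor finishes.\<close>

lemma mpoly_eval_mult:
  assumes F: "F \<in> carrier (mpoly_ring R n)" and G: "G \<in> carrier (mpoly_ring R n)"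
  shows "mpoly_eval s (F \<otimes>\<^bsub>mpoly_ring R n\<^esub> G) = mpoly_eval s F \<otimes>\<^bsub>S\<^esub> mpoly_eval s G"
proof -
  interpret T: cring "mpoly_ring R n" by (rule R.mpoly_cring)
  note simps = mpoly_eval_add mpoly_eval_shift mpoly_eval_const mpoly_eval_closed
    R.mpoly_const_closed R.mpoly_var_closed s[THEN funcset_mem]
  show ?thesis
    using F
  proof (induction rule: R.mpoly_induct)
    case (const k)
    show ?case
      using G
    proof (induction rule: R.mpoly_induct)
      case (const l)
      with \<open>k \<in> carrier R\<close> show ?case
        by (simp add: R.mpoly_const_mult_const simps)
    next
      case (add F G)
      with \<open>k \<in> carrier R\<close> show ?case
        by (simp add: T.r_distr S.r_distr simps)
    next
      case (var F i)
      then have "R.indexed_const k \<otimes>\<^bsub>mpoly_ring R n\<^esub> (R.indexed_var i \<otimes>\<^bsub>mpoly_ring R n\<^esub> F) =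
          R.indexed_var i \<otimes>\<^bsub>mpoly_ring R n\<^esub> (R.indexed_const k \<otimes>\<^bsub>mpoly_ring R n\<^esub> F)"
        using \<open>k \<in> carrier R\<close> by (intro T.m_lcomm) (auto simp: simps)
      moreover have "s i \<in> carrier S"
        using s var by auto
      ultimately show ?case
        using var \<open>k \<in> carrier R\<close> by (simp add: simps S.m_lcomm)
    qed
  next
    case (add F F')
    with G show ?case by (simp add: T.l_distr S.l_distr simps)
  next
    case (var F i)
    moreover have "s i \<in> carrier S"
      using s var by auto
    ultimately show ?case
      using G by (simp add: T.m_assoc S.m_assoc simps)
  qed
qed

theorem mpoly_eval_hom: "ring_hom_cring (mpoly_ring R n) S (mpoly_eval s)"
  by (rule ring_hom_cringI[OF R.mpoly_cring S.is_cring ring_hom_memI])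
    (simp_all add: mpoly_eval_closed mpoly_eval_mult mpoly_eval_add R.mpoly_one mpoly_eval_const)

end

end

text \<open>The product case rests on f(x)f(F) - g(x)g(F) = f(F)(f(x) - g(x)) + g(x)(f(F) - g(F)).
  With \<open>L\<close> zero this gives uniqueness of homomorphisms; with the linear ideal it
  compares a composite of substitutions with the identity.\<close>

lemma (in cring) mpoly_homs_cong:
  assumes f: "ring_hom_cring (mpoly_ring R n) S f" and g: "ring_hom_cring (mpoly_ring R n) S g"
    and L: "ideal L S"
    and const: "\<And>k. k \<in> carrier R \<Longrightarrow> f (indexed_const k) = g (indexed_const k)"
    and var: "\<And>i. i < n \<Longrightarrow> f (indexed_var i) \<ominus>\<^bsub>S\<^esub> g (indexed_var i) \<in> L"
    and F: "F \<in> carrier (mpoly_ring R n)"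
  shows "f F \<ominus>\<^bsub>S\<^esub> g F \<in> L"
proof -
  interpret f: ring_hom_cring "mpoly_ring R n" S f by (rule f)
  interpret g: ring_hom_cring "mpoly_ring R n" S g by (rule g)
  note L' = f.S.idealD[OF L]
  show ?thesis
    using F
  proof (induction rule: mpoly_induct)
    case (const k)
    then show ?case
      using L'(2) by (simp add: assms(4) mpoly_const_closed f.S.r_neg a_minus_def)
  next
    case (add F G)
    have "f (F \<oplus>\<^bsub>mpoly_ring R n\<^esub> G) \<ominus>\<^bsub>S\<^esub> g (F \<oplus>\<^bsub>mpoly_ring R n\<^esub> G) =
        (f F \<ominus>\<^bsub>S\<^esub> g F) \<oplus>\<^bsub>S\<^esub> (f G \<ominus>\<^bsub>S\<^esub> g G)"
      using add(1,2) f.hom_closed[of F] f.hom_closed[of G] g.hom_closed[of F] g.hom_closed[of G]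
      unfolding f.hom_add[OF add(1,2)] g.hom_add[OF add(1,2)] by algebra
    with add(3,4) L'(3) show ?case by simp
  next
    case (var F i)
    let ?X = "indexed_var i :: nat multiset \<Rightarrow> 'a"
    note X = mpoly_var_closed[OF var(2)]
    note c = f.hom_closed[OF X] g.hom_closed[OF X] f.hom_closed[OF var(1)] g.hom_closed[OF var(1)]
    have "f (?X \<otimes>\<^bsub>mpoly_ring R n\<^esub> F) \<ominus>\<^bsub>S\<^esub> g (?X \<otimes>\<^bsub>mpoly_ring R n\<^esub> F) =
        f F \<otimes>\<^bsub>S\<^esub> (f ?X \<ominus>\<^bsub>S\<^esub> g ?X) \<oplus>\<^bsub>S\<^esub> g ?X \<otimes>\<^bsub>S\<^esub> (f F \<ominus>\<^bsub>S\<^esub> g F)"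
      using c unfolding f.hom_mult[OF X var(1)] g.hom_mult[OF X var(1)] by algebra
    then show ?case
      using L'(3)[OF L'(5)[OF assms(5)[OF var(2)] c(3)] L'(5)[OF var(3) c(2)]] by simp
  qed
qed

lemma (in cring) mpoly_homs_eq:
  assumes f: "ring_hom_cring (mpoly_ring R n) S f" and g: "ring_hom_cring (mpoly_ring R n) S g"
    and const: "\<And>k. k \<in> carrier R \<Longrightarrow> f (indexed_const k) = g (indexed_const k)"
    and var: "\<And>i. i < n \<Longrightarrow> f (indexed_var i) = g (indexed_var i)"
    and F: "F \<in> carrier (mpoly_ring R n)"
  shows "f F = g F"
proof -
  interpret f: ring_hom_cring "mpoly_ring R n" S f by (rule f)
  interpret g: ring_hom_cring "mpoly_ring R n" S g by (rule g)
  have "f F \<ominus>\<^bsub>S\<^esub> g F \<in> {\<zero>\<^bsub>S\<^esub>}"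
    using mpoly_homs_cong[OF f g f.S.zeroideal const _ F] var
    by (simp add: mpoly_var_closed f.S.r_neg a_minus_def)
  then show ?thesis
    using F by simp
qed

text \<open>Coefficients are attached to positions of the list and not to its elements, so that
  repeated entries are allowed and positions match variables. The combinations form an ideal, and
  Kronecker coefficients show that it contains every entry.\<close>

lemma (in cring) Idl_list_combination:
  assumes fs: "set fs \<subseteq> carrier R" and g: "g \<in> Idl (set fs)"
  shows "\<exists>c\<in>{..<length fs} \<rightarrow> carrier R. g = (\<Oplus>i\<in>{..<length fs}. c i \<otimes> fs ! i)"
proof -
  let ?n = "length fs"
  let ?I = "{\<Oplus>i\<in>{..<?n}. c i \<otimes> fs ! i | c. c \<in> {..<?n} \<rightarrow> carrier R}"
  have fc: "fs ! i \<in> carrier R" if "i < ?n" for i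
    using that fs by (meson nth_mem subsetD)
  have "ideal ?I R"
  proof (rule ideal_memI)
    show "?I \<subseteq> carrier R"
      using fc by (auto intro!: finsum_closed)
    have "(\<Oplus>i\<in>{..<?n}. \<zero> \<otimes> fs ! i) = (\<Oplus>i\<in>{..<?n}. \<zero>)"
      using fc by (intro finsum_cong') auto
    then show "\<zero> \<in> ?I"
      by (auto intro!: exI[of _ "\<lambda>_. \<zero>"])
    fix a assume "a \<in> ?I"
    then obtain c where c: "c \<in> {..<?n} \<rightarrow> carrier R" "a = (\<Oplus>i\<in>{..<?n}. c i \<otimes> fs ! i)"
      by auto
    show "a \<oplus> b \<in> ?I" if b: "b \<in> ?I" for b
    proof -
      obtain d where d: "d \<in> {..<?n} \<rightarrow> carrier R" "b = (\<Oplus>i\<in>{..<?n}. d i \<otimes> fs ! i)"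
        using b by auto
      have "a \<oplus> b = (\<Oplus>i\<in>{..<?n}. c i \<otimes> fs ! i \<oplus> d i \<otimes> fs ! i)"
        unfolding c(2) d(2) using c(1) d(1) fc by (intro finsum_addf[symmetric]) auto
      also have "\<dots> = (\<Oplus>i\<in>{..<?n}. (c i \<oplus> d i) \<otimes> fs ! i)"
        using c(1) d(1) fc by (intro finsum_cong') (auto simp: l_distr Pi_def)
      finally show ?thesis
        using c(1) d(1) by (auto intro!: exI[of _ "\<lambda>i. c i \<oplus> d i"])
    qed
    show "x \<otimes> a \<in> ?I" if "x \<in> carrier R" for x
    proof -
      have "x \<otimes> a = (\<Oplus>i\<in>{..<?n}. x \<otimes> (c i \<otimes> fs ! i))"
        unfolding c(2) using that c(1) fc by (intro finsum_rdistr) auto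
      also have "\<dots> = (\<Oplus>i\<in>{..<?n}. (x \<otimes> c i) \<otimes> fs ! i)"
        using that c(1) fc by (intro finsum_cong') (auto simp: m_assoc Pi_def)
      finally show ?thesis
        using c(1) that by (auto intro!: exI[of _ "\<lambda>i. x \<otimes> c i"])
    qed
  qed
  moreover have "set fs \<subseteq> ?I"
  proof
    fix f assume "f \<in> set fs"
    then obtain j where j: "j < ?n" "f = fs ! j"
      by (auto simp: in_set_conv_nth)
    have "(\<Oplus>i\<in>{..<?n}. (if j = i then \<one> else \<zero>) \<otimes> fs ! i) =
        (\<Oplus>i\<in>{..<?n}. if j = i then fs ! i else \<zero>)"
      using fc by (intro finsum_cong') auto
    also have "\<dots> = f"
      using j fc by (subst finsum_singleton) auto
    finally show "f \<in> ?I"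
      by (auto intro!: exI[of _ "\<lambda>i. if j = i then \<one> else \<zero>"])
  qed
  ultimately show ?thesis
    using genideal_minimal[of ?I "set fs"] g by blast
qed

section \<open>Linear relations and the Rees ideal\<close>

definition (in ring) linear_form :: "nat \<Rightarrow> (nat \<Rightarrow> 'a) \<Rightarrow> nat multiset \<Rightarrow> 'a" where
  "linear_form n a =
     (\<Oplus>\<^bsub>mpoly_ring R n\<^esub>i\<in>{..<n}. indexed_const (a i) \<otimes>\<^bsub>mpoly_ring R n\<^esub> indexed_var i)"

definition (in ring) linear_forms :: "nat \<Rightarrow> (nat multiset \<Rightarrow> 'a) set" where
  "linear_forms n = linear_form n ` ({..<n} \<rightarrow> carrier R)"

context cring
begin

lemma linear_term_closed:
  assumes "a \<in> {..<n} \<rightarrow> carrier R"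
  shows "(\<lambda>i. indexed_const (a i) \<otimes>\<^bsub>mpoly_ring R n\<^esub> indexed_var i) \<in> {..<n} \<rightarrow> carrier (mpoly_ring R n)"
  using assms by (auto intro!: mpoly_m_closed mpoly_const_closed mpoly_var_closed)

lemma linear_form_closed:
  assumes "a \<in> {..<n} \<rightarrow> carrier R"
  shows "linear_form n a \<in> carrier (mpoly_ring R n)"
proof -
  interpret T: cring "mpoly_ring R n" by (rule mpoly_cring)
  show ?thesis
    unfolding linear_form_def by (rule T.finsum_closed[OF linear_term_closed[OF assms]])
qed

lemma linear_forms_closed: "linear_forms n \<subseteq> carrier (mpoly_ring R n)"
  by (auto simp: linear_forms_def intro: linear_form_closed)

lemma linear_form_add:
  assumes a: "a \<in> {..<n} \<rightarrow> carrier R" and b: "b \<in> {..<n} \<rightarrow> carrier R"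
  shows "linear_form n a \<oplus>\<^bsub>mpoly_ring R n\<^esub> linear_form n b = linear_form n (\<lambda>i. a i \<oplus> b i)"
proof -
  interpret T: cring "mpoly_ring R n" by (rule mpoly_cring)
  interpret c: ring_hom_cring R "mpoly_ring R n" indexed_const by (rule mpoly_const_hom)
  show ?thesis
    unfolding linear_form_def T.finsum_addf[OF linear_term_closed[OF a] linear_term_closed[OF b], symmetric]
    using a b mpoly_var_closed[of _ n]
    by (intro T.finsum_cong') (auto simp: Pi_def T.l_distr)
qed

lemma linear_form_smult:
  assumes k: "k \<in> carrier R" and a: "a \<in> {..<n} \<rightarrow> carrier R"
  shows "indexed_const k \<otimes>\<^bsub>mpoly_ring R n\<^esub> linear_form n a = linear_form n (\<lambda>i. k \<otimes> a i)"
proof -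
  interpret T: cring "mpoly_ring R n" by (rule mpoly_cring)
  interpret c: ring_hom_cring R "mpoly_ring R n" indexed_const by (rule mpoly_const_hom)
  have "indexed_const k \<otimes>\<^bsub>mpoly_ring R n\<^esub> linear_form n a = (\<Oplus>\<^bsub>mpoly_ring R n\<^esub>i\<in>{..<n}.
      indexed_const k \<otimes>\<^bsub>mpoly_ring R n\<^esub> (indexed_const (a i) \<otimes>\<^bsub>mpoly_ring R n\<^esub> indexed_var i))"
    unfolding linear_form_def
    by (rule T.finsum_rdistr[OF _ mpoly_const_closed[OF k] linear_term_closed[OF a]]) simp
  also have "\<dots> = linear_form n (\<lambda>i. k \<otimes> a i)"
    unfolding linear_form_def using k a mpoly_var_closed[of _ n]
    by (intro T.finsum_cong') (auto simp: Pi_def T.m_assoc)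
  finally show ?thesis .
qed

lemma linear_forms_add:
  "F \<in> linear_forms n \<Longrightarrow> G \<in> linear_forms n \<Longrightarrow> F \<oplus>\<^bsub>mpoly_ring R n\<^esub> G \<in> linear_forms n"
  unfolding linear_forms_def by (auto simp: linear_form_add Pi_def intro!: imageI)

lemma linear_forms_smult:
  "k \<in> carrier R \<Longrightarrow> F \<in> linear_forms n \<Longrightarrow> indexed_const k \<otimes>\<^bsub>mpoly_ring R n\<^esub> F \<in> linear_forms n"
  unfolding linear_forms_def by (auto simp: linear_form_smult Pi_def intro!: imageI)

lemma indexed_var_in_linear_forms:
  assumes "j < n"
  shows "indexed_var j \<in> linear_forms n"
proof -
  interpret T: cring "mpoly_ring R n" by (rule mpoly_cring)
  interpret c: ring_hom_cring R "mpoly_ring R n" indexed_const by (rule mpoly_const_hom)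
  let ?a = "\<lambda>i. if j = i then \<one> else \<zero>"
  have "linear_form n ?a = (\<Oplus>\<^bsub>mpoly_ring R n\<^esub>i\<in>{..<n}. if j = i then indexed_var i else \<zero>\<^bsub>mpoly_ring R n\<^esub>)"
    unfolding linear_form_def using mpoly_var_closed[of _ n]
    by (intro T.finsum_cong') auto
  also have "\<dots> = indexed_var j"
    using assms mpoly_var_closed by (subst T.finsum_singleton) auto
  finally show ?thesis
    unfolding linear_forms_def by (intro image_eqI[where f = "linear_form n" and x = ?a]) auto
qed

lemma linear_forms_zero: "\<zero>\<^bsub>mpoly_ring R n\<^esub> \<in> linear_forms n"
proof -
  interpret T: cring "mpoly_ring R n" by (rule mpoly_cring)
  interpret c: ring_hom_cring R "mpoly_ring R n" indexed_const by (rule mpoly_const_hom)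
  have "linear_form n (\<lambda>_. \<zero>) = (\<Oplus>\<^bsub>mpoly_ring R n\<^esub>i\<in>{..<n}. \<zero>\<^bsub>mpoly_ring R n\<^esub>)"
    unfolding linear_form_def using mpoly_var_closed[of _ n]
    by (intro T.finsum_cong') auto
  then have "\<zero>\<^bsub>mpoly_ring R n\<^esub> = linear_form n (\<lambda>_. \<zero>)"
    by simp
  then show ?thesis
    unfolding linear_forms_def by (rule image_eqI[where f = "linear_form n"]) simp
qed

lemma linear_forms_diff:
  assumes "F \<in> linear_forms n" "G \<in> linear_forms n"
  shows "F \<ominus>\<^bsub>mpoly_ring R n\<^esub> G \<in> linear_forms n"
proof -
  interpret T: cring "mpoly_ring R n" by (rule mpoly_cring)
  interpret c: ring_hom_cring R "mpoly_ring R n" indexed_const by (rule mpoly_const_hom)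
  have c: "F \<in> carrier (mpoly_ring R n)" "G \<in> carrier (mpoly_ring R n)"
    using assms linear_forms_closed by auto
  have "indexed_const (\<ominus> \<one>) = \<ominus>\<^bsub>mpoly_ring R n\<^esub> \<one>\<^bsub>mpoly_ring R n\<^esub>"
    using c.hom_a_inv[OF one_closed] by simp
  then have "F \<ominus>\<^bsub>mpoly_ring R n\<^esub> G =
      F \<oplus>\<^bsub>mpoly_ring R n\<^esub> indexed_const (\<ominus> \<one>) \<otimes>\<^bsub>mpoly_ring R n\<^esub> G"
    using c by (simp add: T.l_minus a_minus_def)
  then show ?thesis
    using linear_forms_add[OF assms(1) linear_forms_smult[OF _ assms(2), of "\<ominus> \<one>"]] by simp
qed

lemma linear_forms_finsum:
  assumes "finite A" "f \<in> A \<rightarrow> linear_forms n"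
  shows "(\<Oplus>\<^bsub>mpoly_ring R n\<^esub>i\<in>A. f i) \<in> linear_forms n"
proof -
  interpret T: cring "mpoly_ring R n" by (rule mpoly_cring)
  show ?thesis
    using assms
  proof (induction rule: finite_induct)
    case empty
    show ?case by (simp add: linear_forms_zero)
  next
    case (insert x A)
    then have "f \<in> A \<rightarrow> carrier (mpoly_ring R n)" "f x \<in> carrier (mpoly_ring R n)"
      using linear_forms_closed[of n] by (auto simp: Pi_def)
    then have "(\<Oplus>\<^bsub>mpoly_ring R n\<^esub>i\<in>insert x A. f i) = f x \<oplus>\<^bsub>mpoly_ring R n\<^esub> (\<Oplus>\<^bsub>mpoly_ring R n\<^esub>i\<in>A. f i)"
      using insert.hyps by (intro T.finsum_insert)
    with insert show ?case by (simp add: linear_forms_add)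
  qed
qed

context
  fixes fs :: "'a list"
  assumes fs: "set fs \<subseteq> carrier R"
begin

lemma fs_nth_closed: "i < length fs \<Longrightarrow> fs ! i \<in> carrier R"
  using fs by (meson nth_mem subsetD)

text \<open>All three facts come from reading \<open>rees_map\<close> as evaluation along the
  constant embedding of \<open>R\<close> into R[t], with the variable \<open>j\<close> sent to
  \<open>fs ! j\<close> times t.\<close>

lemma
  shows rees_map_hom: "ring_hom_cring (mpoly_ring R (length fs)) (UP R) (rees_map R fs)"
    and rees_map_const: "k \<in> carrier R \<Longrightarrow> rees_map R fs (indexed_const k) = up_ring.monom (UP R) k 0"
    and rees_map_var: "i < length fs \<Longrightarrow> rees_map R fs (indexed_var i) = up_ring.monom (UP R) (fs ! i) 1"
proof -
  interpret U: UP_cring R "UP R" by unfold_locales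
  interpret c: ring_hom_cring R "UP R" "\<lambda>a. up_ring.monom (UP R) a 0"
    by (rule ring_hom_cringI[OF is_cring U.UP_cring]) (rule U.const_ring_hom)
  let ?s = "\<lambda>j. up_ring.monom (UP R) (fs ! j) 1"
  have s: "?s \<in> {..<length fs} \<rightarrow> carrier (UP R)"
    using fs_nth_closed by simp
  have eq: "rees_map R fs = c.mpoly_eval ?s"
    by (simp add: rees_map_def c.mpoly_eval_def c.monomial_value_def fun_eq_iff)
  show "ring_hom_cring (mpoly_ring R (length fs)) (UP R) (rees_map R fs)"
    unfolding eq by (rule c.mpoly_eval_hom[OF s])
  show "rees_map R fs (indexed_const k) = up_ring.monom (UP R) k 0" if "k \<in> carrier R"
    unfolding eq by (rule c.mpoly_eval_const[OF s that])
  show "rees_map R fs (indexed_var i) = up_ring.monom (UP R) (fs ! i) 1" if "i < length fs"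
    unfolding eq by (rule c.mpoly_eval_var[OF s that])
qed

lemma rees_map_linear_form:
  assumes a: "a \<in> {..<length fs} \<rightarrow> carrier R"
  shows "rees_map R fs (linear_form (length fs) a) = up_ring.monom (UP R) (\<Oplus>i\<in>{..<length fs}. a i \<otimes> fs ! i) 1"
proof -
  interpret U: UP_cring R "UP R" by unfold_locales
  interpret r: ring_hom_cring "mpoly_ring R (length fs)" "UP R" "rees_map R fs"
    by (rule rees_map_hom)
  have m: "up_ring.monom (UP R) (\<Oplus>i\<in>A. f i) 1 = (\<Oplus>\<^bsub>UP R\<^esub>i\<in>A. up_ring.monom (UP R) (f i) 1)"
    if "finite A" "f \<in> A \<rightarrow> carrier R" for f and A :: "nat set"
    using that by (induction rule: finite_induct) (auto simp: Pi_def)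
  have "rees_map R fs (linear_form (length fs) a) = (\<Oplus>\<^bsub>UP R\<^esub>i\<in>{..<length fs}.
      rees_map R fs (indexed_const (a i) \<otimes>\<^bsub>mpoly_ring R (length fs)\<^esub> indexed_var i))"
    unfolding linear_form_def using r.hom_finsum[OF linear_term_closed[OF a]] by (simp add: comp_def)
  also have "\<dots> = (\<Oplus>\<^bsub>UP R\<^esub>i\<in>{..<length fs}. up_ring.monom (UP R) (a i \<otimes> fs ! i) 1)"
    using a fs_nth_closed
    by (intro U.P.finsum_cong')
      (auto simp: Pi_def mpoly_const_closed mpoly_var_closed rees_map_const rees_map_var
        simp flip: U.monom_mult)
  also have "\<dots> = up_ring.monom (UP R) (\<Oplus>i\<in>{..<length fs}. a i \<otimes> fs ! i) 1"
    using a fs_nth_closed by (intro m[symmetric]) auto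
  finally show ?thesis .
qed

text \<open>A kernel depends on the codomain only through its zero, which
  \<open>rees_algebra\<close> shares with \<open>UP R\<close>.\<close>

lemma mem_rees_ideal_iff:
  "F \<in> rees_ideal R fs \<longleftrightarrow> F \<in> carrier (mpoly_ring R (length fs)) \<and> rees_map R fs F = \<zero>\<^bsub>UP R\<^esub>"
  by (simp add: rees_ideal_def a_kernel_def' rees_algebra_def)

lemma rees_ideal_ideal: "ideal (rees_ideal R fs) (mpoly_ring R (length fs))"
proof -
  interpret r: ring_hom_cring "mpoly_ring R (length fs)" "UP R" "rees_map R fs"
    by (rule rees_map_hom)
  show ?thesis
    by (rule r.R.ideal_memI) (auto simp: mem_rees_ideal_iff)
qed

text \<open>The Rees map sends a linear form to a monomial of degree one, and such a monomial
  vanishes only if its coefficient does.\<close>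

lemma linear_form_in_rees_ideal_iff:
  assumes a: "a \<in> {..<length fs} \<rightarrow> carrier R"
  shows "linear_form (length fs) a \<in> rees_ideal R fs \<longleftrightarrow> (\<Oplus>i\<in>{..<length fs}. a i \<otimes> fs ! i) = \<zero>"
proof -
  interpret U: UP_cring R "UP R" by unfold_locales
  have c: "(\<Oplus>i\<in>{..<length fs}. a i \<otimes> fs ! i) \<in> carrier R"
    using a fs_nth_closed by (intro finsum_closed) auto
  show ?thesis
    using inj_on_eq_iff[OF U.monom_inj c zero_closed, of 1] linear_form_closed[OF a]
    by (simp add: mem_rees_ideal_iff rees_map_linear_form[OF a])
qed

text \<open>In this form relations can be transported by any map that preserves linear forms and is
  compatible with the Rees maps, with no reference to coefficients.\<close>

lemma linear_relations_eq: "linear_relations R fs = linear_forms (length fs) \<inter> rees_ideal R fs"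
  using linear_form_in_rees_ideal_iff
  by (auto simp: linear_relations_def linear_forms_def simp flip: linear_form_def)

lemma linear_relations_closed: "linear_relations R fs \<subseteq> carrier (mpoly_ring R (length fs))"
  using linear_forms_closed linear_relations_eq by auto

lemma linear_ideal_ideal: "ideal (linear_ideal R fs) (mpoly_ring R (length fs))"
proof -
  interpret T: cring "mpoly_ring R (length fs)" by (rule mpoly_cring)
  show ?thesis
    unfolding linear_ideal_def by (rule T.genideal_ideal[OF linear_relations_closed])
qed

lemma linear_relations_subset: "linear_relations R fs \<subseteq> linear_ideal R fs"
proof -
  interpret T: cring "mpoly_ring R (length fs)" by (rule mpoly_cring)
  show ?thesis
    unfolding linear_ideal_def by (rule T.genideal_self[OF linear_relations_closed])
qed

lemma linear_ideal_minimal: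
  assumes "ideal K (mpoly_ring R (length fs))" "linear_relations R fs \<subseteq> K"
  shows "linear_ideal R fs \<subseteq> K"
proof -
  interpret T: cring "mpoly_ring R (length fs)" by (rule mpoly_cring)
  show ?thesis
    unfolding linear_ideal_def by (rule T.genideal_minimal[OF assms])
qed

lemma linear_ideal_subset: "linear_ideal R fs \<subseteq> rees_ideal R fs"
  using linear_relations_eq by (intro linear_ideal_minimal rees_ideal_ideal) simp

end

section \<open>Change of generators\<close>

text \<open>If the j-th entry of \<open>gs\<close> is a combination of \<open>fs\<close> with
  coefficients \<open>c j\<close>, then \<open>\<psi>\<close> substitutes the linear form with these
  coefficients for the j-th variable. Both Rees maps then send that variable to
  \<open>gs ! j\<close> times t, so they are compatible.\<close>

lemma change_of_generators:
  assumes fs: "set fs \<subseteq> carrier R" and gs: "set gs \<subseteq> carrier R"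
    and sub: "set gs \<subseteq> Idl (set fs)"
  obtains \<psi> where
    "ring_hom_cring (mpoly_ring R (length gs)) (mpoly_ring R (length fs)) \<psi>"
    "\<And>k. k \<in> carrier R \<Longrightarrow> \<psi> (indexed_const k) = indexed_const k"
    "\<And>j. j < length gs \<Longrightarrow> \<psi> (indexed_var j) \<in> linear_forms (length fs)"
    "\<And>F. F \<in> carrier (mpoly_ring R (length gs)) \<Longrightarrow> rees_map R fs (\<psi> F) = rees_map R gs F"
    "\<And>F. F \<in> linear_forms (length gs) \<Longrightarrow> \<psi> F \<in> linear_forms (length fs)"
    "\<And>F. F \<in> linear_ideal R gs \<Longrightarrow> \<psi> F \<in> linear_ideal R fs"
proof -
  let ?n = "length fs" and ?m = "length gs"
  have "\<forall>j\<in>{..<?m}. \<exists>c. c \<in> {..<?n} \<rightarrow> carrier R \<and> gs ! j = (\<Oplus>i\<in>{..<?n}. c i \<otimes> fs ! i)"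
    using Idl_list_combination[OF fs] sub by (auto simp: Bex_def subset_iff)
  then obtain c where c: "\<And>j. j < ?m \<Longrightarrow> c j \<in> {..<?n} \<rightarrow> carrier R"
    "\<And>j. j < ?m \<Longrightarrow> gs ! j = (\<Oplus>i\<in>{..<?n}. c j i \<otimes> fs ! i)"
    by (metis lessThan_iff)
  interpret i: ring_hom_cring R "mpoly_ring R ?n" indexed_const by (rule mpoly_const_hom)
  let ?s = "\<lambda>j. linear_form ?n (c j)"
  have s: "?s \<in> {..<?m} \<rightarrow> carrier (mpoly_ring R ?n)"
    using c(1) by (auto intro: linear_form_closed)
  have sl: "?s j \<in> linear_forms ?n" if "j < ?m" for j
    using c(1)[OF that] by (simp add: linear_forms_def)
  define \<psi> where "\<psi> = i.mpoly_eval ?s"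
  interpret p: ring_hom_cring "mpoly_ring R ?m" "mpoly_ring R ?n" \<psi>
    unfolding \<psi>_def by (rule i.mpoly_eval_hom[OF s])
  have const: "\<psi> (indexed_const k) = indexed_const k" if "k \<in> carrier R" for k
    unfolding \<psi>_def by (rule i.mpoly_eval_const[OF s that])
  have var: "\<psi> (indexed_var j) = ?s j" if "j < ?m" for j
    unfolding \<psi>_def by (rule i.mpoly_eval_var[OF s that])
  interpret rf: ring_hom_cring "mpoly_ring R ?n" "UP R" "rees_map R fs" by (rule rees_map_hom[OF fs])
  interpret rg: ring_hom_cring "mpoly_ring R ?m" "UP R" "rees_map R gs" by (rule rees_map_hom[OF gs])
  have rp: "ring_hom_cring (mpoly_ring R ?m) (UP R) (rees_map R fs \<circ> \<psi>)"
    by (rule ring_hom_cringI[OF p.R.is_cring rf.S.is_cring]) (rule ring_hom_trans[OF p.homh rf.homh])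
  have rees: "rees_map R fs (\<psi> F) = rees_map R gs F" if F: "F \<in> carrier (mpoly_ring R ?m)" for F
  proof -
    have "(rees_map R fs \<circ> \<psi>) F = rees_map R gs F"
      by (rule mpoly_homs_eq[OF rp rg.ring_hom_cring_axioms _ _ F])
        (simp_all add: const var rees_map_const fs gs rees_map_var rees_map_linear_form[OF fs c(1)] c(2))
    then show ?thesis by simp
  qed
  have lin: "\<psi> F \<in> linear_forms ?n" if F: "F \<in> linear_forms ?m" for F
  proof -
    obtain a where a: "a \<in> {..<?m} \<rightarrow> carrier R" "F = linear_form ?m a"
      using F by (auto simp: linear_forms_def)
    have "\<psi> F = (\<Oplus>\<^bsub>mpoly_ring R ?n\<^esub>j\<in>{..<?m}. \<psi> (indexed_const (a j) \<otimes>\<^bsub>mpoly_ring R ?m\<^esub> indexed_var j))"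
      unfolding a(2) linear_form_def using p.hom_finsum[OF linear_term_closed[OF a(1)]] by (simp add: comp_def)
    also have "\<dots> = (\<Oplus>\<^bsub>mpoly_ring R ?n\<^esub>j\<in>{..<?m}. indexed_const (a j) \<otimes>\<^bsub>mpoly_ring R ?n\<^esub> ?s j)"
      using a(1) s by (intro i.S.finsum_cong')
        (auto simp: Pi_def mpoly_const_closed mpoly_var_closed const var)
    also have "\<dots> \<in> linear_forms ?n"
      using a(1) sl by (intro linear_forms_finsum) (auto simp: Pi_def intro!: linear_forms_smult)
    finally show ?thesis .
  qed
  \<comment> \<open>The preimage of the linear ideal under \<open>\<psi>\<close> is an ideal. It
    contains the relations of \<open>gs\<close> because \<open>\<psi>\<close> preserves linear forms
    and Rees values.\<close>
  have "linear_ideal R gs \<subseteq> {F \<in> carrier (mpoly_ring R ?m). \<psi> F \<in> linear_ideal R fs}"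
  proof (rule linear_ideal_minimal[OF gs p.R.ideal_memI])
    show "linear_relations R gs \<subseteq> {F \<in> carrier (mpoly_ring R ?m). \<psi> F \<in> linear_ideal R fs}"
    proof
      fix F assume F: "F \<in> linear_relations R gs"
      then have "F \<in> carrier (mpoly_ring R ?m)"
        using linear_relations_closed[OF gs] by blast
      moreover from F have "\<psi> F \<in> linear_relations R fs"
        using lin rees p.hom_closed
        by (simp add: linear_relations_eq fs gs mem_rees_ideal_iff)
      ultimately show "F \<in> {F \<in> carrier (mpoly_ring R ?m). \<psi> F \<in> linear_ideal R fs}"
        using linear_relations_subset[OF fs] by blast
    qed
  qed (use i.S.idealD[OF linear_ideal_ideal[OF fs]] in auto)
  then have "\<psi> F \<in> linear_ideal R fs" if "F \<in> linear_ideal R gs" for F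
    using that by blast
  moreover have "\<psi> (indexed_var j) \<in> linear_forms ?n" if "j < ?m" for j
    using var[OF that] sl[OF that] by simp
  ultimately show ?thesis
    using that[OF p.ring_hom_cring_axioms const _ rees lin] by blast
qed

text \<open>An \<open>F\<close> in the Rees ideal of \<open>gs\<close> goes under
  \<open>\<psi>\<close> into that of \<open>fs\<close>, which is the linear ideal by assumption, and
  back under \<open>\<theta>\<close> into the linear ideal of \<open>gs\<close>. It remains to see
  that the round trip changes \<open>F\<close> only by an element of that ideal.\<close>

lemma linear_type_generators_independent:
  assumes fs: "set fs \<subseteq> carrier R" and gs: "set gs \<subseteq> carrier R"
    and eq: "Idl (set fs) = Idl (set gs)"
    and lt: "rees_ideal R fs = linear_ideal R fs"
  shows "rees_ideal R gs = linear_ideal R gs"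
proof
  show "linear_ideal R gs \<subseteq> rees_ideal R gs"
    by (rule linear_ideal_subset[OF gs])
  let ?n = "length fs" and ?m = "length gs"
  have sub: "set gs \<subseteq> Idl (set fs)" "set fs \<subseteq> Idl (set gs)"
    using genideal_self[OF fs] genideal_self[OF gs] eq by auto
  obtain \<psi> where p: "ring_hom_cring (mpoly_ring R ?m) (mpoly_ring R ?n) \<psi>"
      "\<And>k. k \<in> carrier R \<Longrightarrow> \<psi> (indexed_const k) = indexed_const k"
      "\<And>j. j < ?m \<Longrightarrow> \<psi> (indexed_var j) \<in> linear_forms ?n"
      "\<And>F. F \<in> carrier (mpoly_ring R ?m) \<Longrightarrow> rees_map R fs (\<psi> F) = rees_map R gs F"
    using change_of_generators[OF fs gs sub(1)] by metis
  obtain \<theta> where q: "ring_hom_cring (mpoly_ring R ?n) (mpoly_ring R ?m) \<theta>"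
      "\<And>k. k \<in> carrier R \<Longrightarrow> \<theta> (indexed_const k) = indexed_const k"
      "\<And>F. F \<in> carrier (mpoly_ring R ?n) \<Longrightarrow> rees_map R gs (\<theta> F) = rees_map R fs F"
      "\<And>F. F \<in> linear_forms ?n \<Longrightarrow> \<theta> F \<in> linear_forms ?m"
      "\<And>F. F \<in> linear_ideal R fs \<Longrightarrow> \<theta> F \<in> linear_ideal R gs"
    using change_of_generators[OF gs fs sub(2)] by metis
  interpret p: ring_hom_cring "mpoly_ring R ?m" "mpoly_ring R ?n" \<psi> by (rule p(1))
  interpret q: ring_hom_cring "mpoly_ring R ?n" "mpoly_ring R ?m" \<theta> by (rule q(1))
  interpret rg: ring_hom_cring "mpoly_ring R ?m" "UP R" "rees_map R gs" by (rule rees_map_hom[OF gs])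
  note L = p.R.idealD[OF linear_ideal_ideal[OF gs]]
  have qp: "ring_hom_cring (mpoly_ring R ?m) (mpoly_ring R ?m) (\<theta> \<circ> \<psi>)"
    by (rule ring_hom_cringI[OF p.R.is_cring p.R.is_cring]) (rule ring_hom_trans[OF p.homh q.homh])
  have id: "ring_hom_cring (mpoly_ring R ?m) (mpoly_ring R ?m) id"
    by (rule ring_hom_cringI[OF p.R.is_cring p.R.is_cring]) simp
  \<comment> \<open>The difference is a linear form since both substitutions preserve linear forms,
    and it has Rees value zero since both preserve Rees values; hence it is a linear
    relation.\<close>
  have var: "\<theta> (\<psi> (indexed_var j)) \<ominus>\<^bsub>mpoly_ring R ?m\<^esub> indexed_var j \<in> linear_ideal R gs"
    if j: "j < ?m" for j
  proof -
    let ?X = "indexed_var j :: nat multiset \<Rightarrow> 'a"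
    note X = mpoly_var_closed[OF j]
    have c: "\<psi> ?X \<in> carrier (mpoly_ring R ?n)" "\<theta> (\<psi> ?X) \<in> carrier (mpoly_ring R ?m)"
      using X by auto
    have "\<theta> (\<psi> ?X) \<ominus>\<^bsub>mpoly_ring R ?m\<^esub> ?X \<in> linear_forms ?m"
      by (intro linear_forms_diff q(4) p(3) j indexed_var_in_linear_forms)
    moreover have "rees_map R gs (\<theta> (\<psi> ?X) \<ominus>\<^bsub>mpoly_ring R ?m\<^esub> ?X) = \<zero>\<^bsub>UP R\<^esub>"
      using c X by (simp add: a_minus_def q(3) p(4) rg.S.r_neg)
    ultimately have "\<theta> (\<psi> ?X) \<ominus>\<^bsub>mpoly_ring R ?m\<^esub> ?X \<in> linear_relations R gs"
      using c X by (simp add: linear_relations_eq[OF gs] mem_rees_ideal_iff[OF gs])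
    then show ?thesis
      using linear_relations_subset[OF gs] by blast
  qed
  show "rees_ideal R gs \<subseteq> linear_ideal R gs"
  proof
    fix F assume F: "F \<in> rees_ideal R gs"
    then have Fc: "F \<in> carrier (mpoly_ring R ?m)"
      by (simp add: mem_rees_ideal_iff[OF gs])
    have "\<psi> F \<in> rees_ideal R fs"
      using F by (simp add: mem_rees_ideal_iff fs gs p(4))
    then have 1: "\<theta> (\<psi> F) \<in> linear_ideal R gs"
      using lt q(5) by simp
    have "(\<theta> \<circ> \<psi>) F \<ominus>\<^bsub>mpoly_ring R ?m\<^esub> id F \<in> linear_ideal R gs"
      by (rule mpoly_homs_cong[OF qp id linear_ideal_ideal[OF gs] _ _ Fc])
        (simp_all add: p(2) q(2) var)
    then have 2: "\<theta> (\<psi> F) \<ominus>\<^bsub>mpoly_ring R ?m\<^esub> F \<in> linear_ideal R gs"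
      by simp
    have "F = \<theta> (\<psi> F) \<ominus>\<^bsub>mpoly_ring R ?m\<^esub> (\<theta> (\<psi> F) \<ominus>\<^bsub>mpoly_ring R ?m\<^esub> F)"
      using Fc q.hom_closed[OF p.hom_closed[OF Fc]] by algebra
    then show "F \<in> linear_ideal R gs"
      using L(4)[OF 1 2] by simp
  qed
qed

end

section \<open>Base change\<close>

text \<open>The operations of \<open>UP R\<close> are functions restricted to \<open>up R\<close>
  and \<open>carrier R\<close>; hence the membership assumptions in these unfoldings.\<close>

lemma
  fixes R (structure)
  shows carrier_UP: "carrier (UP R) = up R"
    and add_UP: "p \<in> up R \<Longrightarrow> q \<in> up R \<Longrightarrow> p \<oplus>\<^bsub>UP R\<^esub> q = (\<lambda>i. p i \<oplus> q i)"
    and mult_UP: "p \<in> up R \<Longrightarrow> q \<in> up R \<Longrightarrow> p \<otimes>\<^bsub>UP R\<^esub> q = (\<lambda>n. \<Oplus>i\<in>{..n}. p i \<otimes> q (n - i))"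
    and one_UP: "\<one>\<^bsub>UP R\<^esub> = (\<lambda>i. if i = 0 then \<one> else \<zero>)"
    and smult_UP: "a \<in> carrier R \<Longrightarrow> p \<in> up R \<Longrightarrow> a \<odot>\<^bsub>UP R\<^esub> p = (\<lambda>i. a \<otimes> p i)"
    and zero_UP: "\<zero>\<^bsub>UP R\<^esub> = (\<lambda>i. \<zero>)"
    and monom_UP: "a \<in> carrier R \<Longrightarrow> up_ring.monom (UP R) a n = (\<lambda>i. if i = n then a else \<zero>)"
  by (simp_all add: UP_def)

context ring_hom_cring
begin

lemma mpoly_map_const: "(\<lambda>\<mu>. h (R.indexed_const k \<mu>)) = S.indexed_const (h k)"
  by (auto simp: R.indexed_const_def S.indexed_const_def)

lemma mpoly_map_var: "(\<lambda>\<mu>. h (R.indexed_var i \<mu>)) = S.indexed_var i"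
  by (auto simp: R.indexed_var_def S.indexed_var_def R.indexed_pmult_def S.indexed_pmult_def
      R.indexed_const_def S.indexed_const_def)

text \<open>Only closure needs induction over the carrier; compatibility with sum and product is
  read off the coefficient formulas.\<close>

lemma mpoly_map_hom:
  "ring_hom_cring (mpoly_ring R n) (mpoly_ring S n) (\<lambda>F \<mu>. h (F \<mu>))"
proof (rule ring_hom_cringI[OF R.mpoly_cring S.mpoly_cring ring_hom_memI])
  fix F assume F: "F \<in> carrier (mpoly_ring R n)"
  then show "(\<lambda>\<mu>. h (F \<mu>)) \<in> carrier (mpoly_ring S n)"
  proof (induction rule: R.mpoly_shift_induct)
    case (const k)
    then show ?case by (simp add: mpoly_map_const S.mpoly_const_closed)
  next
    case (add F G)
    have "(\<lambda>\<mu>. h ((F \<oplus>\<^bsub>mpoly_ring R n\<^esub> G) \<mu>)) = (\<lambda>\<mu>. h (F \<mu>)) \<oplus>\<^bsub>mpoly_ring S n\<^esub> (\<lambda>\<mu>. h (G \<mu>))"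
      using R.mpoly_coeff[OF add(1)] R.mpoly_coeff[OF add(2)] by (simp add: R.mpoly_add S.mpoly_add)
    then show ?case using S.mpoly_a_closed[OF add(3,4)] by simp
  next
    case (shift F i)
    have "(\<lambda>\<mu>. h (R.indexed_pmult F i \<mu>)) = S.indexed_pmult (\<lambda>\<mu>. h (F \<mu>)) i"
      by (auto simp: R.indexed_pmult_def S.indexed_pmult_def)
    then show ?case using S.mpoly_shift_closed[OF shift(3,2)] by simp
  qed
  fix G assume G: "G \<in> carrier (mpoly_ring R n)"
  note c = R.mpoly_coeff[OF F] R.mpoly_coeff[OF G]
  show "(\<lambda>\<mu>. h ((F \<oplus>\<^bsub>mpoly_ring R n\<^esub> G) \<mu>)) = (\<lambda>\<mu>. h (F \<mu>)) \<oplus>\<^bsub>mpoly_ring S n\<^esub> (\<lambda>\<mu>. h (G \<mu>))"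
    using c by (simp add: R.mpoly_add S.mpoly_add)
  show "(\<lambda>\<mu>. h ((F \<otimes>\<^bsub>mpoly_ring R n\<^esub> G) \<mu>)) = (\<lambda>\<mu>. h (F \<mu>)) \<otimes>\<^bsub>mpoly_ring S n\<^esub> (\<lambda>\<mu>. h (G \<mu>))"
  proof
    fix \<mu>
    have "h ((F \<otimes>\<^bsub>mpoly_ring R n\<^esub> G) \<mu>) = (\<Oplus>\<^bsub>S\<^esub>\<nu>\<in>{\<nu>. \<nu> \<subseteq># \<mu>}. h (F \<nu> \<otimes> G (\<mu> - \<nu>)))"
      unfolding R.mpoly_mult using c by (subst hom_finsum) (auto simp: comp_def)
    also have "\<dots> = ((\<lambda>\<mu>. h (F \<mu>)) \<otimes>\<^bsub>mpoly_ring S n\<^esub> (\<lambda>\<mu>. h (G \<mu>))) \<mu>"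
      unfolding S.mpoly_mult using c by (intro S.finsum_cong') auto
    finally show "h ((F \<otimes>\<^bsub>mpoly_ring R n\<^esub> G) \<mu>) = ((\<lambda>\<mu>. h (F \<mu>)) \<otimes>\<^bsub>mpoly_ring S n\<^esub> (\<lambda>\<mu>. h (G \<mu>))) \<mu>" .
  qed
qed (simp add: R.mpoly_one S.mpoly_one mpoly_map_const)

lemma up_map_hom: "ring_hom_cring (UP R) (UP S) (\<lambda>p i. h (p i))"
proof -
  interpret UR: UP_cring R "UP R" by unfold_locales
  interpret US: UP_cring S "UP S" by unfold_locales
  have closed: "(\<lambda>i. h (p i)) \<in> up S" if p: "p \<in> up R" for p
  proof
    show "h (p i) \<in> carrier S" for i
      using mem_upD[OF p] by (rule hom_closed)
    obtain n where "bound \<zero> n p"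
      using R.bound_upD[OF p] by blast
    then have "bound \<zero>\<^bsub>S\<^esub> n (\<lambda>i. h (p i))"
      by (auto simp: bound_def)
    then show "\<exists>n. bound \<zero>\<^bsub>S\<^esub> n (\<lambda>i. h (p i))" ..
  qed
  have "(\<lambda>p i. h (p i)) \<in> ring_hom (UP R) (UP S)"
  proof (rule ring_hom_memI)
    fix p assume "p \<in> carrier (UP R)"
    then have p: "p \<in> up R"
      by (simp only: carrier_UP)
    show "(\<lambda>i. h (p i)) \<in> carrier (UP S)"
      unfolding carrier_UP by (rule closed[OF p])
    fix q assume "q \<in> carrier (UP R)"
    then have q: "q \<in> up R"
      by (simp only: carrier_UP)
    have pq: "p i \<in> carrier R" "q i \<in> carrier R" for i
      using mem_upD[OF p] mem_upD[OF q] .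
    show "(\<lambda>i. h ((p \<oplus>\<^bsub>UP R\<^esub> q) i)) = (\<lambda>i. h (p i)) \<oplus>\<^bsub>UP S\<^esub> (\<lambda>i. h (q i))"
      unfolding add_UP[OF p q] add_UP[OF closed[OF p] closed[OF q]] using pq by simp
    have "h (\<Oplus>i\<in>{..n}. p i \<otimes> q (n - i)) = (\<Oplus>\<^bsub>S\<^esub>i\<in>{..n}. h (p i) \<otimes>\<^bsub>S\<^esub> h (q (n - i)))" for n
    proof -
      have "h (\<Oplus>i\<in>{..n}. p i \<otimes> q (n - i)) = (\<Oplus>\<^bsub>S\<^esub>i\<in>{..n}. h (p i \<otimes> q (n - i)))"
        using pq by (subst hom_finsum) (auto simp: comp_def)
      also have "\<dots> = (\<Oplus>\<^bsub>S\<^esub>i\<in>{..n}. h (p i) \<otimes>\<^bsub>S\<^esub> h (q (n - i)))"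
        using pq by (intro S.finsum_cong') auto
      finally show ?thesis .
    qed
    then show "(\<lambda>i. h ((p \<otimes>\<^bsub>UP R\<^esub> q) i)) = (\<lambda>i. h (p i)) \<otimes>\<^bsub>UP S\<^esub> (\<lambda>i. h (q i))"
      unfolding mult_UP[OF p q] mult_UP[OF closed[OF p] closed[OF q]] by simp
  next
    show "(\<lambda>i. h (\<one>\<^bsub>UP R\<^esub> i)) = \<one>\<^bsub>UP S\<^esub>"
      by (simp add: one_UP fun_eq_iff)
  qed
  then show ?thesis
    by (rule ring_hom_cringI[OF UR.UP_cring US.UP_cring])
qed

lemma map_closed: "set fs \<subseteq> carrier R \<Longrightarrow> set (map h fs) \<subseteq> carrier S"
  by auto

text \<open>Naturality of the Rees map in the base ring: both composites are homomorphisms into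
  S[t], and they agree on constants and variables.\<close>

lemma rees_map_mpoly_map:
  assumes fs: "set fs \<subseteq> carrier R" and F: "F \<in> carrier (mpoly_ring R (length fs))"
  shows "rees_map S (map h fs) (\<lambda>\<mu>. h (F \<mu>)) = (\<lambda>i. h (rees_map R fs F i))"
proof -
  let ?n = "length fs"
  interpret m: ring_hom_cring "mpoly_ring R ?n" "mpoly_ring S ?n" "\<lambda>F \<mu>. h (F \<mu>)"
    by (rule mpoly_map_hom)
  interpret u: ring_hom_cring "UP R" "UP S" "\<lambda>p i. h (p i)"
    by (rule up_map_hom)
  interpret r: ring_hom_cring "mpoly_ring R ?n" "UP R" "rees_map R fs"
    by (rule R.rees_map_hom[OF fs])
  interpret s: ring_hom_cring "mpoly_ring S ?n" "UP S" "rees_map S (map h fs)"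
    using S.rees_map_hom[OF map_closed[OF fs]] by simp
  have hom: "ring_hom_cring (mpoly_ring R ?n) (UP S) (rees_map S (map h fs) \<circ> (\<lambda>F \<mu>. h (F \<mu>)))"
    "ring_hom_cring (mpoly_ring R ?n) (UP S) ((\<lambda>p i. h (p i)) \<circ> rees_map R fs)"
    by (rule ring_hom_cringI[OF m.R.is_cring u.S.is_cring ring_hom_trans];
        rule m.homh u.homh r.homh s.homh)+
  have monom: "(\<lambda>i. h (up_ring.monom (UP R) a n i)) = up_ring.monom (UP S) (h a) n" if "a \<in> carrier R" for a n
    using that by (simp add: monom_UP fun_eq_iff)
  have "(rees_map S (map h fs) \<circ> (\<lambda>F \<mu>. h (F \<mu>))) F = ((\<lambda>p i. h (p i)) \<circ> rees_map R fs) F"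
  proof (rule R.mpoly_homs_eq[OF hom _ _ F])
    fix k assume "k \<in> carrier R"
    then show "(rees_map S (map h fs) \<circ> (\<lambda>F \<mu>. h (F \<mu>))) (R.indexed_const k) =
        ((\<lambda>p i. h (p i)) \<circ> rees_map R fs) (R.indexed_const k)"
      using S.rees_map_const[OF map_closed[OF fs]] R.rees_map_const[OF fs]
      by (simp add: mpoly_map_const monom)
  next
    fix i assume i: "i < ?n"
    then have "fs ! i \<in> carrier R"
      using fs by (meson nth_mem subsetD)
    with i show "(rees_map S (map h fs) \<circ> (\<lambda>F \<mu>. h (F \<mu>))) (R.indexed_var i) =
        ((\<lambda>p i. h (p i)) \<circ> rees_map R fs) (R.indexed_var i)"
      using S.rees_map_var[OF map_closed[OF fs]] R.rees_map_var[OF fs]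
      by (simp add: mpoly_map_var monom)
  qed
  then show ?thesis by simp
qed

lemma mpoly_map_linear_form:
  assumes a: "a \<in> {..<n} \<rightarrow> carrier R"
  shows "(\<lambda>\<mu>. h (R.linear_form n a \<mu>)) = S.linear_form n (\<lambda>i. h (a i))"
proof -
  interpret m: ring_hom_cring "mpoly_ring R n" "mpoly_ring S n" "\<lambda>F \<mu>. h (F \<mu>)"
    by (rule mpoly_map_hom)
  have "(\<lambda>\<mu>. h (R.linear_form n a \<mu>)) = (\<Oplus>\<^bsub>mpoly_ring S n\<^esub>i\<in>{..<n}.
      (\<lambda>\<mu>. h ((R.indexed_const (a i) \<otimes>\<^bsub>mpoly_ring R n\<^esub> R.indexed_var i) \<mu>)))"
    unfolding R.linear_form_def using m.hom_finsum[OF R.linear_term_closed[OF a]]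
    by (simp add: comp_def)
  also have "\<dots> = S.linear_form n (\<lambda>i. h (a i))"
    unfolding S.linear_form_def using a
    by (intro m.S.finsum_cong')
      (auto simp: Pi_def R.mpoly_const_closed R.mpoly_var_closed S.mpoly_const_closed S.mpoly_var_closed
        mpoly_map_const mpoly_map_var)
  finally show ?thesis .
qed

text \<open>This holds for every ring homomorphism: linear forms map to linear forms and, by
  naturality, elements with Rees value zero to such elements. So relations map to relations, and the
  preimage of the linear ideal is an ideal. A converse needs localization.\<close>

lemma mpoly_map_linear_ideal:
  assumes fs: "set fs \<subseteq> carrier R" and F: "F \<in> linear_ideal R fs"
  shows "(\<lambda>\<mu>. h (F \<mu>)) \<in> linear_ideal S (map h fs)"
proof -
  let ?n = "length fs"
  interpret m: ring_hom_cring "mpoly_ring R ?n" "mpoly_ring S ?n" "\<lambda>F \<mu>. h (F \<mu>)"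
    by (rule mpoly_map_hom)
  interpret u: ring_hom_cring "UP R" "UP S" "\<lambda>p i. h (p i)"
    by (rule up_map_hom)
  note hfs = map_closed[OF fs]
  have L: "ideal (linear_ideal S (map h fs)) (mpoly_ring S ?n)"
    using S.linear_ideal_ideal[OF hfs] by simp
  have "linear_ideal R fs \<subseteq> {F \<in> carrier (mpoly_ring R ?n). (\<lambda>\<mu>. h (F \<mu>)) \<in> linear_ideal S (map h fs)}"
  proof (rule R.linear_ideal_minimal[OF fs m.R.ideal_memI])
    show "linear_relations R fs \<subseteq> {F \<in> carrier (mpoly_ring R ?n). (\<lambda>\<mu>. h (F \<mu>)) \<in> linear_ideal S (map h fs)}"
    proof
      fix F assume F: "F \<in> linear_relations R fs"
      then obtain a where a: "a \<in> {..<?n} \<rightarrow> carrier R" "F = R.linear_form ?n a"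
        by (auto simp: R.linear_relations_eq[OF fs] R.linear_forms_def)
      have Fc: "F \<in> carrier (mpoly_ring R ?n)" "rees_map R fs F = \<zero>\<^bsub>UP R\<^esub>"
        using F by (auto simp: R.linear_relations_eq[OF fs] R.mem_rees_ideal_iff[OF fs])
      have "(\<lambda>\<mu>. h (F \<mu>)) \<in> S.linear_forms ?n"
        unfolding a(2) mpoly_map_linear_form[OF a(1)] S.linear_forms_def
        using a(1) by (intro imageI) auto
      moreover have "rees_map S (map h fs) (\<lambda>\<mu>. h (F \<mu>)) = \<zero>\<^bsub>UP S\<^esub>"
        using u.hom_zero unfolding rees_map_mpoly_map[OF fs Fc(1)] Fc(2) .
      ultimately have "(\<lambda>\<mu>. h (F \<mu>)) \<in> linear_relations S (map h fs)"
        using m.hom_closed[OF Fc(1)]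
        by (simp add: S.linear_relations_eq[OF hfs] S.mem_rees_ideal_iff[OF hfs])
      then show "F \<in> {F \<in> carrier (mpoly_ring R ?n). (\<lambda>\<mu>. h (F \<mu>)) \<in> linear_ideal S (map h fs)}"
        using Fc(1) S.linear_relations_subset[OF hfs] by blast
    qed
    note L' = m.S.idealD[OF L]
    show "{F \<in> carrier (mpoly_ring R ?n). (\<lambda>\<mu>. h (F \<mu>)) \<in> linear_ideal S (map h fs)} \<subseteq> carrier (mpoly_ring R ?n)"
      by blast
    show "\<zero>\<^bsub>mpoly_ring R ?n\<^esub> \<in> {F \<in> carrier (mpoly_ring R ?n). (\<lambda>\<mu>. h (F \<mu>)) \<in> linear_ideal S (map h fs)}"
      using m.hom_zero L'(2) by simp
    fix F assume "F \<in> {F \<in> carrier (mpoly_ring R ?n). (\<lambda>\<mu>. h (F \<mu>)) \<in> linear_ideal S (map h fs)}"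
    then have F: "F \<in> carrier (mpoly_ring R ?n)" "(\<lambda>\<mu>. h (F \<mu>)) \<in> linear_ideal S (map h fs)"
      by auto
    fix G
    show "F \<oplus>\<^bsub>mpoly_ring R ?n\<^esub> G \<in> {F \<in> carrier (mpoly_ring R ?n). (\<lambda>\<mu>. h (F \<mu>)) \<in> linear_ideal S (map h fs)}"
      if "G \<in> {F \<in> carrier (mpoly_ring R ?n). (\<lambda>\<mu>. h (F \<mu>)) \<in> linear_ideal S (map h fs)}"
      using that F L'(3)[OF F(2), of "\<lambda>\<mu>. h (G \<mu>)"] m.hom_add[OF F(1), of G] by simp
    show "G \<otimes>\<^bsub>mpoly_ring R ?n\<^esub> F \<in> {F \<in> carrier (mpoly_ring R ?n). (\<lambda>\<mu>. h (F \<mu>)) \<in> linear_ideal S (map h fs)}"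
      if G: "G \<in> carrier (mpoly_ring R ?n)"
      using G F L'(5)[OF F(2) m.hom_closed[OF G]] m.hom_mult[OF G F(1)] by simp
  qed
  with F show ?thesis by blast
qed

end

section \<open>Linear type and abstract localizations\<close>

text \<open>The last three assumptions characterize the localization at \<open>M\<close> up to
  isomorphism: units, fractions, and a kernel consisting of \<open>M\<close>-torsion. Arguing from
  them keeps equivalence classes of fractions out of the comparison of ideals.\<close>

locale ring_localization = ring_hom_cring +
  fixes M
  assumes M_closed: "M \<subseteq> carrier R" and M_one: "\<one> \<in> M"
    and M_mult: "u \<in> M \<Longrightarrow> v \<in> M \<Longrightarrow> u \<otimes> v \<in> M"
    and M_unit: "u \<in> M \<Longrightarrow> \<exists>y\<in>carrier S. y \<otimes>\<^bsub>S\<^esub> h u = \<one>\<^bsub>S\<^esub>"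
    and fraction: "y \<in> carrier S \<Longrightarrow> \<exists>u\<in>M. \<exists>a\<in>carrier R. h u \<otimes>\<^bsub>S\<^esub> y = h a"
    and kernel: "a \<in> carrier R \<Longrightarrow> h a = \<zero>\<^bsub>S\<^esub> \<Longrightarrow> \<exists>u\<in>M. u \<otimes> a = \<zero>"
begin

lemma M_carrier: "u \<in> M \<Longrightarrow> u \<in> carrier R"
  using M_closed by blast

lemma common_denominator:
  assumes "finite A" "f \<in> A \<rightarrow> carrier S"
  shows "\<exists>u\<in>M. \<exists>g\<in>A \<rightarrow> carrier R. \<forall>x\<in>A. h u \<otimes>\<^bsub>S\<^esub> f x = h (g x)"
  using assms
proof (induction rule: finite_induct)
  case empty
  show ?case using M_one by auto
next
  case (insert y A)
  then obtain u g where u: "u \<in> M" "g \<in> A \<rightarrow> carrier R" "\<And>x. x \<in> A \<Longrightarrow> h u \<otimes>\<^bsub>S\<^esub> f x = h (g x)"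
    by auto
  have fc: "f y \<in> carrier S" "\<And>x. x \<in> A \<Longrightarrow> f x \<in> carrier S"
    using insert.prems by auto
  obtain v a where v: "v \<in> M" "a \<in> carrier R" "h v \<otimes>\<^bsub>S\<^esub> f y = h a"
    using fraction[OF fc(1)] by blast
  note c = M_carrier[OF u(1)] M_carrier[OF v(1)]
  \<comment> \<open>With the common denominator \<open>u \<otimes> v\<close> the old numerators
    acquire the factor \<open>v\<close> and the new one the factor \<open>u\<close>.\<close>
  let ?g = "\<lambda>x. if x = y then u \<otimes> a else v \<otimes> g x"
  have eq: "h (u \<otimes> v) \<otimes>\<^bsub>S\<^esub> f x = h (?g x)" if "x \<in> insert y A" for x
  proof (cases "x = y")
    case True
    then show ?thesis
      using c v fc by (simp add: S.m_assoc)
  next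
    case False
    then have x: "x \<in> A" using that by simp
    have "h (u \<otimes> v) \<otimes>\<^bsub>S\<^esub> f x = h v \<otimes>\<^bsub>S\<^esub> (h u \<otimes>\<^bsub>S\<^esub> f x)"
      using c fc(2)[OF x] by (simp add: S.m_ac)
    then show ?thesis
      using False c u(2,3) x by (auto simp: Pi_def)
  qed
  have "?g \<in> insert y A \<rightarrow> carrier R"
    using u(2) v(2) c by (simp add: Pi_def)
  with M_mult[OF u(1) v(1)] show ?case
    by (intro bexI[of _ "u \<otimes> v"] bexI[of _ ?g] ballI eq)
qed

text \<open>Each element of the kernel has its own annihilator in \<open>M\<close>; for finitely
  many elements the product works for all. Applied to coefficients, it annihilates a whole
  polynomial at once.\<close>

lemma common_annihilator:
  assumes "finite A" "f \<in> A \<rightarrow> carrier R" "\<And>x. x \<in> A \<Longrightarrow> h (f x) = \<zero>\<^bsub>S\<^esub>"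
  shows "\<exists>u\<in>M. \<forall>x\<in>A. u \<otimes> f x = \<zero>"
  using assms
proof (induction rule: finite_induct)
  case empty
  show ?case using M_one by auto
next
  case (insert y A)
  then obtain u where u: "u \<in> M" "\<And>x. x \<in> A \<Longrightarrow> u \<otimes> f x = \<zero>"
    by auto
  have fc: "f y \<in> carrier R" "\<And>x. x \<in> A \<Longrightarrow> f x \<in> carrier R"
    using insert.prems by auto
  obtain v where v: "v \<in> M" "v \<otimes> f y = \<zero>"
    using kernel[OF fc(1)] insert.prems(2) by blast
  note c = M_carrier[OF u(1)] M_carrier[OF v(1)]
  have "(u \<otimes> v) \<otimes> f x = \<zero>" if "x \<in> insert y A" for x
  proof (cases "x = y")
    case True
    then show ?thesis using c v(2) fc(1) by (simp add: R.m_assoc)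
  next
    case False
    then have x: "x \<in> A" using that by simp
    have "(u \<otimes> v) \<otimes> f x = v \<otimes> (u \<otimes> f x)"
      using c fc(2)[OF x] by (simp add: R.m_ac)
    then show ?thesis using u(2)[OF x] c by simp
  qed
  then show ?case
    using M_mult[OF u(1) v(1)] by blast
qed

text \<open>Clearing the denominators of all coefficients at once would leave open whether the
  numerators form an element of the inductively generated carrier; induction provides this.\<close>

lemma mpoly_denominator:
  assumes "F \<in> carrier (mpoly_ring S n)"
  shows "\<exists>u\<in>M. \<exists>G\<in>carrier (mpoly_ring R n).
    S.indexed_const (h u) \<otimes>\<^bsub>mpoly_ring S n\<^esub> F = (\<lambda>\<mu>. h (G \<mu>))"
proof -
  interpret m: ring_hom_cring "mpoly_ring R n" "mpoly_ring S n" "\<lambda>F \<mu>. h (F \<mu>)"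
    by (rule mpoly_map_hom)
  interpret c: ring_hom_cring R "mpoly_ring R n" R.indexed_const by (rule R.mpoly_const_hom)
  interpret d: ring_hom_cring S "mpoly_ring S n" S.indexed_const by (rule S.mpoly_const_hom)
  show ?thesis
    using assms
  proof (induction rule: S.mpoly_induct)
    case (const k)
    then obtain u a where u: "u \<in> M" "a \<in> carrier R" "h u \<otimes>\<^bsub>S\<^esub> k = h a"
      using fraction by blast
    have "S.indexed_const (h u) \<otimes>\<^bsub>mpoly_ring S n\<^esub> S.indexed_const k = (\<lambda>\<mu>. h (R.indexed_const a \<mu>))"
      unfolding mpoly_map_const u(3)[symmetric] using M_carrier[OF u(1)] const by simp
    then show ?case
      using u(1) R.mpoly_const_closed[OF u(2)] by blast
  next
    case (add F F')
    then obtain u G v G' where u: "u \<in> M" "G \<in> carrier (mpoly_ring R n)"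
        "S.indexed_const (h u) \<otimes>\<^bsub>mpoly_ring S n\<^esub> F = (\<lambda>\<mu>. h (G \<mu>))"
      and v: "v \<in> M" "G' \<in> carrier (mpoly_ring R n)"
        "S.indexed_const (h v) \<otimes>\<^bsub>mpoly_ring S n\<^esub> F' = (\<lambda>\<mu>. h (G' \<mu>))"
      by blast
    note cl = S.mpoly_const_closed[OF hom_closed[OF M_carrier[OF u(1)]]] S.mpoly_const_closed[OF hom_closed[OF M_carrier[OF v(1)]]]
    note cl' = R.mpoly_const_closed[OF M_carrier[OF u(1)]] R.mpoly_const_closed[OF M_carrier[OF v(1)]]
    let ?G = "R.indexed_const v \<otimes>\<^bsub>mpoly_ring R n\<^esub> G \<oplus>\<^bsub>mpoly_ring R n\<^esub> R.indexed_const u \<otimes>\<^bsub>mpoly_ring R n\<^esub> G'"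
    have "S.indexed_const (h (u \<otimes> v)) \<otimes>\<^bsub>mpoly_ring S n\<^esub> (F \<oplus>\<^bsub>mpoly_ring S n\<^esub> F') =
        (S.indexed_const (h u) \<otimes>\<^bsub>mpoly_ring S n\<^esub> S.indexed_const (h v)) \<otimes>\<^bsub>mpoly_ring S n\<^esub> (F \<oplus>\<^bsub>mpoly_ring S n\<^esub> F')"
      using M_carrier[OF u(1)] M_carrier[OF v(1)] by simp
    also have "\<dots> = S.indexed_const (h v) \<otimes>\<^bsub>mpoly_ring S n\<^esub> (S.indexed_const (h u) \<otimes>\<^bsub>mpoly_ring S n\<^esub> F)
        \<oplus>\<^bsub>mpoly_ring S n\<^esub> S.indexed_const (h u) \<otimes>\<^bsub>mpoly_ring S n\<^esub> (S.indexed_const (h v) \<otimes>\<^bsub>mpoly_ring S n\<^esub> F')"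
      using cl add(1,2) by algebra
    also have "\<dots> = (\<lambda>\<mu>. h (?G \<mu>))"
      unfolding u(3) v(3) using m.hom_add[OF m.R.m_closed[OF cl'(2) u(2)] m.R.m_closed[OF cl'(1) v(2)]]
      by (simp add: m.hom_mult[OF cl'(2) u(2)] m.hom_mult[OF cl'(1) v(2)] mpoly_map_const)
    finally show ?case
      using M_mult[OF u(1) v(1)] m.R.a_closed[OF m.R.m_closed[OF cl'(2) u(2)] m.R.m_closed[OF cl'(1) v(2)]]
      by blast
  next
    case (var F i)
    then obtain u G where u: "u \<in> M" "G \<in> carrier (mpoly_ring R n)"
        "S.indexed_const (h u) \<otimes>\<^bsub>mpoly_ring S n\<^esub> F = (\<lambda>\<mu>. h (G \<mu>))"
      by blast
    note X = R.mpoly_var_closed[OF var(2)]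
    have "S.indexed_const (h u) \<otimes>\<^bsub>mpoly_ring S n\<^esub> (S.indexed_var i \<otimes>\<^bsub>mpoly_ring S n\<^esub> F) =
        S.indexed_var i \<otimes>\<^bsub>mpoly_ring S n\<^esub> (S.indexed_const (h u) \<otimes>\<^bsub>mpoly_ring S n\<^esub> F)"
      using var(1) S.mpoly_var_closed[OF var(2)] S.mpoly_const_closed[OF hom_closed[OF M_carrier[OF u(1)]], of n]
      by (intro m.S.m_lcomm)
    also have "\<dots> = (\<lambda>\<mu>. h ((R.indexed_var i \<otimes>\<^bsub>mpoly_ring R n\<^esub> G) \<mu>))"
      unfolding u(3) m.hom_mult[OF X u(2)] by (simp add: mpoly_map_var)
    finally show ?case
      using u(1) m.R.m_closed[OF X u(2)] by blast
  qed
qed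

lemma mpoly_annihilator:
  assumes F: "F \<in> carrier (mpoly_ring R n)" "(\<lambda>\<mu>. h (F \<mu>)) = \<zero>\<^bsub>mpoly_ring S n\<^esub>"
  shows "\<exists>u\<in>M. R.indexed_const u \<otimes>\<^bsub>mpoly_ring R n\<^esub> F = \<zero>\<^bsub>mpoly_ring R n\<^esub>"
proof -
  have zero: "h (F \<mu>) = \<zero>\<^bsub>S\<^esub>" for \<mu>
    using F(2) by (simp add: S.mpoly_zero fun_eq_iff)
  obtain u where u: "u \<in> M" "\<And>\<mu>. F \<mu> \<noteq> \<zero> \<Longrightarrow> u \<otimes> F \<mu> = \<zero>"
    using common_annihilator[OF R.mpoly_finite_support[OF F(1)], of F] R.mpoly_coeff[OF F(1)] zero by auto
  have "u \<otimes> F \<mu> = \<zero>" for \<mu>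
    using u(2)[of \<mu>] M_carrier[OF u(1)] by (cases "F \<mu> = \<zero>") auto
  then have "R.indexed_const u \<otimes>\<^bsub>mpoly_ring R n\<^esub> F = \<zero>\<^bsub>mpoly_ring R n\<^esub>"
    unfolding R.mpoly_const_mult[OF M_carrier[OF u(1)] R.mpoly_coeffs[OF F(1)]] R.mpoly_zero by simp
  with u(1) show ?thesis by blast
qed

lemma up_annihilator:
  assumes p: "p \<in> carrier (UP R)" "(\<lambda>i. h (p i)) = \<zero>\<^bsub>UP S\<^esub>"
  shows "\<exists>u\<in>M. up_ring.monom (UP R) u 0 \<otimes>\<^bsub>UP R\<^esub> p = \<zero>\<^bsub>UP R\<^esub>"
proof -
  interpret U: UP_cring R "UP R" by unfold_locales
  have pu: "p \<in> up R"
    using p(1) by (simp only: carrier_UP)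
  note c = mem_upD[OF pu]
  have zero: "h (p i) = \<zero>\<^bsub>S\<^esub>" for i
    using p(2) by (simp add: zero_UP fun_eq_iff)
  obtain N where N: "bound \<zero> N p"
    using R.bound_upD[OF pu] by blast
  obtain u where u: "u \<in> M" "\<And>i. i \<le> N \<Longrightarrow> u \<otimes> p i = \<zero>"
    using common_annihilator[of "{..N}" p] c zero by auto
  have up: "u \<otimes> p i = \<zero>" for i
    using u(2)[of i] bound.bound[OF N, of i] M_carrier[OF u(1)] by (cases "i \<le> N") auto
  have "up_ring.monom (UP R) u 0 \<otimes>\<^bsub>UP R\<^esub> p = u \<odot>\<^bsub>UP R\<^esub> p"
    using U.monom_mult_is_smult[OF M_carrier[OF u(1)] p(1)] .
  also have "\<dots> = \<zero>\<^bsub>UP R\<^esub>"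
    unfolding zero_UP smult_UP[OF M_carrier[OF u(1)] pu] by (simp only: up)
  finally show ?thesis
    using u(1) by blast
qed

lemma unit_cancel_ideal:
  assumes L: "ideal L (mpoly_ring S n)" and u: "u \<in> M" and F: "F \<in> carrier (mpoly_ring S n)"
    and "S.indexed_const (h u) \<otimes>\<^bsub>mpoly_ring S n\<^esub> F \<in> L"
  shows "F \<in> L"
proof -
  interpret T: cring "mpoly_ring S n" by (rule S.mpoly_cring)
  interpret d: ring_hom_cring S "mpoly_ring S n" S.indexed_const by (rule S.mpoly_const_hom)
  obtain y where y: "y \<in> carrier S" "y \<otimes>\<^bsub>S\<^esub> h u = \<one>\<^bsub>S\<^esub>"
    using M_unit[OF u] by blast
  have hu: "h u \<in> carrier S"
    using M_carrier[OF u] by simp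
  have "S.indexed_const y \<otimes>\<^bsub>mpoly_ring S n\<^esub> (S.indexed_const (h u) \<otimes>\<^bsub>mpoly_ring S n\<^esub> F) =
      S.indexed_const (y \<otimes>\<^bsub>S\<^esub> h u) \<otimes>\<^bsub>mpoly_ring S n\<^esub> F"
    using y(1) hu F by (simp add: T.m_assoc)
  also have "\<dots> = F"
    using F unfolding y(2) by simp
  finally show ?thesis
    using T.idealD(5)[OF L assms(4) d.hom_closed[OF y(1)]] by simp
qed

context
  fixes fs
  assumes fs: "set fs \<subseteq> carrier R"
begin

text \<open>Let \<open>r\<close> in \<open>M\<close> lie in the conductor. Clearing denominators by
  \<open>u\<close> turns \<open>F\<close> into the image of some \<open>G\<close>, whose Rees value
  vanishes only over \<open>S\<close>; a further \<open>v\<close> makes it vanish over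
  \<open>R\<close>. Then \<open>r\<close> carries \<open>v\<close> times \<open>G\<close> into the
  linear ideal, and over \<open>S\<close> the units \<open>r\<close>, \<open>v\<close> and
  \<open>u\<close> can be cancelled.\<close>

lemma linear_type_if_conductor:
  assumes "M \<inter> conductor R fs \<noteq> {}"
  shows "rees_ideal S (map h fs) = linear_ideal S (map h fs)"
proof
  let ?n = "length fs"
  note hfs = map_closed[OF fs]
  show "linear_ideal S (map h fs) \<subseteq> rees_ideal S (map h fs)"
    by (rule S.linear_ideal_subset[OF hfs])
  obtain r where r: "r \<in> M" "\<And>F. F \<in> rees_ideal R fs \<Longrightarrow>
      R.indexed_const r \<otimes>\<^bsub>mpoly_ring R ?n\<^esub> F \<in> linear_ideal R fs"
    using assms by (auto simp: conductor_def)
  interpret m: ring_hom_cring "mpoly_ring R ?n" "mpoly_ring S ?n" "\<lambda>F \<mu>. h (F \<mu>)"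
    by (rule mpoly_map_hom)
  interpret c: ring_hom_cring R "mpoly_ring R ?n" R.indexed_const by (rule R.mpoly_const_hom)
  interpret d: ring_hom_cring S "mpoly_ring S ?n" S.indexed_const by (rule S.mpoly_const_hom)
  interpret rr: ring_hom_cring "mpoly_ring R ?n" "UP R" "rees_map R fs"
    by (rule R.rees_map_hom[OF fs])
  interpret rs: ring_hom_cring "mpoly_ring S ?n" "UP S" "rees_map S (map h fs)"
    using S.rees_map_hom[OF hfs] by simp
  have L: "ideal (linear_ideal S (map h fs)) (mpoly_ring S ?n)"
    using S.linear_ideal_ideal[OF hfs] by simp
  show "rees_ideal S (map h fs) \<subseteq> linear_ideal S (map h fs)"
  proof
    fix F assume F: "F \<in> rees_ideal S (map h fs)"
    then have Fc: "F \<in> carrier (mpoly_ring S ?n)" "rees_map S (map h fs) F = \<zero>\<^bsub>UP S\<^esub>"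
      using S.mem_rees_ideal_iff[OF hfs] by auto
    obtain u G where u: "u \<in> M" and G: "G \<in> carrier (mpoly_ring R ?n)"
        "S.indexed_const (h u) \<otimes>\<^bsub>mpoly_ring S ?n\<^esub> F = (\<lambda>\<mu>. h (G \<mu>))"
      using mpoly_denominator[OF Fc(1)] by blast
    have hu: "S.indexed_const (h u) \<in> carrier (mpoly_ring S ?n)"
      using M_carrier[OF u] by simp
    have "(\<lambda>i. h (rees_map R fs G i)) = rees_map S (map h fs) (S.indexed_const (h u) \<otimes>\<^bsub>mpoly_ring S ?n\<^esub> F)"
      unfolding G(2) rees_map_mpoly_map[OF fs G(1)] ..
    also have "\<dots> = \<zero>\<^bsub>UP S\<^esub>"
      unfolding rs.hom_mult[OF hu Fc(1)] Fc(2) using rs.hom_closed[OF hu] by (rule rs.S.r_null)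
    finally obtain v where v: "v \<in> M" "up_ring.monom (UP R) v 0 \<otimes>\<^bsub>UP R\<^esub> rees_map R fs G = \<zero>\<^bsub>UP R\<^esub>"
      using up_annihilator[OF rr.hom_closed[OF G(1)]] by blast
    let ?G = "R.indexed_const v \<otimes>\<^bsub>mpoly_ring R ?n\<^esub> G"
    note vc = c.hom_closed[OF M_carrier[OF v(1)]] and rc = c.hom_closed[OF M_carrier[OF r(1)]]
    have Gc: "?G \<in> carrier (mpoly_ring R ?n)"
      using vc G(1) by simp
    have "?G \<in> rees_ideal R fs"
      unfolding R.mem_rees_ideal_iff[OF fs] rr.hom_mult[OF vc G(1)] R.rees_map_const[OF fs M_carrier[OF v(1)]]
      using Gc v(2) by blast
    then have "(\<lambda>\<mu>. h ((R.indexed_const r \<otimes>\<^bsub>mpoly_ring R ?n\<^esub> ?G) \<mu>)) \<in> linear_ideal S (map h fs)"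
      by (intro mpoly_map_linear_ideal[OF fs] r(2))
    then have "S.indexed_const (h r) \<otimes>\<^bsub>mpoly_ring S ?n\<^esub> (S.indexed_const (h v) \<otimes>\<^bsub>mpoly_ring S ?n\<^esub>
        (S.indexed_const (h u) \<otimes>\<^bsub>mpoly_ring S ?n\<^esub> F)) \<in> linear_ideal S (map h fs)"
      unfolding m.hom_mult[OF rc Gc] m.hom_mult[OF vc G(1)] mpoly_map_const G(2) .
    then show "F \<in> linear_ideal S (map h fs)"
      using M_carrier r(1) v(1) u Fc(1) by (auto dest!: unit_cancel_ideal[OF L, rotated 2])
  qed
qed

text \<open>This is the nontrivial half of the compatibility of the linear ideal with localization:
  its generators over \<open>S\<close> are relations with coefficients in \<open>S\<close>, not just
  images of relations over \<open>R\<close>.\<close>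

lemma linear_ideal_denominator:
  assumes "F \<in> linear_ideal S (map h fs)"
  shows "\<exists>u\<in>M. \<exists>G\<in>linear_ideal R fs.
    S.indexed_const (h u) \<otimes>\<^bsub>mpoly_ring S (length fs)\<^esub> F = (\<lambda>\<mu>. h (G \<mu>))"
proof -
  let ?n = "length fs"
  note hfs = map_closed[OF fs]
  interpret m: ring_hom_cring "mpoly_ring R ?n" "mpoly_ring S ?n" "\<lambda>F \<mu>. h (F \<mu>)"
    by (rule mpoly_map_hom)
  interpret c: ring_hom_cring R "mpoly_ring R ?n" R.indexed_const by (rule R.mpoly_const_hom)
  interpret d: ring_hom_cring S "mpoly_ring S ?n" S.indexed_const by (rule S.mpoly_const_hom)
  interpret rr: ring_hom_cring "mpoly_ring R ?n" "UP R" "rees_map R fs"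
    by (rule R.rees_map_hom[OF fs])
  interpret rs: ring_hom_cring "mpoly_ring S ?n" "UP S" "rees_map S (map h fs)"
    using S.rees_map_hom[OF hfs] by simp
  note L = m.R.idealD[OF R.linear_ideal_ideal[OF fs]]
  \<comment> \<open>The elements with the required property form an ideal, so it suffices to find
    the relations over \<open>S\<close> among them.\<close>
  define K where "K = {F \<in> carrier (mpoly_ring S ?n). \<exists>u\<in>M. \<exists>G\<in>linear_ideal R fs.
    S.indexed_const (h u) \<otimes>\<^bsub>mpoly_ring S ?n\<^esub> F = (\<lambda>\<mu>. h (G \<mu>))}"
  have KI: "F \<in> K" if "F \<in> carrier (mpoly_ring S ?n)" "u \<in> M" "G \<in> linear_ideal R fs"
    "S.indexed_const (h u) \<otimes>\<^bsub>mpoly_ring S ?n\<^esub> F = (\<lambda>\<mu>. h (G \<mu>))" for F u G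
    using that unfolding K_def by blast
  have "ideal K (mpoly_ring S ?n)"
  proof (rule m.S.ideal_memI)
    show "K \<subseteq> carrier (mpoly_ring S ?n)"
      by (auto simp: K_def)
    have "S.indexed_const (h \<one>) \<otimes>\<^bsub>mpoly_ring S ?n\<^esub> \<zero>\<^bsub>mpoly_ring S ?n\<^esub> = (\<lambda>\<mu>. h (\<zero>\<^bsub>mpoly_ring R ?n\<^esub> \<mu>))"
      unfolding m.hom_zero by (rule m.S.r_null) simp
    then show "\<zero>\<^bsub>mpoly_ring S ?n\<^esub> \<in> K"
      using KI[OF m.S.zero_closed M_one L(2)] by simp
    fix F assume "F \<in> K"
    then obtain u G where F: "F \<in> carrier (mpoly_ring S ?n)" "u \<in> M" "G \<in> linear_ideal R fs"
      "S.indexed_const (h u) \<otimes>\<^bsub>mpoly_ring S ?n\<^esub> F = (\<lambda>\<mu>. h (G \<mu>))"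
      unfolding K_def by blast
    have Gc: "G \<in> carrier (mpoly_ring R ?n)"
      using F(3) L(1) by blast
    note uc = c.hom_closed[OF M_carrier[OF F(2)]] d.hom_closed[OF hom_closed[OF M_carrier[OF F(2)]]]
    show "F \<oplus>\<^bsub>mpoly_ring S ?n\<^esub> F' \<in> K" if "F' \<in> K" for F'
    proof -
      obtain v G' where F': "F' \<in> carrier (mpoly_ring S ?n)" "v \<in> M" "G' \<in> linear_ideal R fs"
        "S.indexed_const (h v) \<otimes>\<^bsub>mpoly_ring S ?n\<^esub> F' = (\<lambda>\<mu>. h (G' \<mu>))"
        using \<open>F' \<in> K\<close> unfolding K_def by blast
      have Gc': "G' \<in> carrier (mpoly_ring R ?n)"
        using F'(3) L(1) by blast
      note vc = c.hom_closed[OF M_carrier[OF F'(2)]] d.hom_closed[OF hom_closed[OF M_carrier[OF F'(2)]]]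
      let ?G = "R.indexed_const v \<otimes>\<^bsub>mpoly_ring R ?n\<^esub> G \<oplus>\<^bsub>mpoly_ring R ?n\<^esub> R.indexed_const u \<otimes>\<^bsub>mpoly_ring R ?n\<^esub> G'"
      have "S.indexed_const (h (u \<otimes> v)) \<otimes>\<^bsub>mpoly_ring S ?n\<^esub> (F \<oplus>\<^bsub>mpoly_ring S ?n\<^esub> F') =
          (S.indexed_const (h u) \<otimes>\<^bsub>mpoly_ring S ?n\<^esub> S.indexed_const (h v)) \<otimes>\<^bsub>mpoly_ring S ?n\<^esub> (F \<oplus>\<^bsub>mpoly_ring S ?n\<^esub> F')"
        using M_carrier[OF F(2)] M_carrier[OF F'(2)] by simp
      also have "\<dots> = S.indexed_const (h v) \<otimes>\<^bsub>mpoly_ring S ?n\<^esub> (S.indexed_const (h u) \<otimes>\<^bsub>mpoly_ring S ?n\<^esub> F)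
          \<oplus>\<^bsub>mpoly_ring S ?n\<^esub> S.indexed_const (h u) \<otimes>\<^bsub>mpoly_ring S ?n\<^esub> (S.indexed_const (h v) \<otimes>\<^bsub>mpoly_ring S ?n\<^esub> F')"
        using uc(2) vc(2) F(1) F'(1) by algebra
      also have "\<dots> = (\<lambda>\<mu>. h (?G \<mu>))"
        unfolding F(4) F'(4) using m.hom_add[OF m.R.m_closed[OF vc(1) Gc] m.R.m_closed[OF uc(1) Gc']]
        by (simp add: m.hom_mult[OF vc(1) Gc] m.hom_mult[OF uc(1) Gc'] mpoly_map_const)
      finally show ?thesis
        by (intro KI[OF _ M_mult[OF F(2) F'(2)] L(3)[OF L(5)[OF F(3) vc(1)] L(5)[OF F'(3) uc(1)]]]
            m.S.a_closed F(1) F'(1))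
    qed
    show "H \<otimes>\<^bsub>mpoly_ring S ?n\<^esub> F \<in> K" if H: "H \<in> carrier (mpoly_ring S ?n)" for H
    proof -
      \<comment> \<open>The multiplier \<open>H\<close> has coefficients in \<open>S\<close> as
        well, so its own denominator enters.\<close>
      obtain v H' where v: "v \<in> M" "H' \<in> carrier (mpoly_ring R ?n)"
        "S.indexed_const (h v) \<otimes>\<^bsub>mpoly_ring S ?n\<^esub> H = (\<lambda>\<mu>. h (H' \<mu>))"
        using mpoly_denominator[OF H] by blast
      note vc = d.hom_closed[OF hom_closed[OF M_carrier[OF v(1)]]]
      have "S.indexed_const (h (v \<otimes> u)) \<otimes>\<^bsub>mpoly_ring S ?n\<^esub> (H \<otimes>\<^bsub>mpoly_ring S ?n\<^esub> F) =
          (S.indexed_const (h v) \<otimes>\<^bsub>mpoly_ring S ?n\<^esub> S.indexed_const (h u)) \<otimes>\<^bsub>mpoly_ring S ?n\<^esub> (H \<otimes>\<^bsub>mpoly_ring S ?n\<^esub> F)"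
        using M_carrier[OF F(2)] M_carrier[OF v(1)] by simp
      also have "\<dots> = (S.indexed_const (h v) \<otimes>\<^bsub>mpoly_ring S ?n\<^esub> H) \<otimes>\<^bsub>mpoly_ring S ?n\<^esub> (S.indexed_const (h u) \<otimes>\<^bsub>mpoly_ring S ?n\<^esub> F)"
        using uc(2) vc F(1) H by algebra
      also have "\<dots> = (\<lambda>\<mu>. h ((H' \<otimes>\<^bsub>mpoly_ring R ?n\<^esub> G) \<mu>))"
        unfolding v(3) F(4) m.hom_mult[OF v(2) Gc] ..
      finally show ?thesis
        by (intro KI[OF _ M_mult[OF v(1) F(2)] L(5)[OF F(3) v(2)]] m.S.m_closed H F(1))
    qed
  qed
  moreover have "linear_relations S (map h fs) \<subseteq> K"
  proof
    fix F assume F: "F \<in> linear_relations S (map h fs)"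
    then obtain b where b: "b \<in> {..<?n} \<rightarrow> carrier S" "F = S.linear_form ?n b"
      by (auto simp: S.linear_relations_eq[OF hfs] S.linear_forms_def)
    have Fc: "F \<in> carrier (mpoly_ring S ?n)" "rees_map S (map h fs) F = \<zero>\<^bsub>UP S\<^esub>"
      using F S.mem_rees_ideal_iff[OF hfs] by (auto simp: S.linear_relations_eq[OF hfs])
    obtain u a where u: "u \<in> M" "a \<in> {..<?n} \<rightarrow> carrier R"
      "\<And>i. i < ?n \<Longrightarrow> h u \<otimes>\<^bsub>S\<^esub> b i = h (a i)"
      using common_denominator[OF finite_lessThan b(1)] by auto
    note uc = d.hom_closed[OF hom_closed[OF M_carrier[OF u(1)]]]
    let ?G = "R.linear_form ?n a"
    have Gc: "?G \<in> carrier (mpoly_ring R ?n)" "?G \<in> R.linear_forms ?n"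
      using R.linear_form_closed[OF u(2)] u(2) by (auto simp: R.linear_forms_def)
    have "S.indexed_const (h u) \<otimes>\<^bsub>mpoly_ring S ?n\<^esub> F = S.linear_form ?n (\<lambda>i. h u \<otimes>\<^bsub>S\<^esub> b i)"
      unfolding b(2) by (rule S.linear_form_smult[OF hom_closed[OF M_carrier[OF u(1)]] b(1)])
    also have "\<dots> = S.linear_form ?n (\<lambda>i. h (a i))"
      unfolding S.linear_form_def using u(2,3) S.linear_term_closed[of "\<lambda>i. h (a i)" ?n]
      by (intro m.S.finsum_cong') auto
    also have "\<dots> = (\<lambda>\<mu>. h (?G \<mu>))"
      by (rule mpoly_map_linear_form[OF u(2), symmetric])
    finally have G: "S.indexed_const (h u) \<otimes>\<^bsub>mpoly_ring S ?n\<^esub> F = (\<lambda>\<mu>. h (?G \<mu>))" .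
    have "(\<lambda>i. h (rees_map R fs ?G i)) = rees_map S (map h fs) (S.indexed_const (h u) \<otimes>\<^bsub>mpoly_ring S ?n\<^esub> F)"
      unfolding G rees_map_mpoly_map[OF fs Gc(1)] ..
    also have "\<dots> = \<zero>\<^bsub>UP S\<^esub>"
      unfolding rs.hom_mult[OF uc Fc(1)] Fc(2) using rs.hom_closed[OF uc] by (rule rs.S.r_null)
    \<comment> \<open>The numerators \<open>a\<close> satisfy the relation only after applying
      \<open>h\<close>; multiplication by \<open>v\<close> makes it hold in
      \<open>R\<close>.\<close>
    finally obtain v where v: "v \<in> M" "up_ring.monom (UP R) v 0 \<otimes>\<^bsub>UP R\<^esub> rees_map R fs ?G = \<zero>\<^bsub>UP R\<^esub>"
      using up_annihilator[OF rr.hom_closed[OF Gc(1)]] by blast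
    note vc = c.hom_closed[OF M_carrier[OF v(1)]] d.hom_closed[OF hom_closed[OF M_carrier[OF v(1)]]]
    let ?H = "R.indexed_const v \<otimes>\<^bsub>mpoly_ring R ?n\<^esub> ?G"
    have "?H \<in> rees_ideal R fs"
      unfolding R.mem_rees_ideal_iff[OF fs] rr.hom_mult[OF vc(1) Gc(1)] R.rees_map_const[OF fs M_carrier[OF v(1)]]
      using m.R.m_closed[OF vc(1) Gc(1)] v(2) by blast
    then have H: "?H \<in> linear_ideal R fs"
      using R.linear_relations_subset[OF fs] R.linear_forms_smult[OF M_carrier[OF v(1)] Gc(2)]
      unfolding R.linear_relations_eq[OF fs] by blast
    have "S.indexed_const (h (v \<otimes> u)) \<otimes>\<^bsub>mpoly_ring S ?n\<^esub> F =
        S.indexed_const (h v) \<otimes>\<^bsub>mpoly_ring S ?n\<^esub> (S.indexed_const (h u) \<otimes>\<^bsub>mpoly_ring S ?n\<^esub> F)"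
      using M_carrier[OF u(1)] M_carrier[OF v(1)] Fc(1) by (simp add: m.S.m_assoc)
    also have "\<dots> = (\<lambda>\<mu>. h (?H \<mu>))"
      unfolding G m.hom_mult[OF vc(1) Gc(1)] mpoly_map_const ..
    finally show "F \<in> K"
      by (rule KI[OF Fc(1) M_mult[OF v(1) u(1)] H])
  qed
  ultimately have "linear_ideal S (map h fs) \<subseteq> K"
    using S.linear_ideal_minimal[OF hfs] by simp
  with assms show ?thesis
    unfolding K_def by blast
qed

text \<open>First each element of the Rees ideal gets its own multiplier in \<open>M\<close>. Finite
  generation, the only use of the Noetherian hypothesis here, then yields a uniform one.\<close>

lemma conductor_if_linear_type:
  assumes noeth: "noetherian_ring R" and lt: "rees_ideal S (map h fs) = linear_ideal S (map h fs)"
  shows "M \<inter> conductor R fs \<noteq> {}"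
proof -
  let ?n = "length fs"
  note hfs = map_closed[OF fs]
  interpret m: ring_hom_cring "mpoly_ring R ?n" "mpoly_ring S ?n" "\<lambda>F \<mu>. h (F \<mu>)"
    by (rule mpoly_map_hom)
  interpret c: ring_hom_cring R "mpoly_ring R ?n" R.indexed_const by (rule R.mpoly_const_hom)
  interpret N: noetherian_ring "mpoly_ring R ?n" by (rule R.mpoly_noetherian[OF noeth])
  interpret u: ring_hom_cring "UP R" "UP S" "\<lambda>p i. h (p i)"
    by (rule up_map_hom)
  note L = m.R.idealD[OF R.linear_ideal_ideal[OF fs]]
  have single: "\<exists>u\<in>M. R.indexed_const u \<otimes>\<^bsub>mpoly_ring R ?n\<^esub> F \<in> linear_ideal R fs"
    if F: "F \<in> rees_ideal R fs" for F
  proof -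
    have Fc: "F \<in> carrier (mpoly_ring R ?n)" "rees_map R fs F = \<zero>\<^bsub>UP R\<^esub>"
      using F R.mem_rees_ideal_iff[OF fs] by auto
    have "rees_map S (map h fs) (\<lambda>\<mu>. h (F \<mu>)) = \<zero>\<^bsub>UP S\<^esub>"
      unfolding rees_map_mpoly_map[OF fs Fc(1)] Fc(2) by (rule u.hom_zero)
    then have "(\<lambda>\<mu>. h (F \<mu>)) \<in> linear_ideal S (map h fs)"
      unfolding lt[symmetric] S.mem_rees_ideal_iff[OF hfs] using m.hom_closed[OF Fc(1)] by simp
    then obtain v G where v: "v \<in> M" "G \<in> linear_ideal R fs"
      "S.indexed_const (h v) \<otimes>\<^bsub>mpoly_ring S ?n\<^esub> (\<lambda>\<mu>. h (F \<mu>)) = (\<lambda>\<mu>. h (G \<mu>))"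
      using linear_ideal_denominator by blast
    have Gc: "G \<in> carrier (mpoly_ring R ?n)"
      using v(2) L(1) by blast
    note vc = c.hom_closed[OF M_carrier[OF v(1)]]
    \<comment> \<open>Over \<open>S\<close> the two terms of \<open>?D\<close> agree, so some
      \<open>w\<close> in \<open>M\<close> kills \<open>?D\<close> over \<open>R\<close>, and
      \<open>w \<otimes> v\<close> carries \<open>F\<close> into the linear ideal.\<close>
    let ?D = "R.indexed_const v \<otimes>\<^bsub>mpoly_ring R ?n\<^esub> F \<ominus>\<^bsub>mpoly_ring R ?n\<^esub> G"
    note vF = m.R.m_closed[OF vc Fc(1)]
    have "(\<lambda>\<mu>. h (?D \<mu>)) = (\<lambda>\<mu>. h (G \<mu>)) \<ominus>\<^bsub>mpoly_ring S ?n\<^esub> (\<lambda>\<mu>. h (G \<mu>))"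
      unfolding a_minus_def m.hom_add[OF vF m.R.a_inv_closed[OF Gc]] m.hom_a_inv[OF Gc]
        m.hom_mult[OF vc Fc(1)] mpoly_map_const v(3) ..
    also have "\<dots> = \<zero>\<^bsub>mpoly_ring S ?n\<^esub>"
      using m.hom_closed[OF Gc] by (simp only: a_minus_def m.S.r_neg)
    finally obtain w where w: "w \<in> M" "R.indexed_const w \<otimes>\<^bsub>mpoly_ring R ?n\<^esub> ?D = \<zero>\<^bsub>mpoly_ring R ?n\<^esub>"
      using mpoly_annihilator[OF m.R.minus_closed[OF vF Gc]] by blast
    note wc = c.hom_closed[OF M_carrier[OF w(1)]]
    have "R.indexed_const (w \<otimes> v) \<otimes>\<^bsub>mpoly_ring R ?n\<^esub> F =
        (R.indexed_const w \<otimes>\<^bsub>mpoly_ring R ?n\<^esub> R.indexed_const v) \<otimes>\<^bsub>mpoly_ring R ?n\<^esub> F"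
      using M_carrier[OF w(1)] M_carrier[OF v(1)] by simp
    also have "\<dots> = R.indexed_const w \<otimes>\<^bsub>mpoly_ring R ?n\<^esub> ?D \<oplus>\<^bsub>mpoly_ring R ?n\<^esub> R.indexed_const w \<otimes>\<^bsub>mpoly_ring R ?n\<^esub> G"
      using wc vc Fc(1) Gc by algebra
    also have "\<dots> = R.indexed_const w \<otimes>\<^bsub>mpoly_ring R ?n\<^esub> G"
      unfolding w(2) using wc Gc by simp
    also have "\<dots> \<in> linear_ideal R fs"
      by (rule L(5)[OF v(2) wc])
    finally show ?thesis
      using M_mult[OF w(1) v(1)] by blast
  qed
  obtain B where B: "B \<subseteq> carrier (mpoly_ring R ?n)" "finite B" "rees_ideal R fs = Idl\<^bsub>mpoly_ring R ?n\<^esub> B"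
    using N.finetely_gen[OF R.rees_ideal_ideal[OF fs]] by blast
  have BJ: "B \<subseteq> rees_ideal R fs"
    unfolding B(3) by (rule m.R.genideal_self[OF B(1)])
  have "\<exists>u\<in>M. \<forall>F\<in>B. R.indexed_const u \<otimes>\<^bsub>mpoly_ring R ?n\<^esub> F \<in> linear_ideal R fs"
    using B(2) BJ
  proof (induction rule: finite_induct)
    case empty
    show ?case using M_one by auto
  next
    case (insert F B)
    then obtain u where u: "u \<in> M" "\<And>G. G \<in> B \<Longrightarrow> R.indexed_const u \<otimes>\<^bsub>mpoly_ring R ?n\<^esub> G \<in> linear_ideal R fs"
      by auto
    obtain v where v: "v \<in> M" "R.indexed_const v \<otimes>\<^bsub>mpoly_ring R ?n\<^esub> F \<in> linear_ideal R fs"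
      using single insert.prems by auto
    note uc = c.hom_closed[OF M_carrier[OF u(1)]] and vc = c.hom_closed[OF M_carrier[OF v(1)]]
    have "R.indexed_const (u \<otimes> v) \<otimes>\<^bsub>mpoly_ring R ?n\<^esub> G \<in> linear_ideal R fs" if G: "G \<in> insert F B" for G
    proof -
      have Gc: "G \<in> carrier (mpoly_ring R ?n)"
        using G insert.prems R.mem_rees_ideal_iff[OF fs] by auto
      have "R.indexed_const (u \<otimes> v) = R.indexed_const u \<otimes>\<^bsub>mpoly_ring R ?n\<^esub> R.indexed_const v"
        using M_carrier[OF u(1)] M_carrier[OF v(1)] by simp
      \<comment> \<open>The two orders of the factors serve the new and the old generators
        respectively: the inner factor reaches the linear ideal and the outer one stays in
        it.\<close>
      then have
        1: "R.indexed_const (u \<otimes> v) \<otimes>\<^bsub>mpoly_ring R ?n\<^esub> G =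
          R.indexed_const u \<otimes>\<^bsub>mpoly_ring R ?n\<^esub> (R.indexed_const v \<otimes>\<^bsub>mpoly_ring R ?n\<^esub> G)" and
        2: "R.indexed_const (u \<otimes> v) \<otimes>\<^bsub>mpoly_ring R ?n\<^esub> G =
          R.indexed_const v \<otimes>\<^bsub>mpoly_ring R ?n\<^esub> (R.indexed_const u \<otimes>\<^bsub>mpoly_ring R ?n\<^esub> G)"
        using uc vc Gc by (simp_all only: m.R.m_ac m.R.m_closed)
      show ?thesis
      proof (cases "G = F")
        case True
        then show ?thesis unfolding 1 using L(5)[OF v(2) uc] by simp
      next
        case False
        then show ?thesis unfolding 2 using G L(5)[OF u(2) vc] by simp
      qed
    qed
    then show ?case
      using M_mult[OF u(1) v(1)] by blast
  qed
  then obtain u where u: "u \<in> M" "\<And>F. F \<in> B \<Longrightarrow> R.indexed_const u \<otimes>\<^bsub>mpoly_ring R ?n\<^esub> F \<in> linear_ideal R fs"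
    by blast
  note uc = c.hom_closed[OF M_carrier[OF u(1)]]
  \<comment> \<open>Being multiplied into the linear ideal by \<open>u\<close> is a condition that
    defines an ideal, so it passes from \<open>B\<close> to all of
    \<open>rees_ideal R fs\<close>.\<close>
  let ?K = "{F \<in> carrier (mpoly_ring R ?n). R.indexed_const u \<otimes>\<^bsub>mpoly_ring R ?n\<^esub> F \<in> linear_ideal R fs}"
  have "ideal ?K (mpoly_ring R ?n)"
  proof (rule m.R.ideal_memI)
    show "\<zero>\<^bsub>mpoly_ring R ?n\<^esub> \<in> ?K"
      using uc L(2) by simp
    show "F \<oplus>\<^bsub>mpoly_ring R ?n\<^esub> G \<in> ?K" if "F \<in> ?K" "G \<in> ?K" for F G
      using that uc L(3) by (simp add: m.R.r_distr)
    show "G \<otimes>\<^bsub>mpoly_ring R ?n\<^esub> F \<in> ?K" if "F \<in> ?K" "G \<in> carrier (mpoly_ring R ?n)" for F G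
    proof -
      have "R.indexed_const u \<otimes>\<^bsub>mpoly_ring R ?n\<^esub> (G \<otimes>\<^bsub>mpoly_ring R ?n\<^esub> F) =
          G \<otimes>\<^bsub>mpoly_ring R ?n\<^esub> (R.indexed_const u \<otimes>\<^bsub>mpoly_ring R ?n\<^esub> F)"
        using that uc by (intro m.R.m_lcomm) auto
      then show ?thesis
        using that L(5) by simp
    qed
  qed blast
  moreover have "B \<subseteq> ?K"
    using u(2) B(1) by blast
  ultimately have "rees_ideal R fs \<subseteq> ?K"
    unfolding B(3) by (rule m.R.genideal_minimal)
  then have "u \<in> conductor R fs"
    using M_carrier[OF u(1)] unfolding conductor_def by blast
  with u(1) show ?thesis by blast
qed

text \<open>The generators witnessing linear type over \<open>S\<close> may be unrelated to
  \<open>fs\<close>; independence of the generators replaces them by \<open>map h fs\<close>, to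
  which the two preceding implications apply.\<close>

theorem linear_type_localization_iff:
  assumes "noetherian_ring R"
  shows "linear_type S (Idl\<^bsub>S\<^esub> (h ` set fs)) \<longleftrightarrow> M \<inter> conductor R fs \<noteq> {}"
proof
  note hfs = map_closed[OF fs]
  show "linear_type S (Idl\<^bsub>S\<^esub> (h ` set fs))" if "M \<inter> conductor R fs \<noteq> {}"
    using linear_type_if_conductor[OF that] hfs
    unfolding linear_type_def generators_def by (intro exI[of _ "map h fs"]) simp
  assume "linear_type S (Idl\<^bsub>S\<^esub> (h ` set fs))"
  then obtain gs where gs: "set gs \<subseteq> carrier S" "Idl\<^bsub>S\<^esub> (h ` set fs) = Idl\<^bsub>S\<^esub> (set gs)"
    "rees_ideal S gs = linear_ideal S gs"
    unfolding linear_type_def generators_def by blast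
  have "Idl\<^bsub>S\<^esub> (set gs) = Idl\<^bsub>S\<^esub> (set (map h fs))"
    using gs(2) by simp
  then show "M \<inter> conductor R fs \<noteq> {}"
    by (intro conductor_if_linear_type assms S.linear_type_generators_independent[OF gs(1) hfs _ gs(3)])
qed

end

end

section \<open>Localization at a prime\<close>

text \<open>Operations on fractions are unions over representatives. Once they are known to be
  independent of the representatives, the union collapses to one value, as the classes are
  nonempty.\<close>

lemma UN_pairs_constant:
  assumes "A \<noteq> {}" "\<And>a s. (a, s) \<in> A \<Longrightarrow> f a s = c"
  shows "(\<Union>(a, s)\<in>A. f a s) = c"
proof -
  have "(case x of (a, s) \<Rightarrow> f a s) = c" if "x \<in> A" for x
    using that assms(2) by (cases x) simp
  then show ?thesis
    using assms(1) by (simp cong: SUP_cong_simp)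
qed

lemma UN_pairs_constant2:
  assumes "A \<noteq> {}" "B \<noteq> {}" "\<And>a s b t. (a, s) \<in> A \<Longrightarrow> (b, t) \<in> B \<Longrightarrow> f a s b t = c"
  shows "(\<Union>(a, s)\<in>A. \<Union>(b, t)\<in>B. f a s b t) = c"
  by (intro UN_pairs_constant assms)

section \<open>The ring of fractions and extended ideals\<close>

locale multiplicative_subset = cring +
  fixes M
  assumes subset: "M \<subseteq> carrier R" and one_mem: "\<one> \<in> M"
    and mult_mem: "u \<in> M \<Longrightarrow> v \<in> M \<Longrightarrow> u \<otimes> v \<in> M"
begin

lemma mem_carrier: "u \<in> M \<Longrightarrow> u \<in> carrier R"
  using subset by blast

lemma frac_rel_iff:
  "((a, s), (b, t)) \<in> frac_rel R M \<longleftrightarrow>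
     a \<in> carrier R \<and> s \<in> M \<and> b \<in> carrier R \<and> t \<in> M \<and> (\<exists>u\<in>M. u \<otimes> (t \<otimes> a \<ominus> s \<otimes> b) = \<zero>)"
  by (simp add: frac_rel_def)

lemma frac_rel_equiv: "equiv (carrier R \<times> M) (frac_rel R M)"
proof (rule equivI)
  show "frac_rel R M \<subseteq> (carrier R \<times> M) \<times> (carrier R \<times> M)"
    by (auto simp: frac_rel_def)
  have "((a, s), (a, s)) \<in> frac_rel R M" if a: "a \<in> carrier R" "s \<in> M" for a s
    unfolding frac_rel_iff using a one_mem mem_carrier[OF a(2)]
    by (auto intro!: bexI[of _ \<one>] simp: a_minus_def r_neg)
  then show "refl_on (carrier R \<times> M) (frac_rel R M)"
    by (auto intro!: refl_onI)
  show "sym (frac_rel R M)"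
  proof (rule symI, clarify)
    fix a s b t assume "((a, s), (b, t)) \<in> frac_rel R M"
    then obtain u where u: "a \<in> carrier R" "s \<in> M" "b \<in> carrier R" "t \<in> M" "u \<in> M"
      "u \<otimes> (t \<otimes> a \<ominus> s \<otimes> b) = \<zero>"
      by (auto simp: frac_rel_iff)
    note c = u(1,3) mem_carrier[OF u(2)] mem_carrier[OF u(4)] mem_carrier[OF u(5)]
    have "u \<otimes> (s \<otimes> b \<ominus> t \<otimes> a) = \<ominus> (u \<otimes> (t \<otimes> a \<ominus> s \<otimes> b))"
      using c by algebra
    then show "((b, t), (a, s)) \<in> frac_rel R M"
      using u by (auto simp: frac_rel_iff)
  qed
  show "trans (frac_rel R M)"
  proof (rule transI, clarify)
    fix a s b t d w
    assume "((a, s), (b, t)) \<in> frac_rel R M" "((b, t), (d, w)) \<in> frac_rel R M"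
    then obtain u v where u: "a \<in> carrier R" "s \<in> M" "b \<in> carrier R" "t \<in> M" "u \<in> M"
        "u \<otimes> (t \<otimes> a \<ominus> s \<otimes> b) = \<zero>"
      and v: "d \<in> carrier R" "w \<in> M" "v \<in> M" "v \<otimes> (w \<otimes> b \<ominus> t \<otimes> d) = \<zero>"
      by (auto simp: frac_rel_iff)
    note c = u(1,3) mem_carrier[OF u(2)] mem_carrier[OF u(4)] mem_carrier[OF u(5)]
      v(1) mem_carrier[OF v(2)] mem_carrier[OF v(3)]
    \<comment> \<open>Eliminating \<open>b\<close> leaves the middle denominator \<open>t\<close> as
      a factor. As zero divisors are allowed, it cannot be cancelled and joins the witness
      instead.\<close>
    have "(u \<otimes> v \<otimes> t) \<otimes> (w \<otimes> a \<ominus> s \<otimes> d) =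
        v \<otimes> w \<otimes> (u \<otimes> (t \<otimes> a \<ominus> s \<otimes> b)) \<oplus> u \<otimes> s \<otimes> (v \<otimes> (w \<otimes> b \<ominus> t \<otimes> d))"
      using c by algebra
    also have "\<dots> = \<zero>"
      unfolding u(6) v(4) using c by simp
    finally show "((a, s), (d, w)) \<in> frac_rel R M"
      using u v mult_mem[OF mult_mem[OF u(5) v(3)] u(4)] by (auto simp: frac_rel_iff)
  qed
qed

lemma frac_eq_iff:
  assumes "a \<in> carrier R" "s \<in> M" "b \<in> carrier R" "t \<in> M"
  shows "frac R M a s = frac R M b t \<longleftrightarrow> (\<exists>u\<in>M. u \<otimes> (t \<otimes> a \<ominus> s \<otimes> b) = \<zero>)"
  unfolding frac_def using eq_equiv_class_iff[OF frac_rel_equiv, of "(a, s)" "(b, t)"] assms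
  by (simp add: frac_rel_iff)

lemma frac_eqI:
  assumes "a \<in> carrier R" "s \<in> M" "b \<in> carrier R" "t \<in> M" "t \<otimes> a = s \<otimes> b"
  shows "frac R M a s = frac R M b t"
  unfolding frac_eq_iff[OF assms(1-4)] using assms one_mem mem_carrier
  by (intro bexI[of _ \<one>]) (simp_all add: a_minus_def r_neg)

lemma frac_mem:
  assumes "a \<in> carrier R" "s \<in> M"
  shows "(a, s) \<in> frac R M a s"
  unfolding frac_def using equiv_class_self[OF frac_rel_equiv] assms by simp

lemma mem_fracD:
  assumes "(b, t) \<in> frac R M a s"
  shows "b \<in> carrier R" "t \<in> M" "\<exists>u\<in>M. u \<otimes> (t \<otimes> a \<ominus> s \<otimes> b) = \<zero>"
  using assms by (auto simp: frac_def frac_rel_iff)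

lemma localization_carrier:
  "carrier (localization R M) = {frac R M a s | a s. a \<in> carrier R \<and> s \<in> M}"
  by (auto simp: localization_def quotient_def frac_def)

lemma localization_mult:
  assumes "a \<in> carrier R" "s \<in> M" "b \<in> carrier R" "t \<in> M"
  shows "frac R M a s \<otimes>\<^bsub>localization R M\<^esub> frac R M b t = frac R M (a \<otimes> b) (s \<otimes> t)"
proof -
  have "frac R M (a' \<otimes> b') (s' \<otimes> t') = frac R M (a \<otimes> b) (s \<otimes> t)"
    if as: "(a', s') \<in> frac R M a s" and bt: "(b', t') \<in> frac R M b t" for a' s' b' t'
  proof -
    obtain u where u: "a' \<in> carrier R" "s' \<in> M" "u \<in> M" "u \<otimes> (s' \<otimes> a \<ominus> s \<otimes> a') = \<zero>"
      using mem_fracD[OF as] by blast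
    obtain v where v: "b' \<in> carrier R" "t' \<in> M" "v \<in> M" "v \<otimes> (t' \<otimes> b \<ominus> t \<otimes> b') = \<zero>"
      using mem_fracD[OF bt] by blast
    note c = assms(1,3) mem_carrier[OF assms(2)] mem_carrier[OF assms(4)]
      u(1) v(1) mem_carrier[OF u(2)] mem_carrier[OF v(2)] mem_carrier[OF u(3)] mem_carrier[OF v(3)]
    \<comment> \<open>The representatives are exchanged one at a time: s't'ab - sta'b' = t'b(s'a -
      sa') + sa'(t'b - tb').\<close>
    have "(u \<otimes> v) \<otimes> ((s' \<otimes> t') \<otimes> (a \<otimes> b) \<ominus> (s \<otimes> t) \<otimes> (a' \<otimes> b')) =
        v \<otimes> t' \<otimes> b \<otimes> (u \<otimes> (s' \<otimes> a \<ominus> s \<otimes> a')) \<oplus> u \<otimes> s \<otimes> a' \<otimes> (v \<otimes> (t' \<otimes> b \<ominus> t \<otimes> b'))"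
      using c by algebra
    also have "\<dots> = \<zero>"
      unfolding u(4) v(4) using c by simp
    finally have "frac R M (a \<otimes> b) (s \<otimes> t) = frac R M (a' \<otimes> b') (s' \<otimes> t')"
      using assms u v mult_mem by (subst frac_eq_iff) auto
    then show ?thesis ..
  qed
  moreover have "frac R M a s \<noteq> {}" "frac R M b t \<noteq> {}"
    using frac_mem assms by blast+
  ultimately show ?thesis
    unfolding localization_def by (simp only: ring.simps monoid.simps) (rule UN_pairs_constant2)
qed

lemma localization_add:
  assumes "a \<in> carrier R" "s \<in> M" "b \<in> carrier R" "t \<in> M"
  shows "frac R M a s \<oplus>\<^bsub>localization R M\<^esub> frac R M b t = frac R M (t \<otimes> a \<oplus> s \<otimes> b) (s \<otimes> t)"
proof -
  have "frac R M (t' \<otimes> a' \<oplus> s' \<otimes> b') (s' \<otimes> t') = frac R M (t \<otimes> a \<oplus> s \<otimes> b) (s \<otimes> t)"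
    if as: "(a', s') \<in> frac R M a s" and bt: "(b', t') \<in> frac R M b t" for a' s' b' t'
  proof -
    obtain u where u: "a' \<in> carrier R" "s' \<in> M" "u \<in> M" "u \<otimes> (s' \<otimes> a \<ominus> s \<otimes> a') = \<zero>"
      using mem_fracD[OF as] by blast
    obtain v where v: "b' \<in> carrier R" "t' \<in> M" "v \<in> M" "v \<otimes> (t' \<otimes> b \<ominus> t \<otimes> b') = \<zero>"
      using mem_fracD[OF bt] by blast
    note c = assms(1,3) mem_carrier[OF assms(2)] mem_carrier[OF assms(4)]
      u(1) v(1) mem_carrier[OF u(2)] mem_carrier[OF v(2)] mem_carrier[OF u(3)] mem_carrier[OF v(3)]
    have "(u \<otimes> v) \<otimes> ((s' \<otimes> t') \<otimes> (t \<otimes> a \<oplus> s \<otimes> b) \<ominus> (s \<otimes> t) \<otimes> (t' \<otimes> a' \<oplus> s' \<otimes> b')) =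
        v \<otimes> t \<otimes> t' \<otimes> (u \<otimes> (s' \<otimes> a \<ominus> s \<otimes> a')) \<oplus> u \<otimes> s \<otimes> s' \<otimes> (v \<otimes> (t' \<otimes> b \<ominus> t \<otimes> b'))"
      using c by algebra
    also have "\<dots> = \<zero>"
      unfolding u(4) v(4) using c by simp
    finally have "\<exists>u\<in>M. u \<otimes> ((s' \<otimes> t') \<otimes> (t \<otimes> a \<oplus> s \<otimes> b) \<ominus> (s \<otimes> t) \<otimes> (t' \<otimes> a' \<oplus> s' \<otimes> b')) = \<zero>"
      using mult_mem[OF u(3) v(3)] by blast
    then have "frac R M (t \<otimes> a \<oplus> s \<otimes> b) (s \<otimes> t) = frac R M (t' \<otimes> a' \<oplus> s' \<otimes> b') (s' \<otimes> t')"
      using c assms(2,4) u(2) v(2) mult_mem by (simp add: frac_eq_iff)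
    then show ?thesis ..
  qed
  moreover have "frac R M a s \<noteq> {}" "frac R M b t \<noteq> {}"
    using frac_mem assms by blast+
  ultimately show ?thesis
    unfolding localization_def by (simp only: ring.simps monoid.simps) (rule UN_pairs_constant2)
qed

lemma localization_one: "\<one>\<^bsub>localization R M\<^esub> = frac R M \<one> \<one>"
  and localization_zero: "\<zero>\<^bsub>localization R M\<^esub> = frac R M \<zero> \<one>"
  by (simp_all add: localization_def)

lemma localization_cases:
  assumes "x \<in> carrier (localization R M)"
  obtains a s where "a \<in> carrier R" "s \<in> M" "s \<in> carrier R" "x = frac R M a s"
  using assms mem_carrier unfolding localization_carrier by blast

lemma frac_closed: "a \<in> carrier R \<Longrightarrow> s \<in> M \<Longrightarrow> frac R M a s \<in> carrier (localization R M)"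
  unfolding localization_carrier by blast

lemma localization_cring: "cring (localization R M)"
proof (rule cringI)
  note simps = localization_mult localization_add localization_one localization_zero frac_closed
    one_mem mult_mem
  show "abelian_group (localization R M)"
  proof (rule abelian_groupI)
    show "\<zero>\<^bsub>localization R M\<^esub> \<in> carrier (localization R M)"
      by (simp add: simps)
    fix x assume "x \<in> carrier (localization R M)"
    then obtain a s where x: "a \<in> carrier R" "s \<in> M" "s \<in> carrier R" "x = frac R M a s"
      by (rule localization_cases)
    show "\<zero>\<^bsub>localization R M\<^esub> \<oplus>\<^bsub>localization R M\<^esub> x = x"
      using x by (simp add: simps)
    \<comment> \<open>The sum of the fractions with numerators \<open>\<ominus> a\<close> and
      \<open>a\<close> has denominator \<open>s \<otimes> s\<close>, so it equals zero only as a
      class.\<close>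
    have "frac R M (s \<otimes> (\<ominus> a) \<oplus> s \<otimes> a) (s \<otimes> s) = frac R M \<zero> \<one>"
    proof (rule frac_eqI)
      show "\<one> \<otimes> (s \<otimes> (\<ominus> a) \<oplus> s \<otimes> a) = s \<otimes> s \<otimes> \<zero>"
        using x(1,3) by algebra
    qed (use x in \<open>simp_all add: simps\<close>)
    then show "\<exists>y\<in>carrier (localization R M). y \<oplus>\<^bsub>localization R M\<^esub> x = \<zero>\<^bsub>localization R M\<^esub>"
      using x by (intro bexI[of _ "frac R M (\<ominus> a) s"]) (simp_all add: simps)
    fix y assume "y \<in> carrier (localization R M)"
    then obtain b t where y: "b \<in> carrier R" "t \<in> M" "t \<in> carrier R" "y = frac R M b t"
      by (rule localization_cases)
    show "x \<oplus>\<^bsub>localization R M\<^esub> y \<in> carrier (localization R M)"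
      using x y by (simp add: simps)
    show "x \<oplus>\<^bsub>localization R M\<^esub> y = y \<oplus>\<^bsub>localization R M\<^esub> x"
      using x y by (simp add: simps a_comm m_comm)
    fix z assume "z \<in> carrier (localization R M)"
    then obtain d w where z: "d \<in> carrier R" "w \<in> M" "w \<in> carrier R" "z = frac R M d w"
      by (rule localization_cases)
    have "w \<otimes> (t \<otimes> a \<oplus> s \<otimes> b) \<oplus> (s \<otimes> t) \<otimes> d = (t \<otimes> w) \<otimes> a \<oplus> s \<otimes> (w \<otimes> b \<oplus> t \<otimes> d)"
      using x(1,3) y(1,3) z(1,3) by algebra
    then show "x \<oplus>\<^bsub>localization R M\<^esub> y \<oplus>\<^bsub>localization R M\<^esub> z =
        x \<oplus>\<^bsub>localization R M\<^esub> (y \<oplus>\<^bsub>localization R M\<^esub> z)"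
      using x y z by (simp add: simps m_assoc)
  qed
  show "comm_monoid (localization R M)"
  proof (rule comm_monoidI)
    show "\<one>\<^bsub>localization R M\<^esub> \<in> carrier (localization R M)"
      by (simp add: simps)
    fix x assume "x \<in> carrier (localization R M)"
    then obtain a s where x: "a \<in> carrier R" "s \<in> M" "s \<in> carrier R" "x = frac R M a s"
      by (rule localization_cases)
    show "\<one>\<^bsub>localization R M\<^esub> \<otimes>\<^bsub>localization R M\<^esub> x = x"
      using x by (simp add: simps)
    fix y assume "y \<in> carrier (localization R M)"
    then obtain b t where y: "b \<in> carrier R" "t \<in> M" "t \<in> carrier R" "y = frac R M b t"
      by (rule localization_cases)
    show "x \<otimes>\<^bsub>localization R M\<^esub> y \<in> carrier (localization R M)"
      using x y by (simp add: simps)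
    show "x \<otimes>\<^bsub>localization R M\<^esub> y = y \<otimes>\<^bsub>localization R M\<^esub> x"
      using x y by (simp add: simps m_comm)
    fix z assume "z \<in> carrier (localization R M)"
    then obtain d w where z: "d \<in> carrier R" "w \<in> M" "w \<in> carrier R" "z = frac R M d w"
      by (rule localization_cases)
    show "x \<otimes>\<^bsub>localization R M\<^esub> y \<otimes>\<^bsub>localization R M\<^esub> z =
        x \<otimes>\<^bsub>localization R M\<^esub> (y \<otimes>\<^bsub>localization R M\<^esub> z)"
      using x y z by (simp add: simps m_assoc)
  qed
  fix x y z
  assume "x \<in> carrier (localization R M)" "y \<in> carrier (localization R M)" "z \<in> carrier (localization R M)"
  then obtain a s b t d w where x: "a \<in> carrier R" "s \<in> M" "s \<in> carrier R" "x = frac R M a s"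
    and y: "b \<in> carrier R" "t \<in> M" "t \<in> carrier R" "y = frac R M b t"
    and z: "d \<in> carrier R" "w \<in> M" "w \<in> carrier R" "z = frac R M d w"
    by (meson localization_cases)
  have "frac R M ((t \<otimes> a \<oplus> s \<otimes> b) \<otimes> d) (s \<otimes> t \<otimes> w) =
      frac R M (t \<otimes> w \<otimes> (a \<otimes> d) \<oplus> s \<otimes> w \<otimes> (b \<otimes> d)) (s \<otimes> w \<otimes> (t \<otimes> w))"
  proof (rule frac_eqI)
    show "s \<otimes> w \<otimes> (t \<otimes> w) \<otimes> ((t \<otimes> a \<oplus> s \<otimes> b) \<otimes> d) =
        s \<otimes> t \<otimes> w \<otimes> (t \<otimes> w \<otimes> (a \<otimes> d) \<oplus> s \<otimes> w \<otimes> (b \<otimes> d))"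
      using x(1,3) y(1,3) z(1,3) by algebra
  qed (use x y z in \<open>simp_all add: simps\<close>)
  then show "(x \<oplus>\<^bsub>localization R M\<^esub> y) \<otimes>\<^bsub>localization R M\<^esub> z =
      x \<otimes>\<^bsub>localization R M\<^esub> z \<oplus>\<^bsub>localization R M\<^esub> y \<otimes>\<^bsub>localization R M\<^esub> z"
    using x y z by (simp add: simps)
qed

theorem ring_localization: "ring_localization R (localization R M) (\<lambda>a. frac R M a \<one>) M"
proof (intro ring_localization.intro ring_localization_axioms.intro)
  note simps = localization_mult localization_add localization_one localization_zero frac_closed
    one_mem mult_mem
  show "ring_hom_cring R (localization R M) (\<lambda>a. frac R M a \<one>)"
    by (rule ring_hom_cringI[OF is_cring localization_cring ring_hom_memI]) (simp_all add: simps)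
  show "M \<subseteq> carrier R" "\<one> \<in> M" "\<And>u v. u \<in> M \<Longrightarrow> v \<in> M \<Longrightarrow> u \<otimes> v \<in> M"
    by (rule subset one_mem mult_mem; assumption?)+
  show "\<exists>y\<in>carrier (localization R M). y \<otimes>\<^bsub>localization R M\<^esub> frac R M u \<one> = \<one>\<^bsub>localization R M\<^esub>"
    if "u \<in> M" for u
  proof -
    have "frac R M u u = frac R M \<one> \<one>"
      using that mem_carrier[OF that] by (intro frac_eqI) (simp_all add: simps)
    then show ?thesis
      using that mem_carrier[OF that] by (intro bexI[of _ "frac R M \<one> u"]) (simp_all add: simps)
  qed
  show "\<exists>u\<in>M. \<exists>a\<in>carrier R. frac R M u \<one> \<otimes>\<^bsub>localization R M\<^esub> y = frac R M a \<one>"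
    if y: "y \<in> carrier (localization R M)" for y
  proof -
    obtain a s where a: "a \<in> carrier R" "s \<in> M" "s \<in> carrier R" "y = frac R M a s"
      using y by (rule localization_cases)
    have "frac R M (s \<otimes> a) s = frac R M a \<one>"
      using a by (intro frac_eqI) (simp_all add: simps)
    then have "frac R M s \<one> \<otimes>\<^bsub>localization R M\<^esub> y = frac R M a \<one>"
      using a by (simp add: simps)
    with a show ?thesis by blast
  qed
  show "\<exists>u\<in>M. u \<otimes> a = \<zero>"
    if "a \<in> carrier R" "frac R M a \<one> = \<zero>\<^bsub>localization R M\<^esub>" for a
    using that by (simp add: localization_zero frac_eq_iff one_mem a_minus_def)
qed

text \<open>Fractions with numerator in \<open>Idl B\<close> already form an ideal; conversely, a/s
  is the multiple of a/1 by 1/s, and numerators with a/1 in the generated ideal form an ideal of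
  \<open>R\<close> containing \<open>B\<close>. This puts \<open>local_ideal_at\<close> into the
  form used by \<open>linear_type_localization_iff\<close>.\<close>

lemma extended_ideal_eq_Idl:
  assumes B: "B \<subseteq> carrier R"
  shows "{frac R M a s | a s. a \<in> Idl B \<and> s \<in> M} = Idl\<^bsub>localization R M\<^esub> ((\<lambda>a. frac R M a \<one>) ` B)"
    (is "?E = Idl\<^bsub>_\<^esub> (?h ` B)")
proof
  interpret l: ring_localization R "localization R M" ?h M by (rule ring_localization)
  note simps = localization_mult localization_add localization_one localization_zero frac_closed
    one_mem mult_mem
  note I = idealD[OF genideal_ideal[OF B]]
  have hB: "?h ` B \<subseteq> carrier (localization R M)"
    using B by (auto simp: simps)
  note K = l.S.idealD[OF l.S.genideal_ideal[OF hB]]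
  have EI: "frac R M a s \<in> ?E" if "a \<in> Idl B" "s \<in> M" for a s
    using that by blast
  have "ideal ?E (localization R M)"
  proof (rule l.S.ideal_memI)
    show "?E \<subseteq> carrier (localization R M)"
      using I(1) by (auto simp: simps)
    show "\<zero>\<^bsub>localization R M\<^esub> \<in> ?E"
      unfolding localization_zero by (rule EI[OF I(2) one_mem])
    fix x assume "x \<in> ?E"
    then obtain a s where x: "a \<in> Idl B" "s \<in> M" "x = frac R M a s"
      by blast
    note c = subsetD[OF I(1) x(1)] mem_carrier[OF x(2)]
    show "x \<oplus>\<^bsub>localization R M\<^esub> y \<in> ?E" if y: "y \<in> ?E" for y
    proof -
      obtain b t where b: "b \<in> Idl B" "t \<in> M" "y = frac R M b t"
        using y by blast
      note d = subsetD[OF I(1) b(1)] mem_carrier[OF b(2)]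
      show ?thesis
        unfolding x(3) b(3) localization_add[OF c(1) x(2) d(1) b(2)]
        by (intro EI I(3) I(5) mult_mem x b c d)
    qed
    show "y \<otimes>\<^bsub>localization R M\<^esub> x \<in> ?E" if y: "y \<in> carrier (localization R M)" for y
    proof -
      obtain b t where b: "b \<in> carrier R" "t \<in> M" "y = frac R M b t"
        using localization_cases[OF y] by metis
      show ?thesis
        unfolding x(3) b(3) localization_mult[OF b(1,2) c(1) x(2)]
        by (intro EI I(5) mult_mem x b)
    qed
  qed
  moreover have "?h ` B \<subseteq> ?E"
    using genideal_self[OF B] one_mem by blast
  ultimately show "Idl\<^bsub>localization R M\<^esub> (?h ` B) \<subseteq> ?E"
    by (rule l.S.genideal_minimal)
  have "B \<subseteq> {r \<in> carrier R. ?h r \<in> Idl\<^bsub>localization R M\<^esub> (?h ` B)}"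
    using B l.S.genideal_self[OF hB] by blast
  then have sub: "Idl B \<subseteq> {r \<in> carrier R. ?h r \<in> Idl\<^bsub>localization R M\<^esub> (?h ` B)}"
    by (intro genideal_minimal l.vimage_ideal l.S.genideal_ideal hB)
  show "?E \<subseteq> Idl\<^bsub>localization R M\<^esub> (?h ` B)"
  proof
    fix x assume "x \<in> ?E"
    then obtain a s where x: "a \<in> Idl B" "s \<in> M" "x = frac R M a s"
      by blast
    have a: "a \<in> carrier R" "?h a \<in> Idl\<^bsub>localization R M\<^esub> (?h ` B)"
      using sub x(1) by auto
    have "x = frac R M \<one> s \<otimes>\<^bsub>localization R M\<^esub> ?h a"
      using a(1) x(2,3) mem_carrier[OF x(2)] by (simp add: simps)
    then show "x \<in> Idl\<^bsub>localization R M\<^esub> (?h ` B)"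
      using K(5)[OF a(2) frac_closed[OF one_closed x(2)]] by simp
  qed
qed

end

section \<open>The conductor and the locus of linear type\<close>

text \<open>Closed sets of the Zariski topology are given by ideals, so this is what makes the
  complement of the zeros of the conductor open.\<close>

lemma (in cring) conductor_ideal:
  assumes fs: "set fs \<subseteq> carrier R"
  shows "ideal (conductor R fs) R"
proof (rule ideal_memI)
  let ?n = "length fs"
  interpret c: ring_hom_cring R "mpoly_ring R ?n" indexed_const by (rule mpoly_const_hom)
  note L = c.S.idealD[OF linear_ideal_ideal[OF fs]]
  have J: "F \<in> carrier (mpoly_ring R ?n)" if "F \<in> rees_ideal R fs" for F
    using that mem_rees_ideal_iff[OF fs] by blast
  show "conductor R fs \<subseteq> carrier R"
    by (auto simp: conductor_def)
  show "\<zero> \<in> conductor R fs"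
    using J L(2) by (simp add: conductor_def)
  fix r assume r: "r \<in> conductor R fs"
  show "r \<oplus> q \<in> conductor R fs" if "q \<in> conductor R fs" for q
    using r that J L(3) by (simp add: conductor_def c.S.l_distr)
  show "q \<otimes> r \<in> conductor R fs" if "q \<in> carrier R" for q
    using r that J L(5) by (simp add: conductor_def c.S.m_assoc)
qed

text \<open>For \<open>M\<close> the complement of a prime \<open>P\<close>, the conductor meets
  \<open>M\<close> exactly if it is not contained in \<open>P\<close>. Primality, including
  properness, makes this complement multiplicative.\<close>

lemma (in cring) linear_type_locus_eq:
  assumes noeth: "noetherian_ring R" and gen: "generators R fs I"
  shows "linear_type_locus R I = Spec R - zeros R (conductor R fs)"
proof -
  have fs: "set fs \<subseteq> carrier R" and I: "I = Idl (set fs)"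
    using gen by (auto simp: generators_def)
  have "linear_type (local_ring_at R P) (local_ideal_at R P I) \<longleftrightarrow> \<not> conductor R fs \<subseteq> P"
    if "P \<in> Spec R" for P
  proof -
    let ?M = "carrier R - P"
    interpret P: primeideal P R
      using that by (simp add: Spec_def)
    interpret M: multiplicative_subset R ?M
    proof unfold_locales
      show "\<one> \<in> ?M"
        using P.one_imp_carrier P.I_notcarr by auto
      show "u \<otimes> v \<in> ?M" if "u \<in> ?M" "v \<in> ?M" for u v
        using that P.I_prime by blast
    qed blast
    interpret l: ring_localization R "localization R ?M" "\<lambda>a. frac R ?M a \<one>" ?M
      by (rule M.ring_localization)
    have "local_ideal_at R P I = Idl\<^bsub>localization R ?M\<^esub> ((\<lambda>a. frac R ?M a \<one>) ` set fs)"
      unfolding local_ideal_at_def I by (rule M.extended_ideal_eq_Idl[OF fs])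
    then have "linear_type (local_ring_at R P) (local_ideal_at R P I) \<longleftrightarrow> ?M \<inter> conductor R fs \<noteq> {}"
      unfolding local_ring_at_def using l.linear_type_localization_iff[OF fs noeth] by simp
    also have "\<dots> \<longleftrightarrow> \<not> conductor R fs \<subseteq> P"
      using idealD(1)[OF conductor_ideal[OF fs]] by blast
    finally show ?thesis .
  qed
  then show ?thesis
    by (auto simp: linear_type_locus_def zeros_def)
qed

theorem lemma1p3:
  fixes R :: "('a, 'm) ring_scheme" and I :: "'a set"
  assumes "cring R" and "noetherian_ring R" and "ideal I R"
  shows "openin (zariski_topology R) (linear_type_locus R I) \<and>
    (\<forall>fs. generators R fs I \<longrightarrow> linear_type_locus R I = Spec R - zeros R (conductor R fs))"
proof -
  interpret cring R by (rule assms(1))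
  interpret noetherian_ring R by (rule assms(2))
  \<comment> \<open>Openness does not refer to generators, so one finite system is chosen for it;
    the formula for the locus is available for every system.\<close>
  obtain A where A: "A \<subseteq> carrier R" "finite A" "I = Idl\<^bsub>R\<^esub> A"
    using finetely_gen[OF assms(3)] by blast
  obtain fs where fs: "set fs = A"
    using finite_list[OF A(2)] by blast
  have "generators R fs I"
    using A fs by (simp add: generators_def)
  then have "linear_type_locus R I = Spec R - zeros R (conductor R fs)"
    by (rule linear_type_locus_eq[OF assms(2)])
  moreover have "ideal (conductor R fs) R"
    using A(1) fs by (intro conductor_ideal) simp
  ultimately have "openin (zariski_topology R) (linear_type_locus R I)"
    unfolding openin_zariski by blast
  then show ?thesis
    using linear_type_locus_eq[OF assms(2)] by blast
qed

end
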